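(* Let $k$ be an algebraically closed field and let $\alpha,\beta,\gamma$ be partitions with $\alpha_1\leq 2$. For embeddings $Y=(N_\alpha,N_\beta,f)$ and $Z=(N_\alpha,N_\beta,g)$ with $f,g\in V_{\alpha,\gamma}^\beta(k)$ we have $$Y\leq_{\rm deg} Z\quad\text{if and only if}\quad Y\leq_{\rm arc} Z.$$
   Context: For a partition $\alpha=(\alpha_1\geq\cdots\geq\alpha_s)$ let $N_\alpha=N_\alpha(k)=\bigoplus_{i}k[T]/(T^{\alpha_i})$, a $k[T]$-module (a nilpotent linear operator). For partitions $\alpha,\beta,\gamma$, let $V_{\alpha,\gamma}^\beta(k)$ be the set of injective $k[T]$-homomorphisms $f:N_\alpha\to N_\beta$ with $\operatorname{Coker} f\cong N_\gamma$, viewed as a subset of the affine space $\operatorname{Hom}_k(N_\alpha,N_\beta)$ with the induced Zariski topology. The group $\operatorname{Aut}_{k[T]}(N_\alpha)\times\operatorname{Aut}_{k[T]}(N_\beta)$ acts on $V_{\alpha,\gamma}^\beta(k)$ by $(a,h)\cdot f=hfa^{-1}$; let $G_f(k)$ be the orbit of $f$. Define $(N_\alpha,N_\beta,f)\leq_{\rm deg}(N_\alpha,N_\beta,g)$ if $G_g(k)$ is contained in the closure of $G_f(k)$ in $V_{\alpha,\gamma}^\beta(k)$. Indecomposable embeddings with $\alpha_1\le 2$: the pickets $P_\ell^m=(N_{(\ell)},N_{(m)},\iota)$ for $0\le \ell\le\min\{2,m\}$ ($\iota$ the inclusion of the unique $\ell$-dimensional $T$-invariant subspace) and the bipickets $B_2^{m,r}=(N_{(2)},N_{(m,r)},\delta)$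 for $1\le r\le m-2$, with $\delta(1)=(T^{m-2},T^{r-1})$. Every embedding $(N_\alpha,N_\beta,f)$ with $\alpha_1\le 2$ is isomorphic (via pairs of isomorphisms compatible with the maps) to a direct sum of pickets and bipickets, uniquely up to order. Arc diagrams: an arc diagram is a finite multiset of arcs $(m,r)$ with integers $m>r\ge1$ and poles at integer positions $m\ge1$. The arc diagram $\Delta(Y)$ of an embedding $Y$ with $\alpha_1\le2$ contains, for each direct summand $B_2^{m,r}$, an arc $(m,r)$; for each summand $P_2^m$, an arc $(m,m-1)$; for each summand $P_1^m$, a pole at $m$; summands $P_0^m$ contribute nothing. Moves: for $m>n>r>s$, (A) replaces two arcs $(m,r),(n,s)$ by $(m,s),(n,r)$; (C) replaces two arcs $(m,r),(n,s)$ by $(m,n),(r,s)$; for $m>r>s$, (B) replaces an arc $(m,s)$ and a pole at $r$ by an arc $(m,r)$ and a pole at $s$; (D) replaces an arc $(m,s)$ and a pole at $r$ by a pole at $m$ and an arc $(r,s)$. Write $\Delta\leq_{\rm arc}\Delta'$ if $\Delta$ is obtained from $\Delta'$ by a finite (possibly empty) sequence of such moves, and $Y\leq_{\rm arc}Z$ if $\Delta(Y)\leq_{\rm arc}\Delta(Z)$. *)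

theory Defs
  imports "HOL-Analysis.Analysis" "HOL-Computational_Algebra.Polynomial" "HOL-Library.Multiset"
begin

text \<open>For a list xs of natural numbers, N_xs is the direct sum of k[T]/(T^(xs!i)).
  We use the k-basis e_(i,j) = T^j (generator of the i-th summand), with
  i < length xs and j < xs!i.  T sends e_(i,j) to e_(i,j+1) (or to 0 if j+1 = xs!i).\<close>

type_synonym idx = "nat \<times> nat"
type_synonym 'k mat = "idx \<Rightarrow> idx \<Rightarrow> 'k"
type_synonym 'k vec = "idx \<Rightarrow> 'k"

definition Bas :: "nat list \<Rightarrow> idx set" where
  "Bas xs = {(i, j). i < length xs \<and> j < xs ! i}"

definition is_partition :: "nat list \<Rightarrow> bool" where
  "is_partition xs \<longleftrightarrow> sorted_wrt (\<ge>) xs \<and> 0 \<notin> set xs"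

text \<open>k-linear maps N_xs \<rightarrow> N_ys as matrices indexed by Bas ys \<times> Bas xs
  (the affine space Hom_k(N_xs, N_ys)).\<close>
definition Hom :: "nat list \<Rightarrow> nat list \<Rightarrow> ('k::zero) mat set" where
  "Hom xs ys = {M. \<forall>b a. (b \<notin> Bas ys \<or> a \<notin> Bas xs) \<longrightarrow> M b a = 0}"

definition vec_on :: "idx set \<Rightarrow> ('k::zero) vec \<Rightarrow> bool" where
  "vec_on K v \<longleftrightarrow> (\<forall>a. a \<notin> K \<longrightarrow> v a = 0)"

definition mv :: "idx set \<Rightarrow> ('k::comm_semiring_1) mat \<Rightarrow> 'k vec \<Rightarrow> 'k vec" where
  "mv K M v = (\<lambda>b. \<Sum>a\<in>K. M b a * v a)"

definition mmul :: "idx set \<Rightarrow> ('k::comm_semiring_1) mat \<Rightarrow> 'k mat \<Rightarrow> 'k mat" where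
  "mmul K P Q = (\<lambda>b a. \<Sum>c\<in>K. P b c * Q c a)"

definition idm :: "nat list \<Rightarrow> ('k::comm_semiring_1) mat" where
  "idm xs = (\<lambda>b a. if a \<in> Bas xs \<and> b = a then 1 else 0)"

definition tmat :: "nat list \<Rightarrow> ('k::comm_semiring_1) mat" where
  "tmat xs = (\<lambda>b a. if a \<in> Bas xs \<and> b \<in> Bas xs \<and> fst b = fst a \<and> snd b = Suc (snd a)
                    then 1 else 0)"

definition is_hom :: "nat list \<Rightarrow> nat list \<Rightarrow> ('k::comm_semiring_1) mat \<Rightarrow> bool" where
  "is_hom xs ys M \<longleftrightarrow> M \<in> Hom xs ys \<and>
     mmul (Bas xs) M (tmat xs) = mmul (Bas ys) (tmat ys) M"

definition is_iso :: "nat list \<Rightarrow> nat list \<Rightarrow> ('k::comm_semiring_1) mat \<Rightarrow> bool" where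
  "is_iso xs ys P \<longleftrightarrow> is_hom xs ys P \<and>
     (\<exists>Q. is_hom ys xs Q \<and> mmul (Bas ys) Q P = idm xs \<and> mmul (Bas xs) P Q = idm ys)"

definition Aut :: "nat list \<Rightarrow> ('k::comm_semiring_1) mat set" where
  "Aut xs = {A. is_iso xs xs A}"

definition inj_mat :: "nat list \<Rightarrow> nat list \<Rightarrow> ('k::comm_semiring_1) mat \<Rightarrow> bool" where
  "inj_mat xs ys M \<longleftrightarrow>
     (\<forall>v. vec_on (Bas xs) v \<and> (\<forall>b\<in>Bas ys. mv (Bas xs) M v b = 0) \<longrightarrow> (\<forall>a. v a = 0))"

text \<open>Coker M \<cong> N_gs as k[T]-modules, expressed as: there is a surjective k[T]-homomorphism
  P : N_ys \<rightarrow> N_gs whose kernel is the image of M.\<close>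
definition coker_iso :: "nat list \<Rightarrow> nat list \<Rightarrow> nat list \<Rightarrow> ('k::comm_semiring_1) mat \<Rightarrow> bool" where
  "coker_iso xs ys gs M \<longleftrightarrow>
     (\<exists>P. is_hom ys gs P \<and>
        (\<forall>u. vec_on (Bas gs) u \<longrightarrow>
             (\<exists>w. vec_on (Bas ys) w \<and> (\<forall>c\<in>Bas gs. mv (Bas ys) P w c = u c))) \<and>
        (\<forall>w. vec_on (Bas ys) w \<longrightarrow>
             ((\<forall>c\<in>Bas gs. mv (Bas ys) P w c = 0) \<longleftrightarrow>
              (\<exists>v. vec_on (Bas xs) v \<and> (\<forall>b\<in>Bas ys. w b = mv (Bas xs) M v b)))))"

definition Vset :: "nat list \<Rightarrow> nat list \<Rightarrow> nat list \<Rightarrow> ('k::comm_semiring_1) mat set" where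
  "Vset as bs gs = {M. is_hom as bs M \<and> inj_mat as bs M \<and> coker_iso as bs gs M}"

text \<open>Orbit of f under Aut(N_as) \<times> Aut(N_bs), acting by (a,h).f = h f a^{-1};
  as a ranges over Aut, so does a^{-1}.\<close>
definition orbit :: "nat list \<Rightarrow> nat list \<Rightarrow> ('k::comm_semiring_1) mat \<Rightarrow> 'k mat set" where
  "orbit as bs M = {mmul (Bas as) (mmul (Bas bs) H M) A | A H. A \<in> Aut as \<and> H \<in> Aut bs}"

inductive_set polyfun :: "(('k::comm_ring_1) mat \<Rightarrow> 'k) set" where
  pf_const: "(\<lambda>M. c) \<in> polyfun"
| pf_coord: "(\<lambda>M. M b a) \<in> polyfun"
| pf_add: "p \<in> polyfun \<Longrightarrow> q \<in> polyfun \<Longrightarrow> (\<lambda>M. p M + q M) \<in> polyfun"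
| pf_mult: "p \<in> polyfun \<Longrightarrow> q \<in> polyfun \<Longrightarrow> (\<lambda>M. p M * q M) \<in> polyfun"

definition zariski :: "('k::comm_ring_1) mat set \<Rightarrow> 'k mat topology" where
  "zariski X = topology (\<lambda>U. \<exists>F \<subseteq> polyfun. U = X - {M \<in> X. \<forall>p\<in>F. p M = 0})"

definition deg_le :: "nat list \<Rightarrow> nat list \<Rightarrow> nat list \<Rightarrow> ('k::comm_ring_1) mat \<Rightarrow> 'k mat \<Rightarrow> bool" where
  "deg_le as bs gs f g \<longleftrightarrow>
     orbit as bs g \<subseteq> (subtopology (zariski (Hom as bs)) (Vset as bs gs)) closure_of (orbit as bs f)"

type_synonym 'k emb = "nat list \<times> nat list \<times> 'k mat"

datatype summand = Picket nat nat \<comment> \<open>P_l^m\<close> | Bipicket nat nat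

fun valid_summand :: "summand \<Rightarrow> bool" where
  "valid_summand (Picket l m) \<longleftrightarrow> 1 \<le> m \<and> l \<le> 2 \<and> l \<le> m"
| "valid_summand (Bipicket m r) \<longleftrightarrow> 1 \<le> r \<and> r + 2 \<le> m"

fun summand_emb :: "summand \<Rightarrow> ('k::comm_semiring_1) emb" where
  "summand_emb (Picket l m) =
     ([l], [m], \<lambda>b a. if a \<in> Bas [l] \<and> b = (0, m - l + snd a) then 1 else 0)"
| "summand_emb (Bipicket m r) =
     ([2], [m, r], \<lambda>b a.
        if a = (0, 0) then (if b = (0, m - 2) \<or> b = (1, r - 1) then 1 else 0)
        else if a = (0, 1) then (if b = (0, m - 1) then 1 else 0)
        else 0)"

fun dsum :: "('k::zero) emb \<Rightarrow> 'k emb \<Rightarrow> 'k emb" where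
  "dsum (xs, ys, M) (xs', ys', M') =
     (xs @ xs', ys @ ys', \<lambda>(i, j) (i', j').
        if i < length ys \<and> i' < length xs then M (i, j) (i', j')
        else if length ys \<le> i \<and> length xs \<le> i' then M' (i - length ys, j) (i' - length xs, j')
        else 0)"

fun dsum_list :: "summand list \<Rightarrow> ('k::comm_semiring_1) emb" where
  "dsum_list [] = ([], [], (\<lambda>b a. 0))"
| "dsum_list (s # ss) = dsum (summand_emb s) (dsum_list ss)"

fun emb_iso :: "('k::comm_semiring_1) emb \<Rightarrow> 'k emb \<Rightarrow> bool" where
  "emb_iso (xs, ys, M) (xs', ys', M') \<longleftrightarrow>
     (\<exists>\<phi> \<psi>. is_iso xs xs' \<phi> \<and> is_iso ys ys' \<psi> \<and>
        mmul (Bas ys) \<psi> M = mmul (Bas xs') M' \<phi>)"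

datatype arcitem = Arc nat nat | Pole nat

fun summand_diag :: "summand \<Rightarrow> arcitem multiset" where
  "summand_diag (Bipicket m r) = {#Arc m r#}"
| "summand_diag (Picket l m) =
     (if l = 2 then {#Arc m (m - 1)#} else if l = 1 then {#Pole m#} else {#})"

definition arc_diag :: "('k::comm_semiring_1) emb \<Rightarrow> arcitem multiset" where
  "arc_diag Y = (THE D. \<exists>ss. list_all valid_summand ss \<and> emb_iso Y (dsum_list ss) \<and>
                       D = sum_list (map summand_diag ss))"

inductive arc_move :: "arcitem multiset \<Rightarrow> arcitem multiset \<Rightarrow> bool" where
  moveA: "m > n \<Longrightarrow> n > r \<Longrightarrow> r > s \<Longrightarrow>
     arc_move (E + {#Arc m r, Arc n s#}) (E + {#Arc m s, Arc n r#})"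
| moveC: "m > n \<Longrightarrow> n > r \<Longrightarrow> r > s \<Longrightarrow>
     arc_move (E + {#Arc m r, Arc n s#}) (E + {#Arc m n, Arc r s#})"
| moveB: "m > r \<Longrightarrow> r > s \<Longrightarrow>
     arc_move (E + {#Arc m s, Pole r#}) (E + {#Arc m r, Pole s#})"
| moveD: "m > r \<Longrightarrow> r > s \<Longrightarrow>
     arc_move (E + {#Arc m s, Pole r#}) (E + {#Pole m, Arc r s#})"

definition arc_le :: "arcitem multiset \<Rightarrow> arcitem multiset \<Rightarrow> bool" where
  "arc_le D D' \<longleftrightarrow> arc_move\<^sup>*\<^sup>* D' D"

end

theory Submission
  imports Defs "HOL-Library.Function_Algebras"
begin

text \<open>The invariants \<open>dim {v. f v \<in> T^p B + (T^q B \<inter> soc B)}\<close> of an embedding \<open>f\<close> of \<open>A\<close> into \<open>B\<close> are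
  additive and can be read off the arc diagram: up to terms fixed by the three partitions they count
  the arcs lying inside an interval. They can only grow under degeneration, so if \<open>g\<close> lies in the
  closure of the orbit of \<open>f\<close>, every interval contains at least as many arcs of the diagram of \<open>f\<close>
  as of the diagram of \<open>g\<close>, while the end points agree. A suitable extremal pair of
  arcs in the diagram of \<open>g\<close> then admits a move that keeps this domination and strictly increases some count, so the diagram of \<open>f\<close> is reached after
  finitely many moves. The same counts determine the diagram, which makes it well defined.
  Conversely every single move is realised by an affine line of homomorphisms that at the parameter
  \<open>0\<close> is the old embedding and everywhere else is isomorphic to the new one; since the field is
  infinite, the old one lies in the closure. The decomposition into pickets and bipickets is obtained
  by splitting off summands of maximal height with the help of linear functionals.\<close>

subsection \<open>Uncrossing systems of arcs\<close>

text \<open>Two parameters occur because the generator of \<open>N_(2)\<close> in a bipicket has two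
  components: \<open>T^(m-2)\<close> in the long summand and the socle element
  \<open>T^(r-1)\<close> in the short one. For \<open>q \<le> p\<close> it lies in
  \<open>T^p B + (T^q B \<inter> soc B)\<close> iff \<open>p + 2 \<le> m\<close> and
  \<open>q + 1 \<le> r\<close>, so lowering \<open>p\<close> to \<open>q\<close> gains exactly one
  dimension per arc inside \<open>[q+1, p+1]\<close>. At \<open>p = q\<close> the invariant is
  \<open>dim (A \<inter> T^q B) = dim T^q B - dim T^q (B/A)\<close>, fixed by \<open>\<beta>\<close>
  and \<open>\<gamma>\<close>; the number of arcs is the number of parts \<open>2\<close> of
  \<open>\<alpha>\<close>. The combinatorial obstacle is that a crossing pair cannot be chosen
  freely: an uncrossing may overshoot and give some interval more arcs than the target has. The pair
  is sought next to the largest left end, where an arc of the target leaves the slack that is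
  needed. In the decomposition, the height of \<open>T a\<close> and then the height of
  \<open>a\<close> must be made maximal, in this order, for a bipicket to split off.\<close>

definition arcs_within :: "nat \<Rightarrow> nat \<Rightarrow> (nat \<times> nat) multiset \<Rightarrow> nat" where
  "arcs_within a b D = size (filter_mset (\<lambda>d. a \<le> snd d \<and> fst d \<le> b) D)"

definition ends :: "(nat \<times> nat) multiset \<Rightarrow> nat multiset" where
  "ends D = image_mset fst D + image_mset snd D"

text \<open>In an arc \<open>(m, r)\<close> the first component is the right end. Both rules start
  from a crossing pair \<open>s < r < n < m\<close> and keep its four end points.\<close>

inductive uncross :: "(nat \<times> nat) multiset \<Rightarrow> (nat \<times> nat) multiset \<Rightarrow> bool" where
  nest: "m > n \<Longrightarrow> n > r \<Longrightarrow> r > s \<Longrightarrow> uncross (E + {#(m,r),(n,s)#}) (E + {#(m,s),(n,r)#})"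
| sep: "m > n \<Longrightarrow> n > r \<Longrightarrow> r > s \<Longrightarrow> uncross (E + {#(m,r),(n,s)#}) (E + {#(m,n),(r,s)#})"

lemma arcs_within_empty [simp]: "arcs_within a b {#} = 0"
  by (simp add: arcs_within_def)

lemma arcs_within_add [simp]:
  "arcs_within a b (add_mset d D) = (if a \<le> snd d \<and> fst d \<le> b then 1 else 0) + arcs_within a b D"
  by (simp add: arcs_within_def)

lemma arcs_within_union [simp]: "arcs_within a b (D + E) = arcs_within a b D + arcs_within a b E"
  by (simp add: arcs_within_def)

text \<open>Integer form of the count, since the weights in \<open>uncross_step\<close> carry
  signs.\<close>

lemma int_arcs_within: "int (arcs_within a b D) = (\<Sum>d\<in>#D. if a \<le> snd d \<and> fst d \<le> b then 1 else 0)"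
  by (induction D) auto

lemma arcs_within_pos: "d \<in># D \<Longrightarrow> a \<le> snd d \<Longrightarrow> fst d \<le> b \<Longrightarrow> arcs_within a b D \<ge> 1"
  by (auto dest!: multi_member_split)

lemma arcs_within_ex: "arcs_within a b D \<ge> 1 \<Longrightarrow> \<exists>d. d \<in># D \<and> a \<le> snd d \<and> fst d \<le> b"
  by (induction D) (auto split: if_splits, blast)

lemma arcs_within_cong_le:
  "(\<And>d. d \<in># D \<Longrightarrow> a \<le> snd d \<Longrightarrow> fst d \<le> b \<Longrightarrow> a' \<le> snd d \<and> fst d \<le> b') \<Longrightarrow> arcs_within a b D \<le> arcs_within a' b' D"
  by (induction D) auto

lemma arcs_within_less:
  assumes "e \<in># D" "a' \<le> snd e" "fst e \<le> b'" "\<not> (a \<le> snd e \<and> fst e \<le> b)" "a' \<le> a" "b \<le> b'"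
  shows "arcs_within a b D < arcs_within a' b' D"
proof -
  obtain D' where D: "D = add_mset e D'" using assms(1) by (auto dest: multi_member_split)
  have "arcs_within a b D' \<le> arcs_within a' b' D'" by (rule arcs_within_cong_le) (use assms in auto)
  then show ?thesis using assms D by auto
qed

lemma size_filter_ends:
  "int (size (filter_mset P (ends D))) = (\<Sum>d\<in>#D. (if P (fst d) then 1 else 0) + (if P (snd d) then 1 else 0))"
  unfolding ends_def by (induction D) auto

lemma ends_add [simp]: "ends (add_mset d D) = {#fst d, snd d#} + ends D"
  by (simp add: ends_def)

lemma ends_union [simp]: "ends (D + E) = ends D + ends E"
  by (simp add: ends_def)

lemma ends_empty [simp]: "ends {#} = {#}" by (simp add: ends_def)

lemma size_ends: "size (ends D) = 2 * size D"
  by (simp add: ends_def)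

lemma mem_ends: "x \<in># ends D \<longleftrightarrow> (\<exists>d. d \<in># D \<and> (x = fst d \<or> x = snd d))"
  by (auto simp: ends_def image_iff) force+

lemma uncross_add: "uncross Z Z' \<Longrightarrow> uncross (add_mset d Z) (add_mset d Z')"
proof (induction rule: uncross.induct)
  case (nest m n r s E)
  then show ?case using uncross.nest[of n m r s "add_mset d E"] by (simp add: add_mset_commute)
next
  case (sep m n r s E)
  then show ?case using uncross.sep[of n m r s "add_mset d E"] by (simp add: add_mset_commute)
qed

lemma uncross_rtrancl_add: "uncross\<^sup>*\<^sup>* Z Z' \<Longrightarrow> uncross\<^sup>*\<^sup>* (add_mset d Z) (add_mset d Z')"
  by (induction rule: rtranclp_induct) (auto intro: uncross_add rtranclp.rtrancl_into_rtrancl)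

text \<open>Let \<open>r\<close> be the largest left end and \<open>(n, r)\<close> the shortest arc
  of \<open>Y\<close> starting there. This arc is counted in \<open>Y\<close> but cannot be matched
  in \<open>Z\<close>, which is the slack that pays for the new arcs of the move. The strict growth
  is asserted for the interval of an arc of \<open>Z'\<close>, so that it falls into the range of
  the termination measure.\<close>

lemma uncross_step:
  assumes wY: "\<And>d. d \<in># Y \<Longrightarrow> snd d < fst d" and wZ: "\<And>d. d \<in># Z \<Longrightarrow> snd d < fst d"
    and ends: "ends Y = ends Z" and le: "\<And>a b. arcs_within a b Z \<le> arcs_within a b Y"
    and disj: "\<And>d. d \<in># Y \<Longrightarrow> d \<notin># Z" and ne: "Z \<noteq> {#}"
  shows "\<exists>Z'. uncross Z Z' \<and> (\<forall>a b. arcs_within a b Z' \<le> arcs_within a b Y) \<and> (\<exists>d. d \<in># Z' \<and> arcs_within (snd d) (fst d) Z < arcs_within (snd d) (fst d) Z')"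
proof -
  define r where "r = Max (set_mset (image_mset snd (Y + Z)))"
  have fin: "finite (set_mset (image_mset snd (Y + Z)))" by simp
  have rmax: "snd d \<le> r" if "d \<in># Y \<or> d \<in># Z" for d
    unfolding r_def by (rule Max_ge[OF fin]) (use that in auto)
  have "r \<in> set_mset (image_mset snd (Y + Z))"
    unfolding r_def by (rule Max_in[OF fin]) (use ne in auto)
  then obtain d0 where d0: "d0 \<in># Y \<or> d0 \<in># Z" "snd d0 = r" by auto
  \<comment> \<open>Domination on \<open>[r, x]\<close> yields an arc of \<open>Y\<close> in this
    interval; by maximality of \<open>r\<close> it must start at \<open>r\<close>.\<close>
  have exY: "\<exists>n''. (n'', r) \<in># Y \<and> n'' \<le> x" if x: "(x, r) \<in># Z" for x
  proof -
    have "arcs_within r x Z \<ge> 1" using arcs_within_pos[OF x] by auto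
    then have "arcs_within r x Y \<ge> 1" using le[where a=r and b=x] by linarith
    then obtain d where "d \<in># Y" "r \<le> snd d" "fst d \<le> x" using arcs_within_ex by blast
    then show ?thesis using rmax[of d] by (metis le_antisym prod.collapse)
  qed
  have "\<exists>n. (n, r) \<in># Y" using d0 exY by (metis prod.collapse)
  define n where "n = (LEAST n. (n, r) \<in># Y)"
  have nY: "(n, r) \<in># Y" unfolding n_def using \<open>\<exists>n. (n, r) \<in># Y\<close> by (rule LeastI_ex)
  have nmin: "n \<le> n'" if "(n', r) \<in># Y" for n' unfolding n_def using that by (rule Least_le)
  have rn: "r < n" using wY[OF nY] by simp
  have filt: "size (filter_mset P (ends Y)) = size (filter_mset P (ends Z))" for P by (simp add: ends)
  show ?thesis
  proof (cases "\<exists>x. (x, r) \<in># Z")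
    case True
    define x where "x = (LEAST x. (x, r) \<in># Z)"
    have xZ: "(x, r) \<in># Z" unfolding x_def using True by (rule LeastI_ex)
    have xmin: "x \<le> x'" if "(x', r) \<in># Z" for x' unfolding x_def using that by (rule Least_le)
    have "n \<le> x" using exY[OF xZ] nmin by fastforce
    moreover have "n \<noteq> x" using disj[OF nY] xZ by auto
    ultimately have nx: "n < x" by simp
    \<comment> \<open>Left ends of the arcs of \<open>Z\<close> that cross \<open>(x, r)\<close> and
      end in \<open>[n, x)\<close>.\<close>
    define C where "C = {s. \<exists>n'. (n', s) \<in># Z \<and> n \<le> n' \<and> n' < x \<and> s < r}"
    \<comment> \<open>\<open>n\<close> is also an end point of \<open>Z\<close>. Being larger than
      \<open>r\<close> it is a right end, and minimality of \<open>x\<close> keeps its arc from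
      starting at \<open>r\<close>; so \<open>C\<close> is nonempty.\<close>
    have "n \<in># ends Z" using nY ends[symmetric] by (force simp: mem_ends)
    then obtain d where d: "d \<in># Z" "n = fst d \<or> n = snd d" by (auto simp: mem_ends)
    have "n = fst d" using d rmax[of d] rn by auto
    moreover have "snd d \<noteq> r" using d xmin[of n] nx calculation by (metis leD prod.collapse)
    ultimately have "snd d \<in> C" using d rmax[of d] nx unfolding C_def
      by (auto intro!: exI[of _ n])
    have finC: "finite C" by (rule finite_subset[of _ "{..<r}"]) (auto simp: C_def)
    define s where "s = Max C"
    have "s \<in> C" unfolding s_def using finC \<open>snd d \<in> C\<close> by (intro Max_in) auto
    then obtain n' where n': "(n', s) \<in># Z" "n \<le> n'" "n' < x" and sr: "s < r" by (auto simp: C_def)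
    have smax: "s' \<le> s" if "s' \<in> C" for s' unfolding s_def using finC that by simp
    obtain E where E: "Z = add_mset (x, r) (add_mset (n', s) E)"
      using xZ n' sr by (metis (no_types, lifting) insert_noteq_member less_irrefl multi_member_split prod.inject)
    define Z' where "Z' = add_mset (x, s) (add_mset (n', r) E)"
    have unc: "uncross Z Z'" using uncross.nest[of n' x r s E] n' nx sr rn by (simp add: E Z'_def)
    \<comment> \<open>These are the only intervals that gain an arc by the move: they contain
      \<open>(n', r)\<close> but neither \<open>(x, r)\<close> nor \<open>(n', s)\<close>.
      Maximality of \<open>s\<close> forces all arcs of \<open>Z\<close> in them to end before
      \<open>n\<close>, whereas \<open>Y\<close> has \<open>(n, r)\<close> in addition.\<close>
    have strict: "arcs_within a b Z < arcs_within a b Y" if ab: "s < a" "a \<le> r" "n' \<le> b" "b < x" for a b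
    proof -
      have "arcs_within a b Z \<le> arcs_within a (n - 1) Z"
      proof (rule arcs_within_cong_le)
        fix d assume dd: "d \<in># Z" "a \<le> snd d" "fst d \<le> b"
        have "fst d < n"
        proof (rule ccontr)
          assume "\<not> fst d < n"
          moreover have "snd d \<noteq> r" using dd xmin[of "fst d"] ab by (metis leD le_trans prod.collapse)
          ultimately have "snd d \<in> C" using dd ab rmax[of d] unfolding C_def
            by (auto intro!: exI[of _ "fst d"])
          then show False using smax dd ab by fastforce
        qed
        then show "a \<le> snd d \<and> fst d \<le> n - 1" using dd by auto
      qed
      also have "\<dots> \<le> arcs_within a (n - 1) Y" by (rule le)
      also have "\<dots> < arcs_within a b Y" by (rule arcs_within_less[OF nY]) (use ab n' rn in auto)
      finally show ?thesis .
    qed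
    have le': "arcs_within a b Z' \<le> arcs_within a b Y" for a b
    proof (cases "s < a \<and> a \<le> r \<and> n' \<le> b \<and> b < x")
      case True
      then show ?thesis using strict[of a b] by (auto simp: E Z'_def)
    next
      case False
      then have "arcs_within a b Z' \<le> arcs_within a b Z" using sr n' by (auto simp: E Z'_def)
      then show ?thesis using le[of a b] by simp
    qed
    have "arcs_within r n' Z < arcs_within r n' Z'" using sr n' by (auto simp: E Z'_def)
    moreover have "(n', r) \<in># Z'" by (simp add: Z'_def)
    ultimately show ?thesis using unc le' by fastforce
  next
    case False
    then have noR: "(x, r) \<notin># Z" for x by blast
    have "r \<in># ends Z" using nY ends[symmetric] by (force simp: mem_ends)
    then have exs0: "\<exists>s. (r, s) \<in># Z" using noR by (auto simp: mem_ends)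
    \<comment> \<open>Here no arc of \<open>Z\<close> starts at \<open>r\<close>, so
      \<open>r\<close> is a right end in \<open>Z\<close>; the longest arc ending there is
      taken.\<close>
    define s0 where "s0 = (LEAST s. (r, s) \<in># Z)"
    have s0Z: "(r, s0) \<in># Z" unfolding s0_def using exs0 by (rule LeastI_ex)
    have s0min: "s0 \<le> s" if "(r, s) \<in># Z" for s unfolding s0_def using that by (rule Least_le)
    have s0r: "s0 < r" using wZ[OF s0Z] by simp
    \<comment> \<open>End points strictly inside \<open>(r, s0)\<close> of two kinds of crossing
      arcs: those leaving to the right as far as \<open>n\<close>, and those coming from the left of
      \<open>s0\<close>.\<close>
    define C where "C = {s. s0 < s \<and> s < r \<and> ((\<exists>n'. (n', s) \<in># Z \<and> n \<le> n') \<or> (\<exists>n'. (s, n') \<in># Z \<and> n' < s0))}"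
    have finC: "finite C" by (rule finite_subset[of _ "{..<r}"]) (auto simp: C_def)
    have "C \<noteq> {}"
    proof
      assume Ce: "C = {}"
      \<comment> \<open>A combination of interval counts and end point counts, so its total over \<open>Y\<close> is at least that
        over \<open>Z\<close>; its sign on the single arcs gives the contradiction.\<close>
      define w :: "nat \<times> nat \<Rightarrow> int" where "w d = (if s0 \<le> snd d \<and> fst d \<le> r then 1 else 0)
         + (if s0 + 1 \<le> snd d \<and> fst d \<le> n - 1 then 1 else 0)
         - ((if s0 < fst d \<and> fst d \<le> r then 1 else 0) + (if s0 < snd d \<and> snd d \<le> r then 1 else 0))" for d
      have W: "(\<Sum>d\<in>#D. w d) = int (arcs_within s0 r D) + int (arcs_within (s0 + 1) (n - 1) D)
          - int (size (filter_mset (\<lambda>x. s0 < x \<and> x \<le> r) (ends D)))" for D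
        unfolding w_def int_arcs_within size_filter_ends sum_mset.distrib[symmetric] by (induction D) auto
      have "w d \<ge> 0" if "d \<in># Z" for d
      proof (cases d)
        case (Pair p q)
        have "\<not> (s0 < q \<and> q < r \<and> n \<le> p)" "\<not> (s0 < p \<and> p < r \<and> q < s0)"
          using Ce that Pair unfolding C_def by auto
        moreover have "q \<noteq> r" using noR that Pair by auto
        moreover have "p = r \<longrightarrow> s0 \<le> q" using s0min that Pair by auto
        moreover have "q \<le> r" "q < p" using that Pair rmax[of d] wZ[of d] by auto
        ultimately show ?thesis using rn s0r by (auto simp: w_def Pair)
      qed
      then have "(\<Sum>d\<in>#Z. w d) \<ge> 0" using sum_mset_mono[of Z "\<lambda>_. 0" w] by simp
      moreover have "(\<Sum>d\<in>#Y. w d) \<ge> (\<Sum>d\<in>#Z. w d)"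
        using W[of Y] W[of Z] filt le[of s0 r] le[of "s0 + 1" "n - 1"] by simp
      moreover have wYn: "w d \<le> 0" if "d \<in># Y" for d
      proof (cases d)
        case (Pair p q)
        have "q \<le> r" "q < p" using that Pair rmax[of d] wY[of d] by auto
        moreover have "q = r \<longrightarrow> n \<le> p" using nmin that Pair by auto
        ultimately show ?thesis using rn s0r by (auto simp: w_def Pair)
      qed
      moreover obtain Y' where Y': "Y = add_mset (n, r) Y'" using nY by (auto dest: multi_member_split)
      have "(\<Sum>d\<in>#Y'. w d) \<le> 0" using wYn sum_mset_mono[of Y' w "\<lambda>_. 0"] by (simp add: Y')
      moreover have "w (n, r) < 0" using rn s0r by (auto simp: w_def)
      ultimately show False by (simp add: Y')
    qed
    define s where "s = Max C"
    have sC: "s \<in> C" unfolding s_def using finC \<open>C \<noteq> {}\<close> by (intro Max_in) auto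
    have smax: "s' \<le> s" if "s' \<in> C" for s' unfolding s_def using finC that by simp
    have s: "s0 < s" "s < r" using sC by (auto simp: C_def)
    \<comment> \<open>Slack for the intervals that contain the new arc \<open>(s, s0)\<close> but
      not \<open>(r, s0)\<close>.\<close>
    have strictL: "arcs_within a b Z < arcs_within a b Y" if ab: "a \<le> s0" "s \<le> b" "b < r" for a b
    proof -
      \<comment> \<open>The weight is nonpositive on \<open>Z\<close>, nonnegative on
        \<open>Y\<close> and positive on \<open>(n, r)\<close>. The end point term has equal totals
        on both sides and the two subtracted counts are at least as large on \<open>Y\<close>, so
        the excess must come from the interval \<open>[a, b]\<close>.\<close>
      define w :: "nat \<times> nat \<Rightarrow> int" where "w d = (if a \<le> snd d \<and> fst d \<le> b then 1 else 0)
         - (if b + 1 \<le> snd d \<and> fst d \<le> n - 1 then 1 else 0) - (if a \<le> snd d \<and> fst d \<le> r then 1 else 0)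
         + ((if b < fst d \<and> fst d \<le> r then 1 else 0) + (if b < snd d \<and> snd d \<le> r then 1 else 0))" for d
      have W: "(\<Sum>d\<in>#D. w d) = int (arcs_within a b D) - int (arcs_within (b + 1) (n - 1) D) - int (arcs_within a r D)
          + int (size (filter_mset (\<lambda>x. b < x \<and> x \<le> r) (ends D)))" for D
        unfolding w_def int_arcs_within size_filter_ends by (induction D) auto
      have "w d \<le> 0" if "d \<in># Z" for d
      proof (cases d)
        case (Pair p q)
        have no: "\<not> (s < q \<and> q < r \<and> n \<le> p)" "\<not> (s < p \<and> p < r \<and> q < s0)"
          using smax[of q] smax[of p] that Pair s unfolding C_def by fastforce+
        moreover have "q \<noteq> r" using noR that Pair by auto
        moreover have "p = r \<longrightarrow> s0 \<le> q" using s0min that Pair by auto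
        moreover have "q \<le> r" "q < p" using that Pair rmax[of d] wZ[of d] by auto
        ultimately show ?thesis using rn s0r ab s by (auto simp: w_def Pair)
      qed
      then have "(\<Sum>d\<in>#Z. w d) \<le> 0" using sum_mset_mono[of Z w "\<lambda>_. 0"] by simp
      moreover have wYn: "w d \<ge> 0" if "d \<in># Y" for d
      proof (cases d)
        case (Pair p q)
        have "q \<le> r" "q < p" using that Pair rmax[of d] wY[of d] by auto
        then show ?thesis using rn s0r ab s by (auto simp: w_def Pair)
      qed
      moreover obtain Y' where Y': "Y = add_mset (n, r) Y'" using nY by (auto dest: multi_member_split)
      have "(\<Sum>d\<in>#Y'. w d) \<ge> 0" using wYn sum_mset_mono[of Y' "\<lambda>_. 0" w] by (simp add: Y')
      moreover have "w (n, r) > 0" using rn s0r ab s by (auto simp: w_def)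
      ultimately have "(\<Sum>d\<in>#Z. w d) < (\<Sum>d\<in>#Y. w d)" by (simp add: Y')
      then show ?thesis using W[of Y] W[of Z] filt le[of "b + 1" "n - 1"] le[of a r] by simp
    qed
    \<comment> \<open>An arc leaving to the right is separated from \<open>(r, s0)\<close>; an arc
      coming from the left is nested with it.\<close>
    from sC consider n' where "(n', s) \<in># Z" "n \<le> n'" | n' where "(s, n') \<in># Z" "n' < s0"
      by (auto simp: C_def)
    then show ?thesis
    proof cases
      case 1
      obtain E where E: "Z = add_mset (r, s0) (add_mset (n', s) E)"
        using s0Z 1 s by (metis (no_types, lifting) insert_noteq_member less_irrefl multi_member_split prod.inject)
      define Z' where "Z' = add_mset (n', r) (add_mset (s, s0) E)"
      have unc: "uncross Z Z'" using uncross.sep[of r n' s s0 E] 1 rn s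
        by (simp add: E Z'_def add_mset_commute)
      \<comment> \<open>The intervals gaining the other new arc \<open>(n', r)\<close>. As in the
        first case, maximality of \<open>s\<close> makes the arcs of \<open>Z\<close> end before
        \<open>n\<close>, now using that none of them starts at \<open>r\<close>.\<close>
      have strict: "arcs_within a b Z < arcs_within a b Y" if ab: "s < a" "a \<le> r" "n' \<le> b" for a b
      proof -
        have "arcs_within a b Z \<le> arcs_within a (n - 1) Z"
        proof (rule arcs_within_cong_le)
          fix d assume dd: "d \<in># Z" "a \<le> snd d" "fst d \<le> b"
          have "fst d < n"
          proof (rule ccontr)
            assume "\<not> fst d < n"
            moreover have "snd d \<noteq> r" using dd noR by (metis prod.collapse)
            ultimately have "snd d \<in> C" using dd ab rmax[of d] s unfolding C_def
              by (auto intro!: exI[of _ "fst d"])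
            then show False using smax dd ab by fastforce
          qed
          then show "a \<le> snd d \<and> fst d \<le> n - 1" using dd by auto
        qed
        also have "\<dots> \<le> arcs_within a (n - 1) Y" by (rule le)
        also have "\<dots> < arcs_within a b Y" by (rule arcs_within_less[OF nY]) (use ab 1 rn in auto)
        finally show ?thesis .
      qed
      have le': "arcs_within a b Z' \<le> arcs_within a b Y" for a b
      proof (cases "s < a \<and> a \<le> r \<and> n' \<le> b \<or> a \<le> s0 \<and> s \<le> b \<and> b < r")
        case True
        then show ?thesis using strict[of a b] strictL[of a b] 1 s rn by (auto simp: E Z'_def)
      next
        case False
        then have "arcs_within a b Z' \<le> arcs_within a b Z" using s 1 rn by (auto simp: E Z'_def)
        then show ?thesis using le[of a b] by simp
      qed
      have "arcs_within r n' Z < arcs_within r n' Z'" using s 1 rn by (auto simp: E Z'_def)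
      moreover have "(n', r) \<in># Z'" by (simp add: Z'_def)
      ultimately show ?thesis using unc le' by fastforce
    next
      case 2
      obtain E where E: "Z = add_mset (r, s0) (add_mset (s, n') E)"
        using s0Z 2 s by (metis (no_types, lifting) insert_noteq_member less_irrefl multi_member_split prod.inject)
      define Z' where "Z' = add_mset (r, n') (add_mset (s, s0) E)"
      have unc: "uncross Z Z'" using uncross.nest[of s r s0 n' E] 2 rn s
        by (simp add: E Z'_def add_mset_commute)
      have le': "arcs_within a b Z' \<le> arcs_within a b Y" for a b
      proof (cases "a \<le> s0 \<and> s \<le> b \<and> b < r")
        case True
        then show ?thesis using strictL[of a b] 2 s rn by (auto simp: E Z'_def)
      next
        case False
        then have "arcs_within a b Z' \<le> arcs_within a b Z" using s 2 rn by (auto simp: E Z'_def)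
        then show ?thesis using le[of a b] by simp
      qed
      have "arcs_within s0 s Z < arcs_within s0 s Z'" using s 2 rn by (auto simp: E Z'_def)
      moreover have "(s, s0) \<in># Z'" by (simp add: Z'_def)
      ultimately show ?thesis using unc le' by fastforce
    qed
  qed
qed

lemma uncross_mono:
  assumes "uncross Z Z'"
  shows "ends Z' = ends Z" "arcs_within a b Z \<le> arcs_within a b Z'"
    "(\<And>d. d \<in># Z \<Longrightarrow> snd d < fst d) \<Longrightarrow> d \<in># Z' \<Longrightarrow> snd d < fst d"
  using assms by (induction rule: uncross.induct) (auto simp: add_mset_commute)

text \<open>Common arcs are cancelled, which lowers \<open>size Z\<close> and leaves every deficit
  unchanged; if there are none, \<open>uncross_step\<close> lowers the total deficit over intervals
  and keeps the size. The bound \<open>B\<close> makes this total a finite sum that still contains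
  the interval of the witness arc.\<close>

lemma uncross_reachable:
  assumes "\<And>d. d \<in># Y \<Longrightarrow> snd d < fst d" and "\<And>d. d \<in># Z \<Longrightarrow> snd d < fst d"
    and "ends Y = ends Z" and "\<And>a b. arcs_within a b Z \<le> arcs_within a b Y"
    and "\<And>x. x \<in># ends Y \<Longrightarrow> x \<le> B"
  shows "uncross\<^sup>*\<^sup>* Z Y"
  using assms
proof (induction "size Z + (\<Sum>a\<le>B. \<Sum>b\<le>B. arcs_within a b Y - arcs_within a b Z)" arbitrary: Y Z rule: less_induct)
  case less
  show ?case
  proof (cases "\<exists>d. d \<in># Y \<and> d \<in># Z")
    case True
    then obtain d Y' Z' where YZ: "Y = add_mset d Y'" "Z = add_mset d Z'"
      by (meson multi_member_split)
    have "uncross\<^sup>*\<^sup>* Z' Y'"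
    proof (rule less.hyps)
      have "(\<Sum>a\<le>B. \<Sum>b\<le>B. arcs_within a b Y - arcs_within a b Z) = (\<Sum>a\<le>B. \<Sum>b\<le>B. arcs_within a b Y' - arcs_within a b Z')"
        by (simp add: YZ)
      then show "size Z' + (\<Sum>a\<le>B. \<Sum>b\<le>B. arcs_within a b Y' - arcs_within a b Z') < size Z + (\<Sum>a\<le>B. \<Sum>b\<le>B. arcs_within a b Y - arcs_within a b Z)"
        by (simp add: YZ)
      show "arcs_within a b Z' \<le> arcs_within a b Y'" for a b using less.prems(4)[of a b] by (simp add: YZ)
    qed (use less.prems YZ in auto)
    then show ?thesis using YZ uncross_rtrancl_add by simp
  next
    case False
    show ?thesis
    proof (cases "Z = {#}")
      case True
      then have "size (ends Y) = 0" using less.prems(3) by simp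
      then show ?thesis using True by (simp add: size_ends)
    next
      case ne: False
      obtain Z' d where Z': "uncross Z Z'" "\<And>a b. arcs_within a b Z' \<le> arcs_within a b Y"
        "d \<in># Z'" "arcs_within (snd d) (fst d) Z < arcs_within (snd d) (fst d) Z'"
        using uncross_step[of Y Z] less.prems False ne by metis
      have w: "\<And>d. d \<in># Z' \<Longrightarrow> snd d < fst d" using uncross_mono(3)[OF Z'(1)] less.prems(2) by blast
      have e: "ends Y = ends Z'" using uncross_mono(1)[OF Z'(1)] less.prems(3) by simp
      have mono: "arcs_within a b Z \<le> arcs_within a b Z'" for a b by (rule uncross_mono(2)[OF Z'(1)])
      have "fst d \<in># ends Y" "snd d \<in># ends Y" unfolding e mem_ends using Z'(3) by blast+
      then have dB: "fst d \<le> B" "snd d \<le> B" using less.prems(5) by simp_all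
      have "(\<Sum>a\<le>B. \<Sum>b\<le>B. arcs_within a b Y - arcs_within a b Z') < (\<Sum>a\<le>B. \<Sum>b\<le>B. arcs_within a b Y - arcs_within a b Z)"
      proof (rule sum_strict_mono_ex1)
        show "\<forall>a\<in>{..B}. (\<Sum>b\<le>B. arcs_within a b Y - arcs_within a b Z') \<le> (\<Sum>b\<le>B. arcs_within a b Y - arcs_within a b Z)"
          by (auto intro!: sum_mono diff_le_mono2 mono)
        have "(\<Sum>b\<le>B. arcs_within (snd d) b Y - arcs_within (snd d) b Z') < (\<Sum>b\<le>B. arcs_within (snd d) b Y - arcs_within (snd d) b Z)"
        proof (rule sum_strict_mono_ex1)
          show "\<exists>b\<in>{..B}. arcs_within (snd d) b Y - arcs_within (snd d) b Z' < arcs_within (snd d) b Y - arcs_within (snd d) b Z"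
            using dB Z'(4) Z'(2)[of "snd d" "fst d"] by (intro bexI[of _ "fst d"]) auto
        qed (auto intro!: diff_le_mono2 mono)
        then show "\<exists>a\<in>{..B}. (\<Sum>b\<le>B. arcs_within a b Y - arcs_within a b Z') < (\<Sum>b\<le>B. arcs_within a b Y - arcs_within a b Z)"
          using dB by blast
      qed simp
      moreover have "size Z' = size Z" using e less.prems(3) size_ends[of Z] size_ends[of Z'] by simp
      ultimately have "uncross\<^sup>*\<^sup>* Z' Y"
        using less.hyps[of Z' Y] w e Z'(2) less.prems by simp
      then show ?thesis using Z'(1) by simp
    qed
  qed
qed

lemma uncross_strict: "uncross Z Z' \<Longrightarrow> \<exists>a b. arcs_within a b Z < arcs_within a b Z'"
proof (induction rule: uncross.induct)
  case (nest m n r s E)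
  then show ?case by (intro exI[of _ r] exI[of _ n]) auto
next
  case (sep m n r s E)
  then show ?case by (intro exI[of _ s] exI[of _ r]) auto
qed

lemma uncross_rtrancl_arcs_within: "uncross\<^sup>*\<^sup>* Z Y \<Longrightarrow> arcs_within a b Z \<le> arcs_within a b Y"
  by (induction rule: rtranclp_induct) (auto dest: uncross_mono(2)[of _ _ a b])

text \<open>No count ever falls along a chain and every step raises one, so a chain between diagrams
  with equal counts has no step.\<close>

lemma uncross_rtrancl_eq:
  assumes "uncross\<^sup>*\<^sup>* Z Y" "\<And>a b. arcs_within a b Y = arcs_within a b Z"
  shows "Y = Z"
  using assms(1)
proof (cases rule: converse_rtranclpE)
  case (step Z')
  obtain a b where "arcs_within a b Z < arcs_within a b Z'" using uncross_strict[OF step(1)] by blast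
  also have "\<dots> \<le> arcs_within a b Y" using step(2) by (rule uncross_rtrancl_arcs_within)
  finally show ?thesis using assms(2) by simp
qed simp

subsection \<open>Arc diagrams and their counting functions\<close>

fun valid_item :: "arcitem \<Rightarrow> bool" where
  "valid_item (Arc m r) \<longleftrightarrow> 1 \<le> r \<and> r < m"
| "valid_item (Pole s) \<longleftrightarrow> 1 \<le> s"

fun item_bound :: "nat \<Rightarrow> arcitem \<Rightarrow> bool" where
  "item_bound M (Arc m r) \<longleftrightarrow> m < M \<and> r < M"
| "item_bound M (Pole s) \<longleftrightarrow> s < M"

text \<open>For \<open>q \<le> p\<close> these are the dimensions of the invariant on the summand of
  the item. The first term of an arc tests the generator of \<open>N_(2)\<close>, the second its
  image under \<open>T\<close>, which lies in the socle at height \<open>m - 1\<close>.\<close>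

fun item_hom_count :: "nat \<Rightarrow> nat \<Rightarrow> arcitem \<Rightarrow> nat" where
  "item_hom_count p q (Arc m r) = (if p + 2 \<le> m \<and> q + 1 \<le> r then 1 else 0) + (if q + 1 \<le> m then 1 else 0)"
| "item_hom_count p q (Pole s) = (if q + 1 \<le> s then 1 else 0)"

definition hom_count :: "nat \<Rightarrow> nat \<Rightarrow> arcitem multiset \<Rightarrow> nat" where
  "hom_count p q D = (\<Sum>x\<in>#D. item_hom_count p q x)"

fun is_arc :: "arcitem \<Rightarrow> bool" where
  "is_arc (Arc m r) = True" | "is_arc (Pole s) = False"

definition num_arcs :: "arcitem multiset \<Rightarrow> nat" where
  "num_arcs D = size (filter_mset is_arc D)"

lemma hom_count_simps [simp]: "hom_count p q {#} = 0" "hom_count p q (add_mset x D) = item_hom_count p q x + hom_count p q D"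
  "hom_count p q (D + E) = hom_count p q D + hom_count p q E"
  by (simp_all add: hom_count_def)

lemma num_arcs_simps [simp]: "num_arcs {#} = 0" "num_arcs (add_mset x D) = (if is_arc x then 1 else 0) + num_arcs D"
  "num_arcs (D + E) = num_arcs D + num_arcs E"
  by (simp_all add: num_arcs_def)

text \<open>A pole is treated as an arc to a point \<open>M\<close> to the right of all end points; this turns
  moves (B) and (D) into moves (A) and (C).\<close>

fun enc :: "nat \<Rightarrow> arcitem \<Rightarrow> nat \<times> nat" where
  "enc M (Arc m r) = (m, r)"
| "enc M (Pole s) = (M, s)"

fun dec_item :: "nat \<Rightarrow> nat \<times> nat \<Rightarrow> arcitem" where
  "dec_item M (m, r) = (if m = M then Pole r else Arc m r)"

lemma dec_enc: "item_bound M x \<Longrightarrow> dec_item M (enc M x) = x"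
  by (cases x) auto

lemma image_dec_enc:
  "(\<And>x. x \<in># D \<Longrightarrow> item_bound M x) \<Longrightarrow> image_mset (dec_item M) (image_mset (enc M) D) = D"
  by (induction D) (auto simp: dec_enc)

lemma item_bound_exists: "\<exists>M. \<forall>x\<in>#D. item_bound M x"
proof (induction D)
  case (add x D)
  then obtain M where M: "\<forall>x\<in>#D. item_bound M x" by blast
  have mono: "item_bound M y \<Longrightarrow> M \<le> M' \<Longrightarrow> item_bound M' y" for M M' y by (cases y) auto
  obtain M2 where "item_bound M2 x"
  proof (cases x)
    case (Arc m r)
    then show ?thesis using that[of "Suc (m + r)"] by simp
  next
    case (Pole s)
    then show ?thesis using that[of "Suc s"] by simp
  qed
  then show ?case using M mono by (intro exI[of _ "max M M2"]) (auto intro: mono)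
qed simp

text \<open>In a crossing pair only the arc with the larger right end can reach \<open>M\<close>,
  since \<open>n < m \<le> M\<close>. Hence each rule decodes to one of two moves:
  \<open>nest\<close> to (A) or (B), \<open>sep\<close> to (C) or (D).\<close>

lemma uncross_decomposes:
  assumes "uncross Z Z'" "\<And>d. d \<in># Z \<Longrightarrow> fst d \<le> M"
  shows "arc_move (image_mset (dec_item M) Z) (image_mset (dec_item M) Z')"
  using assms
proof (induction rule: uncross.induct)
  case (nest m n r s E)
  moreover have "m \<le> M" using nest.prems[of "(m, r)"] by simp
  ultimately show ?case
    using moveA[of n m r s "image_mset (dec_item M) E"] moveB[of r n s "image_mset (dec_item M) E"]
    by (cases "m = M") (auto simp: add_mset_commute)
next
  case (sep m n r s E)
  moreover have "m \<le> M" using sep.prems[of "(m, r)"] by simp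
  ultimately show ?case
    using moveC[of n m r s "image_mset (dec_item M) E"] moveD[of r n s "image_mset (dec_item M) E"]
    by (cases "m = M") (auto simp: add_mset_commute)
qed

lemma uncross_rtrancl_decomposes:
  assumes "uncross\<^sup>*\<^sup>* Z Z'" "\<And>x. x \<in># ends Z \<Longrightarrow> x \<le> M"
  shows "arc_move\<^sup>*\<^sup>* (image_mset (dec_item M) Z) (image_mset (dec_item M) Z')"
proof -
  have "arc_move\<^sup>*\<^sup>* (image_mset (dec_item M) Z) (image_mset (dec_item M) Z') \<and> ends Z' = ends Z"
    using assms(1)
  proof (induction rule: rtranclp_induct)
    case (step Y W)
    have "fst d \<le> M" if "d \<in># Y" for d
    proof -
      have "fst d \<in># ends Y" unfolding mem_ends using that by blast
      then show ?thesis using assms(2) step.IH by simp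
    qed
    then have "arc_move (image_mset (dec_item M) Y) (image_mset (dec_item M) W)"
      using uncross_decomposes[OF step.hyps(2)] by blast
    then show ?case using step.IH uncross_mono(1)[OF step.hyps(2)] by auto
  qed simp
  then show ?thesis ..
qed

section \<open>Interval counts expressed by the dimension counts\<close>

context
  fixes M :: nat
begin

abbreviation "enc_ok D \<equiv> \<forall>x\<in>#D. valid_item x \<and> item_bound M x"
abbreviation "encs D \<equiv> image_mset (enc M) D"

text \<open>Since \<open>r < m\<close>, the condition \<open>q + 1 \<le> r\<close> already implies
  \<open>q + 2 \<le> m\<close>. Passing from \<open>(q, q)\<close> to \<open>(p, q)\<close>
  therefore loses one for each arc with \<open>q + 1 \<le> r\<close> and
  \<open>m \<le> p + 1\<close>. Encoded poles end at \<open>M > p + 1\<close> and do not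
  interfere.\<close>

lemma arcs_within_enc:
  assumes "enc_ok D" "q \<le> p" "p + 1 < M"
  shows "hom_count p q D + arcs_within (q + 1) (p + 1) (encs D) = hom_count q q D"
  using assms
proof (induction D)
  case (add x D)
  then show ?case by (cases x) auto
qed simp

lemma arcs_within_enc0: "enc_ok D \<Longrightarrow> arcs_within 0 b (encs D) = arcs_within 1 b (encs D)"
proof (induction D)
  case (add x D)
  then show ?case by (cases x) auto
qed simp

lemma arcs_within_enc_empty: "enc_ok D \<Longrightarrow> b \<le> a \<or> M \<le> a \<Longrightarrow> arcs_within a b (encs D) = 0"
proof (induction D)
  case (add x D)
  then show ?case by (cases x) auto
qed simp

text \<open>An interval reaching \<open>M\<close> counts all items with left end above
  \<open>q\<close>. For an arc \<open>hom_count q q\<close> counts both of its ends above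
  \<open>q\<close>; adding the arcs that end by \<open>q\<close> turns the contribution of the right
  end into the constant \<open>1\<close>.\<close>

lemma arcs_within_enc_inf: "enc_ok D \<Longrightarrow> q < M \<Longrightarrow> M \<le> b \<Longrightarrow> arcs_within (q + 1) b (encs D) + num_arcs D = hom_count q q D + arcs_within 0 q (encs D)"
proof (induction D)
  case (add x D)
  then show ?case by (cases x) auto
qed simp

text \<open>\<open>hom_count q q\<close> is the number of end points above \<open>q\<close> apart
  from the artificial \<open>M\<close>, so multiplicities are its successive differences. At
  \<open>M\<close> one counts poles: all end points other than \<open>M\<close>, minus two for each
  arc.\<close>

lemma count_ends_enc:
  assumes "enc_ok D"
  shows "1 \<le> x \<Longrightarrow> x < M \<Longrightarrow> count (ends (encs D)) x + hom_count x x D = hom_count (x - 1) (x - 1) D"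
    and "count (ends (encs D)) M + 2 * num_arcs D = hom_count 0 0 D"
    and "x = 0 \<or> M < x \<Longrightarrow> 0 < M \<Longrightarrow> count (ends (encs D)) x = 0"
  using assms
proof (induction D)
  case (add y D)
  { case 1 then show ?case using add by (cases y) auto }
  { case 2 then show ?case using add by (cases y) auto }
  { case 3 then show ?case using add by (cases y) auto }
qed auto

lemma arcs_within_enc_le:
  assumes gY: "enc_ok Y" and gZ: "enc_ok Z" and le: "\<And>p q. q \<le> p \<Longrightarrow> hom_count p q Y \<le> hom_count p q Z"
    and eq: "\<And>q. hom_count q q Y = hom_count q q Z" and n: "num_arcs Y = num_arcs Z"
  shows "arcs_within a b (encs Z) \<le> arcs_within a b (encs Y)"
proof -
  \<comment> \<open>Ordinary intervals come from the inequality for \<open>p > q\<close>. Intervals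
    reaching \<open>M\<close> are treated below; by the fixed data they reduce to an interval of the
    form \<open>[0, q]\<close>.\<close>
  have 1: "arcs_within a b (encs Z) \<le> arcs_within a b (encs Y)" if "b < M" "a \<ge> 1" for a b
  proof (cases "b \<le> a")
    case False
    then have ab: "a - 1 \<le> b - 1" "b - 1 + 1 < M" "a - 1 + 1 = a" "b - 1 + 1 = b" using that by auto
    show ?thesis
      using arcs_within_enc[OF gY ab(1,2)] arcs_within_enc[OF gZ ab(1,2)] le[OF ab(1)] eq[of "a - 1"]
      unfolding ab by linarith
  qed (simp add: arcs_within_enc_empty gZ)
  have 0: "arcs_within 0 b (encs Z) \<le> arcs_within 0 b (encs Y)" if "b < M" for b
    using 1[of b 1] that arcs_within_enc0 gY gZ by simp
  have 2: "arcs_within a b (encs Z) \<le> arcs_within a b (encs Y)" if "a \<ge> 1" for a b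
  proof (cases "b < M")
    case False
    show ?thesis
    proof (cases "a \<ge> M")
      case True
      then show ?thesis by (simp add: arcs_within_enc_empty gZ)
    next
      case aM: False
      then have "a - 1 < M" "a - 1 + 1 = a" using that by auto
      then show ?thesis
        using arcs_within_enc_inf[OF gY, of "a - 1" b] arcs_within_enc_inf[OF gZ, of "a - 1" b] 0[of "a - 1"] eq[of "a - 1"] n False
        by simp
    qed
  qed (use 1 that in auto)
  show ?thesis using 2[of a b] 2[of 1 b] arcs_within_enc0[OF gY] arcs_within_enc0[OF gZ] by (cases "a = 0") auto
qed

lemma ends_enc_eq:
  assumes gY: "enc_ok Y" and gZ: "enc_ok Z" and eq: "\<And>q. hom_count q q Y = hom_count q q Z" and n: "num_arcs Y = num_arcs Z"
    and M: "0 < M"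
  shows "ends (encs Y) = ends (encs Z)"
proof (rule multiset_eqI)
  fix x
  consider "1 \<le> x" "x < M" | "x = M" | "x = 0 \<or> M < x" by linarith
  then show "count (ends (encs Y)) x = count (ends (encs Z)) x"
  proof cases
    case 1
    then show ?thesis using count_ends_enc(1)[OF gY, of x] count_ends_enc(1)[OF gZ, of x] eq by auto
  next
    case 2
    then show ?thesis using count_ends_enc(2)[OF gY] count_ends_enc(2)[OF gZ] eq n by simp
  next
    case 3
    then show ?thesis using count_ends_enc(3)[OF gY] count_ends_enc(3)[OF gZ] M by simp
  qed
qed

lemma uncross_enc:
  assumes gY: "enc_ok Y" and gZ: "enc_ok Z" and le: "\<And>p q. q \<le> p \<Longrightarrow> hom_count p q Y \<le> hom_count p q Z"
    and eq: "\<And>q. hom_count q q Y = hom_count q q Z" and n: "num_arcs Y = num_arcs Z" and M: "0 < M"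
  shows "uncross\<^sup>*\<^sup>* (encs Z) (encs Y)" "\<And>x. x \<in># ends (encs D) \<Longrightarrow> enc_ok D \<Longrightarrow> x \<le> M"
proof -
  have w: "snd d < fst d" if "d \<in># encs D" "enc_ok D" for d D
  proof -
    obtain x where "x \<in># D" "d = enc M x" using \<open>d \<in># encs D\<close> by auto
    then show ?thesis using that(2) by (cases x) auto
  qed
  have e: "ends (encs Y) = ends (encs Z)" by (rule ends_enc_eq) (use assms in auto)
  show b: "\<And>x D. x \<in># ends (encs D) \<Longrightarrow> enc_ok D \<Longrightarrow> x \<le> M"
    using count_ends_enc(3)[OF _ _ M] by (metis count_greater_zero_iff leI less_irrefl)
  show "uncross\<^sup>*\<^sup>* (encs Z) (encs Y)"
    by (rule uncross_reachable[where B = M]) (use w gY gZ e b arcs_within_enc_le[OF gY gZ le eq n] in blast)+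
qed

end

text \<open>The first conclusion drives the passage from degeneration to moves, the second the
  uniqueness of the arc diagram.\<close>

lemma arc_moves_reachable:
  assumes vY: "\<forall>x\<in>#Y. valid_item x" and vZ: "\<forall>x\<in>#Z. valid_item x"
    and le: "\<And>p q. q \<le> p \<Longrightarrow> hom_count p q Y \<le> hom_count p q Z"
    and eq: "\<And>q. hom_count q q Y = hom_count q q Z" and n: "num_arcs Y = num_arcs Z"
  shows "arc_move\<^sup>*\<^sup>* Z Y"
    and "(\<And>p q. q \<le> p \<Longrightarrow> hom_count p q Y = hom_count p q Z) \<Longrightarrow> Y = Z"
proof -
  obtain M0 where "\<forall>x\<in>#Y + Z. item_bound M0 x" using item_bound_exists by blast
  then have M0: "item_bound (Suc M0) x" if "x \<in># Y + Z" for x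
    using that by (cases x) fastforce+
  \<comment> \<open>The successor makes \<open>M\<close> positive even when both diagrams are
    empty.\<close>
  define M where "M = Suc M0"
  have g: "\<forall>x\<in>#Y. valid_item x \<and> item_bound M x" "\<forall>x\<in>#Z. valid_item x \<and> item_bound M x"
    using vY vZ M0 by (auto simp: M_def)
  have u: "uncross\<^sup>*\<^sup>* (image_mset (enc M) Z) (image_mset (enc M) Y)"
    by (rule uncross_enc(1)[OF g]) (use le eq n in \<open>auto simp: M_def\<close>)
  have b: "x \<le> M" if "x \<in># ends (image_mset (enc M) Z)" for x
    by (rule uncross_enc(2)[OF g le eq n _ that g(2)]) (auto simp: M_def)
  have dY: "image_mset (dec_item M) (image_mset (enc M) Y) = Y" and dZ: "image_mset (dec_item M) (image_mset (enc M) Z) = Z"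
    using g by (auto intro!: image_dec_enc)
  show "arc_move\<^sup>*\<^sup>* Z Y" using uncross_rtrancl_decomposes[OF u b] unfolding dY dZ by blast
  assume heq: "\<And>p q. q \<le> p \<Longrightarrow> hom_count p q Y = hom_count p q Z"
  have "arcs_within a b (image_mset (enc M) Y) = arcs_within a b (image_mset (enc M) Z)" for a b
    by (rule antisym; rule arcs_within_enc_le) (use g heq n in auto)
  then have "image_mset (enc M) Y = image_mset (enc M) Z" by (rule uncross_rtrancl_eq[OF u])
  then show "Y = Z" using dY dZ by metis
qed

subsection \<open>Linear algebra of finitely supported vectors\<close>

definition vscale :: "'k::field \<Rightarrow> (idx \<Rightarrow> 'k) \<Rightarrow> idx \<Rightarrow> 'k" where
  "vscale c v = (\<lambda>a. c * v a)"

lemma vscale_apply [simp]: "vscale c v a = c * v a"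
  by (simp add: vscale_def)

interpretation fv: vector_space "vscale :: 'k::field \<Rightarrow> _"
  by unfold_locales (auto simp: fun_eq_iff algebra_simps)

interpretation fvv: vector_space_pair "vscale :: 'k::field \<Rightarrow> _" "vscale :: 'k::field \<Rightarrow> _"
  by unfold_locales

interpretation fvk: vector_space_pair "vscale :: 'k::field \<Rightarrow> _" "(*) :: 'k::field \<Rightarrow> _"
  by unfold_locales

abbreviation lin :: "((idx \<Rightarrow> 'k::field) \<Rightarrow> (idx \<Rightarrow> 'k)) \<Rightarrow> bool" where
  "lin \<equiv> Vector_Spaces.linear vscale vscale"

abbreviation lfun :: "((idx \<Rightarrow> 'k::field) \<Rightarrow> 'k) \<Rightarrow> bool" where
  "lfun \<equiv> Vector_Spaces.linear vscale (*)"

lemma linI: "(\<And>u v. F (u + v) = F u + F v) \<Longrightarrow> (\<And>c v. F (vscale c v) = vscale c (F v)) \<Longrightarrow> lin F"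
  by (simp add: Vector_Spaces.linear_iff fv.vector_space_axioms)

lemma lin_comp: "lin F \<Longrightarrow> lin G \<Longrightarrow> lin (\<lambda>v. G (F v))"
  using Vector_Spaces.linear_compose[of vscale vscale F vscale G] by (simp add: comp_def)

lemmas lin_add = fvv.linear_add and lin_vscale = fvv.linear_scale and lin_0 = fvv.linear_0
  and lin_sum = fvv.linear_sum and lin_diff = fvv.linear_diff and lin_neg = fvv.linear_neg

definition unit_vec :: "idx \<Rightarrow> idx \<Rightarrow> 'k::field" where
  "unit_vec a = (\<lambda>b. if b = a then 1 else 0)"

lemma unit_vec_apply: "unit_vec a b = (if b = a then 1 else 0)"
  by (simp add: unit_vec_def)

text \<open>All functions on \<open>idx\<close> form an infinite-dimensional space; dimensions are
  compared inside these subspaces with finite index set.\<close>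

definition coord_space :: "idx set \<Rightarrow> (idx \<Rightarrow> 'k::field) set" where
  "coord_space A = {v. \<forall>a. a \<notin> A \<longrightarrow> v a = 0}"

lemma subspace_coord_space: "fv.subspace (coord_space A)"
  by (auto simp: fv.subspace_def coord_space_def)

lemma sum_fun_apply: "(\<Sum>i\<in>I. f i) x = (\<Sum>i\<in>I. f i x)"
  by (induction I rule: infinite_finite_induct) auto

lemma coord_space_expand: "finite A \<Longrightarrow> v \<in> coord_space A \<Longrightarrow> v = (\<Sum>a\<in>A. vscale (v a) (unit_vec a))"
  by (auto simp: fun_eq_iff sum_fun_apply coord_space_def unit_vec_apply if_distrib[of "\<lambda>x. _ * x"] sum.delta' cong: if_cong)

lemma coord_space_span: "finite A \<Longrightarrow> fv.span (unit_vec ` A) = coord_space A"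
proof
  show "fv.span (unit_vec ` A) \<subseteq> coord_space A"
    by (rule fv.span_minimal) (auto simp: subspace_coord_space, auto simp: coord_space_def unit_vec_apply)
  assume A: "finite A"
  show "coord_space A \<subseteq> fv.span (unit_vec ` A)"
  proof
    fix v assume "v \<in> coord_space A"
    moreover have "(\<Sum>a\<in>A. vscale (v a) (unit_vec a)) \<in> fv.span (unit_vec ` A)"
      by (intro fv.span_sum fv.span_scale fv.span_base imageI)
    ultimately show "v \<in> fv.span (unit_vec ` A)" using coord_space_expand[OF A, of v] by metis
  qed
qed

lemma inj_unit_vec: "inj (unit_vec :: idx \<Rightarrow> idx \<Rightarrow> 'k::field)"
  by (auto simp: inj_def fun_eq_iff unit_vec_apply split: if_splits)

lemma independent_unit_vec:
  assumes "finite A"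
  shows "fv.independent (unit_vec ` A :: (idx \<Rightarrow> 'k::field) set)"
proof (rule fv.independent_if_scalars_zero)
  show "finite (unit_vec ` A :: (idx \<Rightarrow> 'k) set)" using assms by simp
  fix f :: "(idx \<Rightarrow> 'k) \<Rightarrow> 'k" and x :: "idx \<Rightarrow> 'k"
  assume sum0: "(\<Sum>x\<in>unit_vec ` A. vscale (f x) x) = 0" and "x \<in> unit_vec ` A"
  then obtain a where a: "a \<in> A" "x = unit_vec a" by blast
  have "(\<Sum>x\<in>unit_vec ` A. vscale (f x) x) a = (\<Sum>b\<in>A. f (unit_vec b) * unit_vec b a)"
    by (subst sum.reindex) (auto intro: inj_on_subset[OF inj_unit_vec] simp: sum_fun_apply)
  also have "\<dots> = (\<Sum>b\<in>A. if b = a then f (unit_vec a) else 0)"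
    by (rule sum.cong) (auto simp: unit_vec_apply)
  also have "\<dots> = f x" using assms a by simp
  finally show "f x = 0" by (simp add: sum0)
qed

lemma dim_coord_space:
  assumes "finite A"
  shows "fv.dim (coord_space A :: (idx \<Rightarrow> 'k::field) set) = card A"
proof -
  have "card (unit_vec ` A :: (idx \<Rightarrow> 'k) set) = card A"
    by (rule card_image) (rule inj_on_subset[OF inj_unit_vec subset_UNIV])
  moreover have "fv.dim (fv.span (unit_vec ` A :: (idx \<Rightarrow> 'k) set)) = card (unit_vec ` A :: (idx \<Rightarrow> 'k) set)"
    by (rule fv.dim_span_eq_card_independent[OF independent_unit_vec[OF assms]])
  ultimately show ?thesis by (simp add: coord_space_span assms)
qed

lemma independent_finite:
  assumes "fv.independent B" "B \<subseteq> coord_space A" "finite A"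
  shows "finite B \<and> card B \<le> card A"
proof -
  have "finite B \<and> card B \<le> card (unit_vec ` A :: (idx \<Rightarrow> 'a) set)"
    by (rule fv.independent_span_bound) (use assms coord_space_span in auto)
  then show ?thesis using card_image_le[OF assms(3), of unit_vec] by (meson le_trans)
qed

text \<open>The finite coordinate space is essential: an infinite-dimensional subspace has
  \<open>fv.dim\<close> equal to \<open>0\<close>, so monotonicity fails in general.\<close>

lemma dim_subset_le:
  assumes "S \<subseteq> T" "T \<subseteq> coord_space A" "finite A"
  shows "fv.dim S \<le> fv.dim T"
proof -
  obtain B where B: "B \<subseteq> S" "fv.independent B" "S \<subseteq> fv.span B" "card B = fv.dim S"
    using fv.basis_exists[of S] by blast
  obtain C where C: "C \<subseteq> T" "fv.independent C" "T \<subseteq> fv.span C" "card C = fv.dim T"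
    using fv.basis_exists[of T] by blast
  have "finite C" using independent_finite[OF C(2)] C assms by blast
  then have "card B \<le> card C" using fv.independent_span_bound[of C B] B C assms by blast
  then show ?thesis using B C by simp
qed

lemma subspace_dim_eq:
  assumes "fv.subspace S" "S \<subseteq> T" "T \<subseteq> coord_space A" "finite A" "fv.dim T \<le> fv.dim S"
  shows "S = T"
proof (rule ccontr)
  assume "S \<noteq> T"
  then obtain x where x: "x \<in> T" "x \<notin> S" using assms by auto
  obtain B where B: "B \<subseteq> S" "fv.independent B" "S \<subseteq> fv.span B" "card B = fv.dim S"
    using fv.basis_exists[of S] by blast
  obtain C where C: "C \<subseteq> T" "fv.independent C" "T \<subseteq> fv.span C" "card C = fv.dim T"
    using fv.basis_exists[of T] by blast
  have fin: "finite C" "finite B" using independent_finite[OF C(2)] independent_finite[OF B(2)] B C assms by blast+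
  have sB: "fv.span B = S" using fv.span_minimal[OF B(1) assms(1)] B by auto
  then have "x \<notin> fv.span B" "x \<notin> B" using x B by auto
  then have "fv.independent (insert x B)" using B by (simp add: fv.independent_insertI)
  moreover have "insert x B \<subseteq> fv.span C" using x B C assms by auto
  ultimately have "card (insert x B) \<le> card C" using fv.independent_span_bound[OF fin(1)] by blast
  then show False using B C assms \<open>x \<notin> B\<close> fin by simp
qed

lemma dim_inj_image:
  assumes "lin F" "fv.subspace S" "inj_on F S"
  shows "fv.dim (F ` S) = fv.dim S"
proof -
  obtain B where B: "B \<subseteq> S" "fv.independent B" "S \<subseteq> fv.span B" "card B = fv.dim S"
    using fv.basis_exists[of S] by blast
  have sB: "fv.span B = S" using fv.span_minimal[OF B(1) assms(2)] B by auto
  have "fv.independent (F ` B)"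
    using fvv.linear_independent_injective_image[OF assms(1) B(2)] sB assms(3) by simp
  moreover have "F ` S = fv.span (F ` B)" using fvv.linear_span_image[OF assms(1)] sB by simp
  moreover have "card (F ` B) = card B" using assms B by (meson card_image inj_on_subset)
  ultimately show ?thesis using fv.dim_span_eq_card_independent B by metis
qed

lemma lin_inj_surj:
  assumes "lin F" "fv.subspace S" "S \<subseteq> coord_space A" "finite A" "inj_on F S" "F ` S \<subseteq> S"
  shows "F ` S = S"
  by (rule subspace_dim_eq[OF _ assms(6) assms(3,4)])
     (use assms in \<open>auto intro: fvv.linear_subspace_image simp: dim_inj_image\<close>)

lemma independent_Un:
  assumes "fv.independent B" "fv.independent C" "finite C" "fv.span B \<inter> fv.span C \<subseteq> {0}"
  shows "fv.independent (B \<union> C)"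
  using assms(3,2,4)
proof (induction C rule: finite_induct)
  case empty
  show ?case using assms(1) by (metis Un_empty_right)
next
  case (insert x C)
  have iC: "fv.independent C" "x \<notin> fv.span C"
    using insert.prems(1) insert.hyps(2) fv.independent_insert[of x C] by metis+
  have "fv.span B \<inter> fv.span C \<subseteq> {0}" using insert.prems(2) fv.span_mono[of C "insert x C"] by blast
  then have "fv.independent (B \<union> C)" using insert.IH iC(1) by blast
  moreover have "x \<notin> fv.span (B \<union> C)"
  proof
    assume "x \<in> fv.span (B \<union> C)"
    then obtain a b where ab: "x = a + b" "a \<in> fv.span B" "b \<in> fv.span C" by (auto simp: fv.span_Un)
    have "x \<in> fv.span (insert x C)" "b \<in> fv.span (insert x C)"
      using ab(3) fv.span_mono[of C "insert x C"] fv.span_base[of x "insert x C"] by blast+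
    then have "x - b \<in> fv.span (insert x C)" by (rule fv.span_diff)
    then have "a \<in> fv.span B \<inter> fv.span (insert x C)" using ab by simp
    then have "a = 0" using insert.prems(2) by blast
    then have "x = b" using ab(1) by (metis add_0)
    then show False using ab(3) iC(2) by blast
  qed
  ultimately have "fv.independent (insert x (B \<union> C))" by (intro fv.independent_insertI)
  then show ?case by (metis Un_insert_right)
qed

lemma dim_direct_sum:
  assumes "fv.subspace S" "fv.subspace T" "S \<subseteq> coord_space A" "T \<subseteq> coord_space A" "finite A" "S \<inter> T \<subseteq> {0}"
  shows "fv.dim {x + y |x y. x \<in> S \<and> y \<in> T} = fv.dim S + fv.dim T"
proof -
  obtain B where B: "B \<subseteq> S" "fv.independent B" "S \<subseteq> fv.span B" "card B = fv.dim S"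
    using fv.basis_exists[of S] by blast
  obtain C where C: "C \<subseteq> T" "fv.independent C" "T \<subseteq> fv.span C" "card C = fv.dim T"
    using fv.basis_exists[of T] by blast
  have fin: "finite C" "finite B" using independent_finite[OF C(2)] independent_finite[OF B(2)] B C assms by blast+
  have sB: "fv.span B = S" using fv.span_minimal[OF B(1) assms(1)] B by auto
  have sC: "fv.span C = T" using fv.span_minimal[OF C(1) assms(2)] C by auto
  have iBC: "fv.independent (B \<union> C)" using independent_Un[OF B(2) C(2) fin(1)] assms(6) unfolding sB sC by blast
  moreover have dBC: "B \<inter> C = {}"
  proof -
    have "0 \<notin> B" using B(2) fv.dependent_zero by blast
    then show ?thesis using assms(6) B(1) C(1) by blast
  qed
  moreover have "{x + y |x y. x \<in> S \<and> y \<in> T} = fv.span (B \<union> C)" by (simp add: fv.span_Un sB sC)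
  ultimately show ?thesis
    using fv.dim_span_eq_card_independent[OF iBC] card_Un_disjoint[OF fin(2,1) dBC] B(4) C(4) by metis
qed

text \<open>A linear section of \<open>F\<close> over its image splits \<open>S\<close> into the
  kernel and a copy of the image.\<close>

lemma rank_nullity:
  assumes "lin F" "fv.subspace S" "S \<subseteq> coord_space A" "finite A"
  shows "fv.dim (F ` S) + fv.dim {v \<in> S. F v = 0} = fv.dim S"
proof -
  obtain g where g: "range g \<subseteq> S" "lin g" "\<forall>v\<in>F ` S. F (g v) = v"
    using fvv.linear_exists_right_inverse_on[OF assms(1,2)] by blast
  define K where "K = {v \<in> S. F v = 0}"
  define G where "G = g ` F ` S"
  have sFS: "fv.subspace (F ` S)" using assms(1,2) by (rule fvv.linear_subspace_image)
  then have sG: "fv.subspace G" unfolding G_def by (rule fvv.linear_subspace_image[OF g(2)])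
  have sK: "fv.subspace K"
    using assms(2) unfolding K_def fv.subspace_def by (auto simp: lin_0[OF assms(1)] lin_add[OF assms(1)] lin_vscale[OF assms(1)])
  have GS: "G \<subseteq> S" using g by (auto simp: G_def)
  have int: "K \<inter> G \<subseteq> {0}" using g by (auto simp: K_def G_def lin_0)
  have sum: "{x + y |x y. x \<in> K \<and> y \<in> G} = S"
  proof
    show "{x + y |x y. x \<in> K \<and> y \<in> G} \<subseteq> S"
      using GS assms(2) by (auto simp: K_def fv.subspace_add)
    show "S \<subseteq> {x + y |x y. x \<in> K \<and> y \<in> G}"
    proof
      fix x assume x: "x \<in> S"
      then have y: "g (F x) \<in> G" by (auto simp: G_def)
      moreover have "x - g (F x) \<in> K"
        using x y GS g assms by (auto simp: K_def lin_diff[OF assms(1)] fv.subspace_diff)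
      ultimately show "x \<in> {x + y |x y. x \<in> K \<and> y \<in> G}"
        by (intro CollectI exI[of _ "x - g (F x)"] exI[of _ "g (F x)"]) simp
    qed
  qed
  have "fv.dim G = fv.dim (F ` S)" unfolding G_def
    by (rule dim_inj_image[OF g(2) sFS]) (use g in \<open>metis inj_onI\<close>)
  moreover have "K \<subseteq> coord_space A" "G \<subseteq> coord_space A" using GS assms(3) by (auto simp: K_def)
  ultimately show ?thesis
    using dim_direct_sum[OF sK sG _ _ assms(4) int] unfolding sum by (simp add: K_def)
qed

text \<open>Source of all functionals below: the projections onto summands and the dual functionals
  in \<open>semicontinuity\<close>.\<close>

lemma functional_exists:
  assumes "fv.subspace S" "p \<notin> S"
  obtains f where "lfun f" "\<And>x. x \<in> S \<Longrightarrow> f x = 0" "f p = 1"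
proof -
  obtain B where B: "B \<subseteq> S" "fv.independent B" "S \<subseteq> fv.span B" "card B = fv.dim S"
    using fv.basis_exists[of S] by blast
  have sB: "fv.span B = S" using fv.span_minimal[OF B(1) assms(1)] B by auto
  have "fv.independent (insert p B)" using B assms by (simp add: fv.independent_insertI sB)
  then obtain f where f: "lfun f" "\<forall>x\<in>insert p B. f x = (if x = p then 1 else 0)"
    using fvk.linear_independent_extend[of "insert p B" "\<lambda>x. if x = p then 1 else 0"] by blast
  have "f x = 0" if "x \<in> S" for x
  proof (rule fvk.linear_eq_0_on_span[OF f(1)])
    show "x \<in> fv.span B" using that sB by simp
    show "f b = 0" if "b \<in> B" for b using that f(2) B(1) assms(2) by auto
  qed
  then show ?thesis using that f by simp
qed

subsection \<open>Modules and embeddings in terms of linear maps\<close>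

abbreviation VS :: "nat list \<Rightarrow> (idx \<Rightarrow> 'k::field) set" where
  "VS xs \<equiv> coord_space (Bas xs)"

lemma finite_Bas [simp]: "finite (Bas xs)"
proof -
  have "Bas xs = Sigma {..<length xs} (\<lambda>i. {..<xs ! i})" by (auto simp: Bas_def)
  then show ?thesis by simp
qed

lemma mem_Bas: "(i, j) \<in> Bas xs \<longleftrightarrow> i < length xs \<and> j < xs ! i"
  by (simp add: Bas_def)

lemma vec_on_VS: "vec_on (Bas xs) v \<longleftrightarrow> v \<in> VS xs"
  by (simp add: vec_on_def coord_space_def)

lemma VS_D: "v \<in> VS xs \<Longrightarrow> a \<notin> Bas xs \<Longrightarrow> v a = 0"
  unfolding coord_space_def by blast

lemma coord_space_I: "(\<And>a. a \<notin> A \<Longrightarrow> v a = 0) \<Longrightarrow> v \<in> coord_space A"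
  unfolding coord_space_def by blast

lemma HomD: "M \<in> Hom xs ys \<Longrightarrow> b \<notin> Bas ys \<or> a \<notin> Bas xs \<Longrightarrow> M b a = 0"
  unfolding Hom_def by blast

lemma HomI: "(\<And>b a. b \<notin> Bas ys \<or> a \<notin> Bas xs \<Longrightarrow> M b a = 0) \<Longrightarrow> M \<in> Hom xs ys"
  unfolding Hom_def by blast

text \<open>Multiplication by \<open>T\<close>. The test \<open>0 < snd b\<close> keeps the
  truncated \<open>snd b - 1\<close> from shifting the bottom coefficient onto itself.\<close>

definition tshift :: "nat list \<Rightarrow> (idx \<Rightarrow> 'k::field) \<Rightarrow> idx \<Rightarrow> 'k" where
  "tshift xs v = (\<lambda>b. if b \<in> Bas xs \<and> 0 < snd b then v (fst b, snd b - 1) else 0)"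

lemma tshift_apply: "tshift xs v (i, j) = (if (i, j) \<in> Bas xs \<and> 0 < j then v (i, j - 1) else 0)"
  by (simp add: tshift_def)

lemma tshift_VS [simp]: "tshift xs v \<in> VS xs"
  by (simp add: tshift_def coord_space_def)

lemma lin_tshift: "lin (tshift xs)"
  by (rule linI) (auto simp: fun_eq_iff tshift_def)

lemma lin_mv: "lin (mv K M)"
  by (rule linI) (auto simp: fun_eq_iff mv_def algebra_simps sum.distrib sum_distrib_left)

lemma mv_tmat: "mv (Bas xs) (tmat xs) v = tshift xs v"
proof
  fix b
  have "(\<Sum>a\<in>Bas xs. tmat xs b a * v a) =
      (\<Sum>a\<in>Bas xs. if a = (fst b, snd b - 1) then (if b \<in> Bas xs \<and> 0 < snd b then v a else 0) else 0)"
    by (rule sum.cong) (auto simp: tmat_def)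
  also have "\<dots> = tshift xs v b"
    by (cases b) (auto simp: tshift_def sum.delta' mem_Bas)
  finally show "mv (Bas xs) (tmat xs) v b = tshift xs v b" by (simp add: mv_def)
qed

lemma mv_mmul:
  assumes "finite K" "finite L"
  shows "mv L (mmul K P Q) v = mv K P (mv L Q v)"
proof
  fix b
  have "(\<Sum>a\<in>L. (\<Sum>c\<in>K. P b c * Q c a) * v a) = (\<Sum>a\<in>L. \<Sum>c\<in>K. P b c * Q c a * v a)"
    by (simp add: sum_distrib_right)
  also have "\<dots> = (\<Sum>c\<in>K. \<Sum>a\<in>L. P b c * Q c a * v a)" by (rule sum.swap)
  finally show "mv L (mmul K P Q) v b = mv K P (mv L Q v) b"
    by (simp add: mv_def mmul_def sum_distrib_left mult.assoc)
qed

lemma mv_VS: "M \<in> Hom xs ys \<Longrightarrow> mv (Bas xs) M v \<in> VS ys"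
  by (rule coord_space_I) (simp add: mv_def HomD)

lemma mv_unit_vec: "a \<in> Bas xs \<Longrightarrow> mv (Bas xs) M (unit_vec a) = (\<lambda>b. M b a)"
  by (auto simp: mv_def unit_vec_apply fun_eq_iff if_distrib[of "\<lambda>x. _ * x"] cong: if_cong)

lemma unit_vec_VS: "a \<in> Bas xs \<Longrightarrow> unit_vec a \<in> VS xs"
  by (auto simp: coord_space_def unit_vec_apply)

lemma Hom_eqI:
  assumes "M \<in> Hom xs ys" "M' \<in> Hom xs ys"
    "\<And>v. v \<in> VS xs \<Longrightarrow> mv (Bas xs) M v = mv (Bas xs) M' v"
  shows "M = M'"
proof (intro ext)
  fix b a
  show "M b a = M' b a"
  proof (cases "a \<in> Bas xs")
    case True
    then show ?thesis using fun_cong[OF assms(3)[OF unit_vec_VS[OF True]], of b] by (simp add: mv_unit_vec)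
  qed (use assms in \<open>simp add: HomD\<close>)
qed

lemma mmul_Hom: "P \<in> Hom ys zs \<Longrightarrow> Q \<in> Hom xs ys \<Longrightarrow> mmul (Bas ys) P Q \<in> Hom xs zs"
  by (rule HomI) (auto simp: mmul_def HomD intro!: sum.neutral)

lemma tmat_Hom: "tmat xs \<in> Hom xs xs" by (auto simp: Hom_def tmat_def)

lemma idm_Hom: "idm xs \<in> Hom xs xs" by (auto simp: Hom_def idm_def)

lemma mv_idm: "v \<in> VS xs \<Longrightarrow> mv (Bas xs) (idm xs) v = v"
proof
  fix b assume "v \<in> VS xs"
  have "(\<Sum>a\<in>Bas xs. idm xs b a * v a) = (\<Sum>a\<in>Bas xs. if b = a then v a else 0)"
    by (rule sum.cong) (auto simp: idm_def)
  then show "mv (Bas xs) (idm xs) v b = v b"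
    using VS_D[OF \<open>v \<in> VS xs\<close>, of b] by (auto simp: mv_def)
qed

definition mat_of :: "nat list \<Rightarrow> ((idx \<Rightarrow> 'k::field) \<Rightarrow> idx \<Rightarrow> 'k) \<Rightarrow> 'k mat" where
  "mat_of xs F = (\<lambda>b a. if a \<in> Bas xs then F (unit_vec a) b else 0)"

lemma mv_mat_of:
  assumes "lin F" "v \<in> VS xs"
  shows "mv (Bas xs) (mat_of xs F) v = F v"
proof -
  have "F v = F (\<Sum>a\<in>Bas xs. vscale (v a) (unit_vec a))" using coord_space_expand[OF finite_Bas assms(2)] by simp
  also have "\<dots> = (\<Sum>a\<in>Bas xs. vscale (v a) (F (unit_vec a)))"
    by (simp add: lin_sum[OF assms(1)] lin_vscale[OF assms(1)])
  also have "\<dots> = mv (Bas xs) (mat_of xs F) v"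
    by (auto simp: fun_eq_iff mv_def mat_of_def sum_fun_apply intro!: sum.cong)
  finally show ?thesis ..
qed

lemma mat_of_Hom: "(\<And>v. v \<in> VS xs \<Longrightarrow> F v \<in> VS ys) \<Longrightarrow> mat_of xs F \<in> Hom xs ys"
  using unit_vec_VS[of _ xs] VS_D[of _ ys] by (fastforce simp: Hom_def mat_of_def)

text \<open>Linearity is required on the whole function space, compatibility with \<open>T\<close>
  only on the module itself. Maps are compared only on \<open>VS xs\<close>, and turning them into
  matrices by \<open>mat_of\<close> discards the rest.\<close>

definition thom :: "nat list \<Rightarrow> nat list \<Rightarrow> ((idx \<Rightarrow> 'k::field) \<Rightarrow> idx \<Rightarrow> 'k) \<Rightarrow> bool" where
  "thom xs ys F \<longleftrightarrow> lin F \<and> (\<forall>v\<in>VS xs. F v \<in> VS ys) \<and> (\<forall>v\<in>VS xs. F (tshift xs v) = tshift ys (F v))"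

definition tiso :: "nat list \<Rightarrow> nat list \<Rightarrow> ((idx \<Rightarrow> 'k::field) \<Rightarrow> idx \<Rightarrow> 'k) \<Rightarrow> bool" where
  "tiso xs ys F \<longleftrightarrow> thom xs ys F \<and> bij_betw F (VS xs) (VS ys)"

lemma is_hom_iff: "is_hom xs ys M \<longleftrightarrow> M \<in> Hom xs ys \<and> thom xs ys (mv (Bas xs) M)"
proof
  assume h: "is_hom xs ys M"
  then have M: "M \<in> Hom xs ys" and e: "mmul (Bas xs) M (tmat xs) = mmul (Bas ys) (tmat ys) M"
    by (auto simp: is_hom_def)
  have "mv (Bas xs) M (tshift xs v) = tshift ys (mv (Bas xs) M v)" for v
    using arg_cong[OF e, of "\<lambda>X. mv (Bas xs) X v"] by (simp add: mv_mmul mv_tmat)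
  then show "M \<in> Hom xs ys \<and> thom xs ys (mv (Bas xs) M)"
    using M by (simp add: thom_def lin_mv mv_VS)
next
  assume h: "M \<in> Hom xs ys \<and> thom xs ys (mv (Bas xs) M)"
  have "mmul (Bas xs) M (tmat xs) = mmul (Bas ys) (tmat ys) M"
    by (rule Hom_eqI[of _ xs ys])
       (use h in \<open>auto simp: mmul_Hom tmat_Hom mv_mmul mv_tmat thom_def\<close>)
  then show "is_hom xs ys M" using h by (simp add: is_hom_def)
qed

lemma thom_comp: "thom xs ys F \<Longrightarrow> thom ys zs G \<Longrightarrow> thom xs zs (\<lambda>v. G (F v))"
  by (simp add: thom_def lin_comp)

lemma tiso_comp: "tiso xs ys F \<Longrightarrow> tiso ys zs G \<Longrightarrow> tiso xs zs (\<lambda>v. G (F v))"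
  using bij_betw_trans[of F "VS xs" "VS ys" G "VS zs"] by (auto simp: tiso_def thom_comp comp_def)

lemma tiso_id: "tiso xs xs (\<lambda>v. v)"
  by (simp add: tiso_def thom_def linI bij_betw_def)

text \<open>The inverse is taken as a globally linear left inverse on \<open>VS xs\<close>, so that
  it satisfies \<open>thom\<close> again.\<close>

lemma tiso_inverse:
  assumes "tiso xs ys F"
  obtains G where "tiso ys xs G" "\<And>v. v \<in> VS xs \<Longrightarrow> G (F v) = v" "\<And>w. w \<in> VS ys \<Longrightarrow> F (G w) = w"
proof -
  have F: "lin F" "inj_on F (VS xs)" "F ` VS xs = VS ys" "\<And>v. v \<in> VS xs \<Longrightarrow> F (tshift xs v) = tshift ys (F v)"
    using assms by (auto simp: tiso_def thom_def bij_betw_def)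
  obtain G where G: "lin G" "\<forall>v\<in>VS xs. G (F v) = v"
    using fvv.linear_exists_left_inverse_on[OF F(1) subspace_coord_space F(2)] by blast
  have FG: "F (G w) = w \<and> G w \<in> VS xs" if w: "w \<in> VS ys" for w
  proof -
    obtain v where "v \<in> VS xs" "w = F v" using w F(3) by blast
    then show ?thesis using G by simp
  qed
  have "G (tshift ys w) = tshift xs (G w)" if w: "w \<in> VS ys" for w
  proof -
    have "F (tshift xs (G w)) = tshift ys w" using F(4) FG[OF w] by simp
    then show ?thesis using G by (metis tshift_VS)
  qed
  then have "thom ys xs G" using G FG by (simp add: thom_def)
  moreover have "bij_betw G (VS ys) (VS xs)"
    by (rule bij_betw_byWitness[where f' = F]) (use G FG F in auto)
  ultimately show ?thesis using that[of G] G FG by (simp add: tiso_def)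
qed

lemma is_iso_iff: "is_iso xs ys P \<longleftrightarrow> P \<in> Hom xs ys \<and> tiso xs ys (mv (Bas xs) P)"
proof
  assume "is_iso xs ys P"
  then obtain Q where P: "is_hom xs ys P" and Q: "is_hom ys xs Q"
    "mmul (Bas ys) Q P = idm xs" "mmul (Bas xs) P Q = idm ys"
    by (auto simp: is_iso_def)
  have "mv (Bas ys) Q (mv (Bas xs) P v) = v" if "v \<in> VS xs" for v
    using arg_cong[OF Q(2), of "\<lambda>X. mv (Bas xs) X v"] that by (simp add: mv_mmul mv_idm)
  moreover have "mv (Bas xs) P (mv (Bas ys) Q v) = v" if "v \<in> VS ys" for v
    using arg_cong[OF Q(3), of "\<lambda>X. mv (Bas ys) X v"] that by (simp add: mv_mmul mv_idm)
  ultimately have "bij_betw (mv (Bas xs) P) (VS xs) (VS ys)"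
    by (intro bij_betw_byWitness[where f' = "mv (Bas ys) Q"]) (use P Q in \<open>auto simp: is_hom_iff mv_VS\<close>)
  then show "P \<in> Hom xs ys \<and> tiso xs ys (mv (Bas xs) P)" using P by (simp add: tiso_def is_hom_iff)
next
  assume h: "P \<in> Hom xs ys \<and> tiso xs ys (mv (Bas xs) P)"
  obtain G where G: "tiso ys xs G" "\<And>v. v \<in> VS xs \<Longrightarrow> G (mv (Bas xs) P v) = v"
    "\<And>w. w \<in> VS ys \<Longrightarrow> mv (Bas xs) P (G w) = w"
    using tiso_inverse[of xs ys "mv (Bas xs) P"] h by blast
  have lG: "lin G" "\<And>v. v \<in> VS ys \<Longrightarrow> G v \<in> VS xs" "\<And>v. v \<in> VS ys \<Longrightarrow> G (tshift ys v) = tshift xs (G v)"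
    using G by (auto simp: tiso_def thom_def)
  define Q where "Q = mat_of ys G"
  have QH: "Q \<in> Hom ys xs" unfolding Q_def by (rule mat_of_Hom) (rule lG)
  have Qv: "mv (Bas ys) Q v = G v" if "v \<in> VS ys" for v unfolding Q_def by (rule mv_mat_of) (use lG that in auto)
  have "is_hom ys xs Q" using QH Qv lG by (simp add: is_hom_iff thom_def lin_mv)
  moreover have "mmul (Bas ys) Q P = idm xs"
    by (rule Hom_eqI[of _ xs xs]) (use h QH Qv G in \<open>auto simp: mmul_Hom idm_Hom mv_mmul mv_idm mv_VS\<close>)
  moreover have "mmul (Bas xs) P Q = idm ys"
    by (rule Hom_eqI[of _ ys ys]) (use h QH Qv G in \<open>auto simp: mmul_Hom idm_Hom mv_mmul mv_idm mv_VS\<close>)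
  ultimately show "is_iso xs ys P" using h by (auto simp: is_iso_def is_hom_iff tiso_def)
qed

lemma mat_of_iso:
  assumes "tiso xs ys F"
  shows "is_iso xs ys (mat_of xs F)" "v \<in> VS xs \<Longrightarrow> mv (Bas xs) (mat_of xs F) v = F v"
proof -
  have F: "lin F" "\<And>v. v \<in> VS xs \<Longrightarrow> F v \<in> VS ys" using assms by (auto simp: tiso_def thom_def)
  show mv: "\<And>v. v \<in> VS xs \<Longrightarrow> mv (Bas xs) (mat_of xs F) v = F v" by (rule mv_mat_of) (use F in auto)
  have "bij_betw (mv (Bas xs) (mat_of xs F)) (VS xs) (VS ys) = bij_betw F (VS xs) (VS ys)"
    by (rule bij_betw_cong) (rule mv)
  then show "is_iso xs ys (mat_of xs F)"
    using assms mv by (simp add: is_iso_iff tiso_def thom_def lin_mv mat_of_Hom)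
qed

definition emb_iso_fun :: "nat list \<Rightarrow> nat list \<Rightarrow> ((idx \<Rightarrow> 'k::field) \<Rightarrow> idx \<Rightarrow> 'k) \<Rightarrow>
    nat list \<Rightarrow> nat list \<Rightarrow> ((idx \<Rightarrow> 'k) \<Rightarrow> idx \<Rightarrow> 'k) \<Rightarrow> bool" where
  "emb_iso_fun xs ys F xs' ys' F' \<longleftrightarrow>
     (\<exists>\<phi> \<psi>. tiso xs xs' \<phi> \<and> tiso ys ys' \<psi> \<and> (\<forall>v\<in>VS xs. \<psi> (F v) = F' (\<phi> v)))"

lemma emb_iso_fun_refl: "emb_iso_fun xs ys F xs ys F"
  unfolding emb_iso_fun_def using tiso_id by blast

lemma emb_iso_fun_trans:
  assumes "emb_iso_fun xs ys F xs' ys' F'" "emb_iso_fun xs' ys' F' xs'' ys'' F''"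
  shows "emb_iso_fun xs ys F xs'' ys'' F''"
proof -
  obtain \<phi> \<psi> where 1: "tiso xs xs' \<phi>" "tiso ys ys' \<psi>" "\<forall>v\<in>VS xs. \<psi> (F v) = F' (\<phi> v)"
    using assms(1) by (auto simp: emb_iso_fun_def)
  obtain \<phi>' \<psi>' where 2: "tiso xs' xs'' \<phi>'" "tiso ys' ys'' \<psi>'" "\<forall>v\<in>VS xs'. \<psi>' (F' v) = F'' (\<phi>' v)"
    using assms(2) by (auto simp: emb_iso_fun_def)
  have "\<psi>' (\<psi> (F v)) = F'' (\<phi>' (\<phi> v))" if "v \<in> VS xs" for v
    using 1 2 that by (auto simp: tiso_def thom_def)
  then show ?thesis unfolding emb_iso_fun_def
    using tiso_comp[OF 1(1) 2(1)] tiso_comp[OF 1(2) 2(2)] by blast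
qed

lemma emb_iso_fun_sym:
  assumes "emb_iso_fun xs ys F xs' ys' F'" "\<And>v. v \<in> VS xs \<Longrightarrow> F v \<in> VS ys"
  shows "emb_iso_fun xs' ys' F' xs ys F"
proof -
  obtain \<phi> \<psi> where 1: "tiso xs xs' \<phi>" "tiso ys ys' \<psi>" "\<forall>v\<in>VS xs. \<psi> (F v) = F' (\<phi> v)"
    using assms(1) by (auto simp: emb_iso_fun_def)
  obtain \<phi>' where p: "tiso xs' xs \<phi>'" "\<And>v. v \<in> VS xs \<Longrightarrow> \<phi>' (\<phi> v) = v" "\<And>w. w \<in> VS xs' \<Longrightarrow> \<phi> (\<phi>' w) = w"
    using tiso_inverse[OF 1(1)] by blast
  obtain \<psi>' where q: "tiso ys' ys \<psi>'" "\<And>v. v \<in> VS ys \<Longrightarrow> \<psi>' (\<psi> v) = v" "\<And>w. w \<in> VS ys' \<Longrightarrow> \<psi> (\<psi>' w) = w"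
    using tiso_inverse[OF 1(2)] by blast
  have "\<psi>' (F' w) = F (\<phi>' w)" if w: "w \<in> VS xs'" for w
  proof -
    have v: "\<phi>' w \<in> VS xs" using p(1) w by (auto simp: tiso_def thom_def)
    then have "\<psi> (F (\<phi>' w)) = F' w" using 1(3) p(3)[OF w] by simp
    then show ?thesis using q(2)[OF assms(2)[OF v]] by simp
  qed
  then show ?thesis unfolding emb_iso_fun_def using p(1) q(1) by blast
qed

lemma emb_iso_iff:
  assumes "M \<in> Hom xs ys" "M' \<in> Hom xs' ys'"
  shows "emb_iso (xs, ys, M) (xs', ys', M') \<longleftrightarrow> emb_iso_fun xs ys (mv (Bas xs) M) xs' ys' (mv (Bas xs') M')"
proof
  assume "emb_iso (xs, ys, M) (xs', ys', M')"
  then obtain \<phi> \<psi> where 1: "is_iso xs xs' \<phi>" "is_iso ys ys' \<psi>" "mmul (Bas ys) \<psi> M = mmul (Bas xs') M' \<phi>"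
    by auto
  have "mv (Bas ys) \<psi> (mv (Bas xs) M v) = mv (Bas xs') M' (mv (Bas xs) \<phi> v)" for v
    using arg_cong[OF 1(3), of "\<lambda>X. mv (Bas xs) X v"] by (simp add: mv_mmul)
  then show "emb_iso_fun xs ys (mv (Bas xs) M) xs' ys' (mv (Bas xs') M')"
    using 1 unfolding emb_iso_fun_def is_iso_iff by blast
next
  assume "emb_iso_fun xs ys (mv (Bas xs) M) xs' ys' (mv (Bas xs') M')"
  then obtain \<phi> \<psi> where 1: "tiso xs xs' \<phi>" "tiso ys ys' \<psi>"
    "\<forall>v\<in>VS xs. \<psi> (mv (Bas xs) M v) = mv (Bas xs') M' (\<phi> v)"
    by (auto simp: emb_iso_fun_def)
  have H: "mat_of xs \<phi> \<in> Hom xs xs'" "mat_of ys \<psi> \<in> Hom ys ys'"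
    using mat_of_iso(1)[OF 1(1)] mat_of_iso(1)[OF 1(2)] by (auto simp: is_iso_iff)
  have "mmul (Bas ys) (mat_of ys \<psi>) M = mmul (Bas xs') M' (mat_of xs \<phi>)"
    by (rule Hom_eqI[of _ xs ys'])
       (use assms H 1 in \<open>auto simp: mmul_Hom mv_mmul mat_of_iso(2)[OF 1(1)] mat_of_iso(2)[OF 1(2)] mv_VS\<close>)
  then show "emb_iso (xs, ys, M) (xs', ys', M')"
    using mat_of_iso(1)[OF 1(1)] mat_of_iso(1)[OF 1(2)] by auto
qed

lemma orbit_Hom: "(M :: 'k::field mat) \<in> Hom xs ys \<Longrightarrow> M' \<in> orbit xs ys M \<Longrightarrow> M' \<in> Hom xs ys"
  unfolding orbit_def Aut_def by (auto simp: is_iso_iff intro!: mmul_Hom)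

text \<open>An isomorphism given by \<open>\<phi>\<close> and \<open>\<psi>\<close> turns
  \<open>M\<close> into \<open>\<psi>\<close> composed with \<open>M\<close> and the inverse of
  \<open>\<phi>\<close>. The orbit is thus the isomorphism class among maps between the same two
  modules.\<close>

lemma orbit_iff:
  assumes "M \<in> Hom xs ys"
  shows "M' \<in> orbit xs ys M \<longleftrightarrow> M' \<in> Hom xs ys \<and> emb_iso_fun xs ys (mv (Bas xs) M) xs ys (mv (Bas xs) M')"
proof
  assume o: "M' \<in> orbit xs ys M"
  then obtain A H where AH: "is_iso xs xs A" "is_iso ys ys H" "M' = mmul (Bas xs) (mmul (Bas ys) H M) A"
    by (auto simp: orbit_def Aut_def)
  have tA: "tiso xs xs (mv (Bas xs) A)" "tiso ys ys (mv (Bas ys) H)" using AH by (auto simp: is_iso_iff)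
  obtain \<phi> where p: "tiso xs xs \<phi>" "\<And>v. v \<in> VS xs \<Longrightarrow> mv (Bas xs) A (\<phi> v) = v"
    using tiso_inverse[OF tA(1)] by metis
  have "mv (Bas ys) H (mv (Bas xs) M v) = mv (Bas xs) M' (\<phi> v)" if "v \<in> VS xs" for v
    using p(2)[OF that] by (simp add: AH(3) mv_mmul)
  then show "M' \<in> Hom xs ys \<and> emb_iso_fun xs ys (mv (Bas xs) M) xs ys (mv (Bas xs) M')"
    using orbit_Hom[OF assms o] p(1) tA(2) unfolding emb_iso_fun_def by blast
next
  assume h: "M' \<in> Hom xs ys \<and> emb_iso_fun xs ys (mv (Bas xs) M) xs ys (mv (Bas xs) M')"
  then obtain \<phi> \<psi> where 1: "tiso xs xs \<phi>" "tiso ys ys \<psi>"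
    "\<forall>v\<in>VS xs. \<psi> (mv (Bas xs) M v) = mv (Bas xs) M' (\<phi> v)"
    by (auto simp: emb_iso_fun_def)
  obtain \<phi>' where p: "tiso xs xs \<phi>'" "\<And>w. w \<in> VS xs \<Longrightarrow> \<phi> (\<phi>' w) = w"
    using tiso_inverse[OF 1(1)] by metis
  have p': "\<phi>' v \<in> VS xs" if "v \<in> VS xs" for v using p(1) that by (auto simp: tiso_def thom_def)
  have H: "mat_of xs \<phi>' \<in> Hom xs xs" "mat_of ys \<psi> \<in> Hom ys ys"
    using mat_of_iso(1)[OF p(1)] mat_of_iso(1)[OF 1(2)] by (auto simp: is_iso_iff)
  have "M' = mmul (Bas xs) (mmul (Bas ys) (mat_of ys \<psi>) M) (mat_of xs \<phi>')"
    by (rule Hom_eqI[of _ xs ys])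
       (use assms h H 1(3) p' in \<open>auto simp: mmul_Hom mv_mmul mat_of_iso(2)[OF p(1)] mat_of_iso(2)[OF 1(2)] mv_VS p(2)\<close>)
  then show "M' \<in> orbit xs ys M" unfolding orbit_def Aut_def
    using mat_of_iso(1)[OF p(1)] mat_of_iso(1)[OF 1(2)] by blast
qed

lemma inj_mat_iff:
  assumes "M \<in> Hom xs ys"
  shows "inj_mat xs ys M \<longleftrightarrow> inj_on (mv (Bas xs) M) (VS xs)"
proof -
  have z: "mv (Bas xs) M v = 0 \<longleftrightarrow> (\<forall>b\<in>Bas ys. mv (Bas xs) M v b = 0)" for v
  proof
    assume h: "\<forall>b\<in>Bas ys. mv (Bas xs) M v b = 0"
    show "mv (Bas xs) M v = 0"
    proof
      fix b show "mv (Bas xs) M v b = 0 b"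
        using h VS_D[OF mv_VS[OF assms], of b v] by (cases "b \<in> Bas ys") simp_all
    qed
  qed simp
  have v0: "(\<forall>a. v a = 0) \<longleftrightarrow> v = 0" for v :: "idx \<Rightarrow> 'a" by (simp add: fun_eq_iff)
  have "inj_on (mv (Bas xs) M) (VS xs) \<longleftrightarrow> (\<forall>v\<in>VS xs. mv (Bas xs) M v = 0 \<longrightarrow> v = 0)"
    using fvv.linear_inj_on_iff_eq_0[OF lin_mv subspace_coord_space] by blast
  then show ?thesis unfolding inj_mat_def vec_on_VS z[symmetric] v0
    by (simp only: Ball_def imp_conjL)
qed

section \<open>Direct sums by concatenation of blocks\<close>

definition take_blocks :: "nat \<Rightarrow> (idx \<Rightarrow> 'k::field) \<Rightarrow> idx \<Rightarrow> 'k" where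
  "take_blocks n v = (\<lambda>(i, j). if i < n then v (i, j) else 0)"

definition drop_blocks :: "nat \<Rightarrow> (idx \<Rightarrow> 'k::field) \<Rightarrow> idx \<Rightarrow> 'k" where
  "drop_blocks n v = (\<lambda>(i, j). v (i + n, j))"

definition join_blocks :: "nat \<Rightarrow> (idx \<Rightarrow> 'k::field) \<Rightarrow> (idx \<Rightarrow> 'k) \<Rightarrow> idx \<Rightarrow> 'k" where
  "join_blocks n u w = (\<lambda>(i, j). if i < n then u (i, j) else w (i - n, j))"

lemma take_blocks_apply [simp]: "take_blocks n v (i, j) = (if i < n then v (i, j) else 0)" by (simp add: take_blocks_def)
lemma drop_blocks_apply [simp]: "drop_blocks n v (i, j) = v (i + n, j)" by (simp add: drop_blocks_def)
lemma join_blocks_apply [simp]: "join_blocks n u w (i, j) = (if i < n then u (i, j) else w (i - n, j))" by (simp add: join_blocks_def)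

lemma ext2: "(\<And>i j. f (i, j) = g (i, j)) \<Longrightarrow> f = g"
  by auto

lemma mem_Bas_append:
  "(i, j) \<in> Bas (xs @ ys) \<longleftrightarrow> (if i < length xs then (i, j) \<in> Bas xs else (i - length xs, j) \<in> Bas ys)"
  by (auto simp: mem_Bas nth_append)

lemma VS_I2: "(\<And>i j. (i, j) \<notin> Bas xs \<Longrightarrow> v (i, j) = 0) \<Longrightarrow> v \<in> VS xs"
  by (rule coord_space_I) (metis prod.collapse)

lemma take_blocks_VS: "v \<in> VS (xs @ ys) \<Longrightarrow> take_blocks (length xs) v \<in> VS xs"
  by (rule VS_I2) (simp add: VS_D mem_Bas_append)

lemma drop_blocks_VS: "v \<in> VS (xs @ ys) \<Longrightarrow> drop_blocks (length xs) v \<in> VS ys"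
  by (rule VS_I2) (simp add: VS_D mem_Bas_append)

lemma join_blocks_VS: "u \<in> VS xs \<Longrightarrow> w \<in> VS ys \<Longrightarrow> join_blocks (length xs) u w \<in> VS (xs @ ys)"
  by (rule VS_I2) (auto simp: VS_D mem_Bas_append)

lemma take_blocks_id: "u \<in> VS xs \<Longrightarrow> take_blocks (length xs) u = u"
  by (rule ext2) (auto simp: VS_D mem_Bas)

lemma join_blocks_take_blocks_drop_blocks [simp]: "join_blocks n (take_blocks n v) (drop_blocks n v) = v"
  by (rule ext2) simp

lemma take_blocks_join_blocks [simp]: "take_blocks n (join_blocks n u w) = take_blocks n u"
  by (rule ext2) simp

lemma drop_blocks_join_blocks [simp]: "drop_blocks n (join_blocks n u w) = w"
  by (rule ext2) simp

lemma lin_take_blocks: "lin (take_blocks n)"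
  by (rule linI; rule ext2) auto

lemma lin_drop_blocks: "lin (drop_blocks n)"
  by (rule linI; rule ext2) auto

lemma lin_join_blocks: "lin F \<Longrightarrow> lin G \<Longrightarrow> lin (\<lambda>v. join_blocks n (F v) (G v))"
  by (rule linI; rule ext2) (auto simp: lin_add lin_vscale)

lemma tshift_join_blocks: "tshift (xs @ ys) (join_blocks (length xs) u w) = join_blocks (length xs) (tshift xs u) (tshift ys w)"
  by (rule ext2) (auto simp: tshift_apply mem_Bas_append)

lemma take_blocks_tshift: "take_blocks (length xs) (tshift (xs @ ys) v) = tshift xs (take_blocks (length xs) v)"
  by (rule ext2) (auto simp: tshift_apply mem_Bas nth_append)

lemma drop_blocks_tshift: "drop_blocks (length xs) (tshift (xs @ ys) v) = tshift ys (drop_blocks (length xs) v)"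
  by (rule ext2) (auto simp: tshift_apply mem_Bas nth_append)

type_synonym 'k femb = "nat list \<times> nat list \<times> ((idx \<Rightarrow> 'k) \<Rightarrow> idx \<Rightarrow> 'k)"

fun fsum :: "'k::field femb \<Rightarrow> 'k femb \<Rightarrow> 'k femb" where
  "fsum (xs, ys, F) (xs', ys', F') =
     (xs @ xs', ys @ ys', \<lambda>v. join_blocks (length ys) (F (take_blocks (length xs) v)) (F' (drop_blocks (length xs) v)))"

fun eqv :: "'k::field femb \<Rightarrow> 'k femb \<Rightarrow> bool" where
  "eqv (xs, ys, F) (xs', ys', F') \<longleftrightarrow> emb_iso_fun xs ys F xs' ys' F'"

fun hemb :: "'k::field femb \<Rightarrow> bool" where
  "hemb (xs, ys, F) \<longleftrightarrow> thom xs ys F"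

fun fun_emb :: "'k::field emb \<Rightarrow> 'k femb" where
  "fun_emb (xs, ys, M) = (xs, ys, mv (Bas xs) M)"

lemma eqv_refl: "eqv X X"
  by (cases X) (simp add: emb_iso_fun_refl)

lemma eqv_trans: "eqv X Y \<Longrightarrow> eqv Y Z \<Longrightarrow> eqv X Z"
  by (cases X; cases Y; cases Z) (auto intro: emb_iso_fun_trans)

lemma eqv_sym: "eqv X Y \<Longrightarrow> hemb X \<Longrightarrow> eqv Y X"
  by (cases X; cases Y) (auto simp: thom_def intro: emb_iso_fun_sym)

lemma sum_Bas_append:
  "(\<Sum>a\<in>Bas (xs @ ys). f a) = (\<Sum>a\<in>Bas xs. f a) + (\<Sum>a\<in>Bas ys. f (fst a + length xs, snd a))"
proof -
  let ?s = "\<lambda>a::idx. (fst a + length xs, snd a)"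
  have "(i, j) \<in> Bas (xs @ ys) \<longleftrightarrow> (i, j) \<in> Bas xs \<union> ?s ` Bas ys" for i j
  proof (cases "i < length xs")
    case True
    then show ?thesis by (auto simp: mem_Bas_append)
  next
    case False
    then have "(i, j) \<in> ?s ` Bas ys \<longleftrightarrow> (i - length xs, j) \<in> Bas ys"
      by (auto simp: image_iff intro!: bexI[of _ "(i - length xs, j)"])
    then show ?thesis using False by (auto simp: mem_Bas nth_append)
  qed
  then have e: "Bas (xs @ ys) = Bas xs \<union> ?s ` Bas ys" by (intro set_eqI) (simp only: split_paired_all)
  have d: "Bas xs \<inter> ?s ` Bas ys = {}" by (auto simp: mem_Bas)
  have "inj_on ?s (Bas ys)" by (auto simp: inj_on_def)
  then show ?thesis unfolding e using d by (subst sum.union_disjoint) (auto simp: sum.reindex)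
qed

lemma fun_emb_dsum: "fun_emb (dsum X Y) = fsum (fun_emb X) (fun_emb Y)"
proof (cases X; cases Y)
  fix xs ys M xs' ys' M' assume X: "X = (xs, ys, M)" and Y: "Y = (xs', ys', M')"
  let ?D = "\<lambda>(i, j) (i', j').
        if i < length ys \<and> i' < length xs then M (i, j) (i', j')
        else if length ys \<le> i \<and> length xs \<le> i' then M' (i - length ys, j) (i' - length xs, j')
        else (0::'a)"
  have "mv (Bas (xs @ xs')) ?D v =
      join_blocks (length ys) (mv (Bas xs) M (take_blocks (length xs) v)) (mv (Bas xs') M' (drop_blocks (length xs) v))" for v
  proof (rule ext2)
    fix i j
    have 1: "(\<Sum>a\<in>Bas xs. ?D (i, j) a * v a) = (if i < length ys then (\<Sum>a\<in>Bas xs. M (i, j) a * take_blocks (length xs) v a) else 0)"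
      by (auto intro!: sum.cong sum.neutral simp: mem_Bas)
    have 2: "(\<Sum>a\<in>Bas xs'. ?D (i, j) (fst a + length xs, snd a) * v (fst a + length xs, snd a)) =
        (if i < length ys then 0 else (\<Sum>a\<in>Bas xs'. M' (i - length ys, j) a * drop_blocks (length xs) v a))"
      by (auto intro!: sum.cong sum.neutral simp: mem_Bas)
    show "mv (Bas (xs @ xs')) ?D v (i, j) =
      join_blocks (length ys) (mv (Bas xs) M (take_blocks (length xs) v)) (mv (Bas xs') M' (drop_blocks (length xs) v)) (i, j)"
      unfolding mv_def sum_Bas_append 1 2 by simp
  qed
  then have "mv (Bas (xs @ xs')) ?D =
      (\<lambda>v. join_blocks (length ys) (mv (Bas xs) M (take_blocks (length xs) v)) (mv (Bas xs') M' (drop_blocks (length xs) v)))" by (rule ext)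
  then show ?thesis by (simp add: X Y)
qed

lemma thom_fsum: "hemb X \<Longrightarrow> hemb Y \<Longrightarrow> hemb (fsum X Y)"
proof (cases X; cases Y)
  fix xs ys F xs' ys' F' assume X: "X = (xs, ys, F)" and Y: "Y = (xs', ys', F')" and h: "hemb X" "hemb Y"
  show ?thesis unfolding X Y fsum.simps hemb.simps thom_def
  proof (intro conjI ballI)
    show "lin (\<lambda>v. join_blocks (length ys) (F (take_blocks (length xs) v)) (F' (drop_blocks (length xs) v)))"
      by (rule lin_join_blocks; rule lin_comp) (use h in \<open>auto simp: X Y thom_def lin_take_blocks lin_drop_blocks\<close>)
  next
    fix v :: "idx \<Rightarrow> 'a" assume v: "v \<in> VS (xs @ xs')"
    note vv = take_blocks_VS[OF v] drop_blocks_VS[OF v]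
    show "join_blocks (length ys) (F (take_blocks (length xs) v)) (F' (drop_blocks (length xs) v)) \<in> VS (ys @ ys')"
      by (rule join_blocks_VS) (use h vv in \<open>auto simp: X Y thom_def\<close>)
    show "join_blocks (length ys) (F (take_blocks (length xs) (tshift (xs @ xs') v))) (F' (drop_blocks (length xs) (tshift (xs @ xs') v))) =
         tshift (ys @ ys') (join_blocks (length ys) (F (take_blocks (length xs) v)) (F' (drop_blocks (length xs) v)))"
      using h vv by (simp add: X Y thom_def tshift_join_blocks take_blocks_tshift drop_blocks_tshift)
  qed
qed

lemma tiso_fsum:
  fixes F :: "(idx \<Rightarrow> 'a::field) \<Rightarrow> idx \<Rightarrow> 'a"
  assumes "tiso xs ys F" "tiso xs' ys' F'"
  shows "tiso (xs @ xs') (ys @ ys') (\<lambda>v. join_blocks (length ys) (F (take_blocks (length xs) v)) (F' (drop_blocks (length xs) v)))"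
proof -
  obtain G where G: "tiso ys xs G" "\<And>v. v \<in> VS xs \<Longrightarrow> G (F v) = v" "\<And>w. w \<in> VS ys \<Longrightarrow> F (G w) = w"
    using tiso_inverse[OF assms(1)] by blast
  obtain G' where G': "tiso ys' xs' G'" "\<And>v. v \<in> VS xs' \<Longrightarrow> G' (F' v) = v" "\<And>w. w \<in> VS ys' \<Longrightarrow> F' (G' w) = w"
    using tiso_inverse[OF assms(2)] by blast
  have m: "\<And>v. v \<in> VS xs \<Longrightarrow> F v \<in> VS ys" "\<And>v. v \<in> VS xs' \<Longrightarrow> F' v \<in> VS ys'"
     "\<And>v. v \<in> VS ys \<Longrightarrow> G v \<in> VS xs" "\<And>v. v \<in> VS ys' \<Longrightarrow> G' v \<in> VS xs'"
    using assms G(1) G'(1) by (auto simp: tiso_def thom_def)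
  have "bij_betw (\<lambda>v. join_blocks (length ys) (F (take_blocks (length xs) v)) (F' (drop_blocks (length xs) v))) (VS (xs @ xs')) (VS (ys @ ys'))"
  proof (rule bij_betw_byWitness[where f' = "\<lambda>v. join_blocks (length xs) (G (take_blocks (length ys) v)) (G' (drop_blocks (length ys) v))"])
    show "\<forall>a\<in>VS (xs @ xs'). join_blocks (length xs) (G (take_blocks (length ys) (join_blocks (length ys) (F (take_blocks (length xs) a)) (F' (drop_blocks (length xs) a)))))
              (G' (drop_blocks (length ys) (join_blocks (length ys) (F (take_blocks (length xs) a)) (F' (drop_blocks (length xs) a))))) = a" (is "\<forall>a\<in>_. ?f a = a")
    proof
      fix a :: "idx \<Rightarrow> 'a" assume "a \<in> VS (xs @ xs')"
      then show "?f a = a" using m G(2) G'(2) take_blocks_VS[of a xs xs'] drop_blocks_VS[of a xs xs'] by (simp add: take_blocks_id)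
    qed
    show "\<forall>a\<in>VS (ys @ ys'). join_blocks (length ys) (F (take_blocks (length xs) (join_blocks (length xs) (G (take_blocks (length ys) a)) (G' (drop_blocks (length ys) a)))))
              (F' (drop_blocks (length xs) (join_blocks (length xs) (G (take_blocks (length ys) a)) (G' (drop_blocks (length ys) a))))) = a" (is "\<forall>a\<in>_. ?g a = a")
    proof
      fix a :: "idx \<Rightarrow> 'a" assume "a \<in> VS (ys @ ys')"
      then show "?g a = a" using m G(3) G'(3) take_blocks_VS[of a ys ys'] drop_blocks_VS[of a ys ys'] by (simp add: take_blocks_id)
    qed
  qed (use m in \<open>auto intro!: join_blocks_VS dest: take_blocks_VS drop_blocks_VS\<close>)
  moreover have "hemb (fsum (xs, ys, F) (xs', ys', F'))"
    by (rule thom_fsum) (use assms in \<open>auto simp: tiso_def\<close>)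
  ultimately show ?thesis by (simp add: tiso_def)
qed

lemma eqv_fsum:
  assumes "eqv X X'" "eqv Y Y'" "hemb X" "hemb Y"
  shows "eqv (fsum X Y) (fsum X' Y')"
proof -
  obtain x1 y1 F1 x2 y2 F2 x1' y1' F1' x2' y2' F2' where
    e: "X = (x1, y1, F1)" "Y = (x2, y2, F2)" "X' = (x1', y1', F1')" "Y' = (x2', y2', F2')"
    by (metis prod.exhaust)
  obtain \<phi> \<psi> where 1: "tiso x1 x1' \<phi>" "tiso y1 y1' \<psi>" "\<forall>v\<in>VS x1. \<psi> (F1 v) = F1' (\<phi> v)"
    using assms(1) by (auto simp: e emb_iso_fun_def)
  obtain \<phi>' \<psi>' where 2: "tiso x2 x2' \<phi>'" "tiso y2 y2' \<psi>'" "\<forall>v\<in>VS x2. \<psi>' (F2 v) = F2' (\<phi>' v)"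
    using assms(2) by (auto simp: e emb_iso_fun_def)
  have m: "\<And>v. v \<in> VS x1 \<Longrightarrow> F1 v \<in> VS y1" "\<And>v. v \<in> VS x2 \<Longrightarrow> F2 v \<in> VS y2"
    "\<And>v. v \<in> VS x1 \<Longrightarrow> \<phi> v \<in> VS x1'" "\<And>v. v \<in> VS x2 \<Longrightarrow> \<phi>' v \<in> VS x2'"
    using assms(3,4) 1(1) 2(1) by (auto simp: e thom_def tiso_def)
  show ?thesis unfolding e fsum.simps eqv.simps emb_iso_fun_def
  proof (intro exI conjI ballI)
    show "tiso (x1 @ x2) (x1' @ x2') (\<lambda>v. join_blocks (length x1') (\<phi> (take_blocks (length x1) v)) (\<phi>' (drop_blocks (length x1) v)))"
      by (rule tiso_fsum) (use 1 2 in auto)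
    show "tiso (y1 @ y2) (y1' @ y2') (\<lambda>v. join_blocks (length y1') (\<psi> (take_blocks (length y1) v)) (\<psi>' (drop_blocks (length y1) v)))"
      by (rule tiso_fsum) (use 1 2 in auto)
    fix v :: "idx \<Rightarrow> 'a" assume v: "v \<in> VS (x1 @ x2)"
    note vv = take_blocks_VS[OF v] drop_blocks_VS[OF v]
    show "join_blocks (length y1') (\<psi> (take_blocks (length y1) (join_blocks (length y1) (F1 (take_blocks (length x1) v)) (F2 (drop_blocks (length x1) v)))))
          (\<psi>' (drop_blocks (length y1) (join_blocks (length y1) (F1 (take_blocks (length x1) v)) (F2 (drop_blocks (length x1) v))))) =
         join_blocks (length y1') (F1' (take_blocks (length x1') (join_blocks (length x1') (\<phi> (take_blocks (length x1) v)) (\<phi>' (drop_blocks (length x1) v)))))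
          (F2' (drop_blocks (length x1') (join_blocks (length x1') (\<phi> (take_blocks (length x1) v)) (\<phi>' (drop_blocks (length x1) v)))))"
      using vv m 1(3) 2(3) by (simp add: take_blocks_id)
  qed
qed

lemma tiso_swap: "tiso (xs @ ys) (ys @ xs) (\<lambda>v::idx \<Rightarrow> 'a::field. join_blocks (length ys) (drop_blocks (length xs) v) (take_blocks (length xs) v))"
proof -
  have s: "join_blocks (length ys) (drop_blocks (length xs) v) (take_blocks (length xs) v) \<in> VS (ys @ xs)" if "v \<in> VS (xs @ ys)"
    for xs ys :: "nat list" and v :: "idx \<Rightarrow> 'a"
    by (rule join_blocks_VS) (use that in \<open>auto intro: take_blocks_VS drop_blocks_VS\<close>)
  have i: "join_blocks (length xs) (drop_blocks (length ys) (join_blocks (length ys) (drop_blocks (length xs) v) (take_blocks (length xs) v)))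
      (take_blocks (length ys) (join_blocks (length ys) (drop_blocks (length xs) v) (take_blocks (length xs) v))) = v" if "v \<in> VS (xs @ ys)"
    for xs ys :: "nat list" and v :: "idx \<Rightarrow> 'a"
    using drop_blocks_VS[OF that] by (simp add: take_blocks_id)
  have "bij_betw (\<lambda>v::idx \<Rightarrow> 'a. join_blocks (length ys) (drop_blocks (length xs) v) (take_blocks (length xs) v)) (VS (xs @ ys)) (VS (ys @ xs))"
  proof (rule bij_betw_byWitness[where f' = "\<lambda>v. join_blocks (length xs) (drop_blocks (length ys) v) (take_blocks (length ys) v)"])
  qed (intro ballI i image_subsetI s; assumption)+
  then show ?thesis unfolding tiso_def thom_def
    by (intro conjI ballI s lin_join_blocks lin_take_blocks lin_drop_blocks) (simp_all add: take_blocks_tshift drop_blocks_tshift tshift_join_blocks)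
qed

lemma eqv_swap:
  assumes "hemb X" "hemb Y"
  shows "eqv (fsum X Y) (fsum Y X)"
proof -
  obtain x1 y1 F1 x2 y2 F2 where e: "X = (x1, y1, F1)" "Y = (x2, y2, F2)"
    by (metis prod.exhaust)
  have m: "\<And>v. v \<in> VS x1 \<Longrightarrow> F1 v \<in> VS y1" "\<And>v. v \<in> VS x2 \<Longrightarrow> F2 v \<in> VS y2"
    using assms by (auto simp: e thom_def)
  show ?thesis unfolding e fsum.simps eqv.simps emb_iso_fun_def
  proof (intro exI conjI ballI)
    show "tiso (x1 @ x2) (x2 @ x1) (\<lambda>v. join_blocks (length x2) (drop_blocks (length x1) v) (take_blocks (length x1) v))" by (rule tiso_swap)
    show "tiso (y1 @ y2) (y2 @ y1) (\<lambda>v. join_blocks (length y2) (drop_blocks (length y1) v) (take_blocks (length y1) v))" by (rule tiso_swap)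
    fix v :: "idx \<Rightarrow> 'a" assume v: "v \<in> VS (x1 @ x2)"
    note vv = take_blocks_VS[OF v] drop_blocks_VS[OF v]
    show "join_blocks (length y2) (drop_blocks (length y1) (join_blocks (length y1) (F1 (take_blocks (length x1) v)) (F2 (drop_blocks (length x1) v))))
          (take_blocks (length y1) (join_blocks (length y1) (F1 (take_blocks (length x1) v)) (F2 (drop_blocks (length x1) v)))) =
         join_blocks (length y2) (F2 (take_blocks (length x2) (join_blocks (length x2) (drop_blocks (length x1) v) (take_blocks (length x1) v))))
          (F1 (drop_blocks (length x2) (join_blocks (length x2) (drop_blocks (length x1) v) (take_blocks (length x1) v))))"
      using vv m by (simp add: take_blocks_id)
  qed
qed

text \<open>A true equality, because blocks are numbered by their position in the concatenated list.
  Only the order of summands has to be treated up to \<open>eqv\<close>.\<close>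

lemma fsum_assoc: "fsum (fsum X Y) Z = fsum X (fsum Y Z)"
proof -
  obtain x1 y1 F1 x2 y2 F2 x3 y3 F3 where e: "X = (x1, y1, F1)" "Y = (x2, y2, F2)" "Z = (x3, y3, F3)"
    by (metis prod.exhaust)
  have 1: "take_blocks m (take_blocks (m + n) v) = take_blocks m v" "drop_blocks m (take_blocks (m + n) v) = take_blocks n (drop_blocks m v)" "drop_blocks (m + n) v = drop_blocks n (drop_blocks m v)"
    for m n and v :: "idx \<Rightarrow> 'a"
    by (rule ext2; auto simp: ac_simps)+
  have 2: "join_blocks (m + n) (join_blocks m u v) w = join_blocks m u (join_blocks n v w)" for m n and u v w :: "idx \<Rightarrow> 'a"
    by (rule ext2) auto
  show ?thesis unfolding e by (simp add: 1 2)
qed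

definition fzero :: "'k::field femb" where "fzero = ([], [], \<lambda>v. 0)"

lemma fsum_fzero_left [simp]: "fsum fzero X = X"
proof -
  have "join_blocks 0 u w = w" "drop_blocks 0 w = w" for u w :: "idx \<Rightarrow> 'a" by (rule ext2; simp)+
  then show ?thesis by (cases X) (simp add: fzero_def)
qed

lemma hemb_fzero: "hemb fzero"
  by (auto simp: fzero_def thom_def linI coord_space_def tshift_def fun_eq_iff)

definition fsum_list :: "summand list \<Rightarrow> 'k::field femb" where
  "fsum_list ss = fun_emb (dsum_list ss)"

lemma fsum_list_Nil: "fsum_list [] = fzero"
  by (auto simp: fsum_list_def fzero_def mv_def fun_eq_iff)

lemma fsum_list_Cons: "fsum_list (s # ss) = fsum (fun_emb (summand_emb s)) (fsum_list ss)"
  by (simp add: fsum_list_def fun_emb_dsum)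

lemma fsum_list_append: "fsum_list (ss @ ts) = fsum (fsum_list ss) (fsum_list ts)"
  by (induction ss) (simp_all add: fsum_list_Nil fsum_list_Cons fsum_assoc)

subsection \<open>Dimension invariants of pickets and bipickets\<close>

definition pickF :: "nat \<Rightarrow> nat \<Rightarrow> (idx \<Rightarrow> 'k::field) \<Rightarrow> idx \<Rightarrow> 'k" where
  "pickF l m v = (\<lambda>(i, j). if i = 0 \<and> j < m \<and> m - l \<le> j then v (0, j - (m - l)) else 0)"

text \<open>The formula makes sense for every \<open>r < m\<close>, in particular for
  \<open>r = m - 1\<close>, which is not a bipicket; this lets all arcs be treated alike in the
  families below.\<close>

definition arcF :: "nat \<Rightarrow> nat \<Rightarrow> (idx \<Rightarrow> 'k::field) \<Rightarrow> idx \<Rightarrow> 'k" where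
  "arcF m r v = (\<lambda>(i, j). if i = 0 \<and> j + 2 = m then v (0, 0) else if i = 0 \<and> j + 1 = m then v (0, 1)
     else if i = 1 \<and> j + 1 = r then v (0, 0) else 0)"

lemma pickF_apply: "pickF l m v (i, j) = (if i = 0 \<and> j < m \<and> m - l \<le> j then v (0, j - (m - l)) else 0)"
  by (simp add: pickF_def)

lemma arcF_apply: "arcF m r v (i, j) = (if i = 0 \<and> j + 2 = m then v (0, 0) else if i = 0 \<and> j + 1 = m then v (0, 1)
     else if i = 1 \<and> j + 1 = r then v (0, 0) else 0)"
  by (simp add: arcF_def)

lemma Bas_single: "(i, j) \<in> Bas [x] \<longleftrightarrow> i = 0 \<and> j < x"
  by (auto simp: mem_Bas)

lemma Bas_pair: "(i, j) \<in> Bas [x, y] \<longleftrightarrow> i = 0 \<and> j < x \<or> i = 1 \<and> j < y"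
  by (auto simp: mem_Bas less_2_cases_iff nth_Cons')

lemma Bas_2: "Bas [2] = {(0, 0), (0, 1)}"
  by (auto simp: Bas_def)

lemma fun_emb_picket:
  assumes "l \<le> m"
  shows "fun_emb (summand_emb (Picket l m)) = ([l], [m], pickF l m)"
proof -
  have "mv (Bas [l]) (\<lambda>b a. if a \<in> Bas [l] \<and> b = (0, m - l + snd a) then 1 else 0) v = pickF l m v" for v :: "idx \<Rightarrow> 'a"
  proof (rule ext2)
    fix i j :: nat
    have "(\<Sum>a\<in>Bas [l]. (if a \<in> Bas [l] \<and> (i, j) = (0, m - l + snd a) then 1 else 0) * v a) =
      (\<Sum>a\<in>Bas [l]. if a = (0, j - (m - l)) then (if i = 0 \<and> m - l \<le> j then v a else 0) else 0)"
      by (rule sum.cong) (auto simp: Bas_single)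
    also have "\<dots> = pickF l m v (i, j)"
      using assms by (auto simp: sum.delta' pickF_apply Bas_single)
    finally show "mv (Bas [l]) (\<lambda>b a. if a \<in> Bas [l] \<and> b = (0, m - l + snd a) then 1 else 0) v (i, j) = pickF l m v (i, j)"
      by (simp add: mv_def)
  qed
  then show ?thesis by auto
qed

lemma fun_emb_bipicket:
  assumes "1 \<le> r" "2 \<le> m"
  shows "fun_emb (summand_emb (Bipicket m r)) = ([2], [m, r], arcF m r)"
proof -
  have "mv (Bas [2]) (snd (snd (summand_emb (Bipicket m r)))) v = arcF m r v" for v :: "idx \<Rightarrow> 'a"
    by (rule ext2) (use assms in \<open>auto simp: mv_def Bas_2 arcF_apply\<close>)
  then show ?thesis by auto
qed

lemma VS_single_D: "v \<in> VS [x] \<Longrightarrow> \<not> (i = 0 \<and> j < x) \<Longrightarrow> v (i, j) = 0"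
  by (rule VS_D) (auto simp: Bas_single)

lemma thom_pickF: "l \<le> m \<Longrightarrow> thom [l] [m] (pickF l m)"
  unfolding thom_def
proof (intro conjI ballI)
  show "lin (pickF l m)" by (rule linI; rule ext2) (auto simp: pickF_apply)
  fix v :: "idx \<Rightarrow> 'a" assume v: "v \<in> VS [l]" and lm: "l \<le> m"
  show "pickF l m v \<in> VS [m]" by (rule VS_I2) (auto simp: pickF_apply Bas_single)
  show "pickF l m (tshift [l] v) = tshift [m] (pickF l m v)"
    using lm by (intro ext2) (auto simp: pickF_apply tshift_apply Bas_single intro!: arg_cong[of _ _ v])
qed

lemma thom_arcF: "1 \<le> r \<Longrightarrow> 2 \<le> m \<Longrightarrow> thom [2] [m, r] (arcF m r)"
  unfolding thom_def
proof (intro conjI ballI)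
  show "lin (arcF m r)" by (rule linI; rule ext2) (auto simp: arcF_apply)
  fix v :: "idx \<Rightarrow> 'a" assume v: "v \<in> VS [2]" and mr: "1 \<le> r" "2 \<le> m"
  show "arcF m r v \<in> VS [m, r]" by (rule VS_I2) (auto simp: arcF_apply Bas_pair)
  show "arcF m r (tshift [2] v) = tshift [m, r] (arcF m r v)"
    using mr VS_single_D[OF v, of 0] by (intro ext2) (auto simp: arcF_apply tshift_apply Bas_pair Bas_single)
qed

lemma hemb_summand: "valid_summand s \<Longrightarrow> hemb (fun_emb (summand_emb s))"
proof (cases s)
  case (Picket l m)
  assume "valid_summand s"
  then show ?thesis unfolding Picket using thom_pickF fun_emb_picket
    by (metis hemb.simps valid_summand.simps(1))
next
  case (Bipicket m r)
  assume "valid_summand s"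
  then have "1 \<le> r" "2 \<le> m" by (auto simp: Bipicket)
  then show ?thesis unfolding Bipicket using thom_arcF fun_emb_bipicket by (metis hemb.simps)
qed

lemma hemb_fsum_list: "list_all valid_summand ss \<Longrightarrow> hemb (fsum_list ss)"
  by (induction ss) (auto simp: fsum_list_Nil fsum_list_Cons hemb_fzero intro!: thom_fsum hemb_summand simp del: summand_emb.simps)

text \<open>\<open>Wsub p q ys\<close> is the submodule \<open>T^p N + (T^q N \<inter> soc N)\<close> of \<open>N = N_ys\<close>.\<close>

definition Wsub :: "nat \<Rightarrow> nat \<Rightarrow> nat list \<Rightarrow> (idx \<Rightarrow> 'k::field) set" where
  "Wsub p q ys = {w \<in> VS ys. \<forall>i j. w (i, j) \<noteq> 0 \<longrightarrow> p \<le> j \<or> q \<le> j \<and> Suc j = ys ! i}"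

lemma tshift_pow: "u \<in> VS ys \<Longrightarrow> (tshift ys ^^ p) u (i, j) = (if (i, j) \<in> Bas ys \<and> p \<le> j then u (i, j - p) else 0)"
proof (induction p arbitrary: i j)
  case 0
  then show ?case by (auto simp: VS_D)
next
  case (Suc p)
  then show ?case by (cases j) (auto simp: tshift_apply mem_Bas)
qed

lemma tshift_pow_VS: "u \<in> VS ys \<Longrightarrow> (tshift ys ^^ p) u \<in> VS ys"
  by (cases p) auto

text \<open>The coordinate-free form of \<open>Wsub\<close>; it is what shows that homomorphisms
  respect these submodules and hence that the dimensions are isomorphism invariants.\<close>

lemma Wsub_iff:
  "w \<in> Wsub p q ys \<longleftrightarrow> (\<exists>u z. u \<in> VS ys \<and> z \<in> VS ys \<and> w = (tshift ys ^^ p) u + (tshift ys ^^ q) z \<and> (tshift ys ^^ Suc q) z = 0)"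
proof
  assume w: "w \<in> Wsub p q ys"
  then have wV: "w \<in> VS ys" and wc: "\<And>i j. w (i, j) \<noteq> 0 \<Longrightarrow> p \<le> j \<or> q \<le> j \<and> Suc j = ys ! i"
    by (auto simp: Wsub_def)
  define u where "u = (\<lambda>(i, j). w (i, j + p))"
  \<comment> \<open>\<open>u\<close> already produces all coordinates from level \<open>p\<close>
    on, so \<open>z\<close> carries only the levels below \<open>p\<close>; by assumption those are
    top levels of their blocks.\<close>
  define z where "z = (\<lambda>(i, j). if j + q < p then w (i, j + q) else 0)"
  have out: "(i, j) \<notin> Bas ys \<Longrightarrow> (i, j + k) \<notin> Bas ys" for i j k by (auto simp: mem_Bas)
  have w0: "w (i, j + k) = 0" if "(i, j) \<notin> Bas ys" for i j k by (rule VS_D[OF wV out[OF that]])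
  have uV: "u \<in> VS ys" by (rule VS_I2) (simp add: u_def w0)
  have zV: "z \<in> VS ys" by (rule VS_I2) (simp add: z_def w0)
  have "w = (tshift ys ^^ p) u + (tshift ys ^^ q) z"
  proof (rule ext2)
    fix i j
    show "w (i, j) = ((tshift ys ^^ p) u + (tshift ys ^^ q) z) (i, j)"
      using wc[of i j] VS_D[OF wV, of "(i, j)"] unfolding plus_fun_apply tshift_pow[OF uV] tshift_pow[OF zV]
      by (cases "w (i, j) = 0") (auto simp: u_def z_def)
  qed
  moreover have "(tshift ys ^^ Suc q) z = 0"
  proof (rule ext2)
    fix i j
    show "(tshift ys ^^ Suc q) z (i, j) = 0 (i, j)"
    proof (cases "(i, j) \<in> Bas ys \<and> Suc q \<le> j")
      case True
      then obtain k where k: "j = Suc (k + q)" by (metis add.commute add_Suc le_Suc_ex)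
      have "Suc (k + q) < ys ! i" using True k by (simp add: mem_Bas)
      then have "z (i, k) = 0" using wc[of i "k + q"] by (cases "w (i, k + q) = 0") (auto simp: z_def)
      then show ?thesis unfolding tshift_pow[OF zV] by (simp add: k)
    next
      case False
      then show ?thesis unfolding tshift_pow[OF zV] by auto
    qed
  qed
  ultimately show "\<exists>u z. u \<in> VS ys \<and> z \<in> VS ys \<and> w = (tshift ys ^^ p) u + (tshift ys ^^ q) z \<and> (tshift ys ^^ Suc q) z = 0"
    using uV zV by blast
next
  assume "\<exists>u z. u \<in> VS ys \<and> z \<in> VS ys \<and> w = (tshift ys ^^ p) u + (tshift ys ^^ q) z \<and> (tshift ys ^^ Suc q) z = 0"
  then obtain u z where uz: "u \<in> VS ys" "z \<in> VS ys" "w = (tshift ys ^^ p) u + (tshift ys ^^ q) z" "(tshift ys ^^ Suc q) z = 0"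
    by blast
  have "w \<in> VS ys" unfolding uz(3) by (rule fv.subspace_add[OF subspace_coord_space]) (use uz tshift_pow_VS in auto)
  moreover have "p \<le> j \<or> q \<le> j \<and> Suc j = ys ! i" if "w (i, j) \<noteq> 0" for i j
  proof (cases "p \<le> j")
    case False
    then have nz: "(i, j) \<in> Bas ys" "q \<le> j" "z (i, j - q) \<noteq> 0"
      using that by (auto simp: uz(3) tshift_pow uz(1,2) split: if_splits)
    have "(tshift ys ^^ Suc q) z (i, Suc j) = 0" using uz(4) by simp
    then have "(i, Suc j) \<notin> Bas ys" using nz unfolding tshift_pow[OF uz(2)] by auto
    then show ?thesis using nz by (auto simp: mem_Bas)
  qed simp
  ultimately show "w \<in> Wsub p q ys" by (simp add: Wsub_def)
qed

lemma thom_pow: "thom xs ys F \<Longrightarrow> v \<in> VS xs \<Longrightarrow> F ((tshift xs ^^ n) v) = (tshift ys ^^ n) (F v)"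
  by (induction n) (auto simp: thom_def tshift_pow_VS)

lemma thom_Wsub:
  assumes "thom xs ys F" "w \<in> Wsub p q xs" shows "F w \<in> Wsub p q ys"
proof -
  obtain u z where uz: "u \<in> VS xs" "z \<in> VS xs" "w = (tshift xs ^^ p) u + (tshift xs ^^ q) z" "(tshift xs ^^ Suc q) z = 0"
    using assms(2) unfolding Wsub_iff by blast
  have F: "lin F" "F u \<in> VS ys" "F z \<in> VS ys" using assms(1) uz by (auto simp: thom_def)
  have "F w = (tshift ys ^^ p) (F u) + (tshift ys ^^ q) (F z)"
    using thom_pow[OF assms(1)] uz by (simp add: lin_add[OF F(1)])
  moreover have "(tshift ys ^^ Suc q) (F z) = 0"
    using thom_pow[OF assms(1) uz(2), of "Suc q"] lin_0[OF F(1)] uz(4) by metis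
  ultimately show ?thesis unfolding Wsub_iff using F by blast
qed

lemma subspace_Wsub: "fv.subspace (Wsub p q ys)"
  unfolding fv.subspace_def
proof (intro conjI ballI allI)
  have z: "(0 :: idx \<Rightarrow> 'a) \<in> VS ys" by (rule VS_I2) simp
  then show "(0 :: idx \<Rightarrow> 'a) \<in> Wsub p q ys" by (simp add: Wsub_def)
  fix x y :: "idx \<Rightarrow> 'a" assume "x \<in> Wsub p q ys" "y \<in> Wsub p q ys"
  then show "x + y \<in> Wsub p q ys" unfolding Wsub_def
    by (auto intro: fv.subspace_add[OF subspace_coord_space]) (metis add.right_neutral)+
next
  fix c and x :: "idx \<Rightarrow> 'a" assume "x \<in> Wsub p q ys"
  then show "vscale c x \<in> Wsub p q ys" unfolding Wsub_def
    by (auto intro: fv.subspace_scale[OF subspace_coord_space])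
qed

fun Ksub :: "nat \<Rightarrow> nat \<Rightarrow> 'k::field femb \<Rightarrow> (idx \<Rightarrow> 'k) set" where
  "Ksub p q (xs, ys, F) = {v \<in> VS xs. F v \<in> Wsub p q ys}"

definition kdim :: "nat \<Rightarrow> nat \<Rightarrow> 'k::field femb \<Rightarrow> nat" where
  "kdim p q X = fv.dim (Ksub p q X)"

lemma subspace_Ksub:
  assumes "lin F"
  shows "fv.subspace (Ksub p q (xs, ys, F))"
proof -
  have "fv.subspace (VS xs \<inter> F -` Wsub p q ys)"
    by (intro fv.subspace_inter subspace_coord_space fvv.linear_subspace_vimage assms subspace_Wsub)
  moreover have "Ksub p q (xs, ys, F) = VS xs \<inter> F -` Wsub p q ys" by auto
  ultimately show ?thesis by metis
qed

text \<open>The isomorphism of ambient modules and its inverse both preserve \<open>Wsub\<close>, so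
  \<open>\<phi>\<close> restricts to a bijection of the two subspaces.\<close>

lemma kdim_eqv:
  assumes "eqv X Y" "hemb X"
  shows "kdim p q X = kdim p q Y"
proof -
  obtain x1 y1 F1 x2 y2 F2 where e: "X = (x1, y1, F1)" "Y = (x2, y2, F2)"
    by (metis prod.exhaust)
  obtain \<phi> \<psi> where 1: "tiso x1 x2 \<phi>" "tiso y1 y2 \<psi>" "\<forall>v\<in>VS x1. \<psi> (F1 v) = F2 (\<phi> v)"
    using assms(1) by (auto simp: e emb_iso_fun_def)
  obtain \<psi>' where p: "tiso y2 y1 \<psi>'" "\<And>v. v \<in> VS y1 \<Longrightarrow> \<psi>' (\<psi> v) = v"
    "\<And>v. v \<in> VS y2 \<Longrightarrow> \<psi> (\<psi>' v) = v" using tiso_inverse[OF 1(2)] by blast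
  have F1: "lin F1" "\<And>v. v \<in> VS x1 \<Longrightarrow> F1 v \<in> VS y1" using assms(2) by (auto simp: e thom_def)
  have iff: "\<phi> v \<in> Ksub p q Y \<longleftrightarrow> v \<in> Ksub p q X" if v: "v \<in> VS x1" for v
  proof -
    have "\<phi> v \<in> VS x2" using 1(1) v by (auto simp: tiso_def thom_def)
    moreover have "\<psi> (F1 v) \<in> Wsub p q y2 \<longleftrightarrow> F1 v \<in> Wsub p q y1"
      using thom_Wsub[of y1 y2 \<psi> "F1 v" p q] thom_Wsub[of y2 y1 \<psi>' "\<psi> (F1 v)" p q] 1(2) p(1) p(2)[OF F1(2)[OF v]]
      by (auto simp: tiso_def)
    ultimately show ?thesis using v 1(3) by (simp add: e)
  qed
  have "\<phi> ` Ksub p q X = Ksub p q Y"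
  proof
    show "\<phi> ` Ksub p q X \<subseteq> Ksub p q Y" using iff by (auto simp: e)
    show "Ksub p q Y \<subseteq> \<phi> ` Ksub p q X"
    proof
      fix w assume w: "w \<in> Ksub p q Y"
      then have "w \<in> \<phi> ` VS x1" using 1(1) by (simp add: tiso_def bij_betw_def e)
      then obtain v where "v \<in> VS x1" "w = \<phi> v" by blast
      then show "w \<in> \<phi> ` Ksub p q X" using iff w by blast
    qed
  qed
  moreover have "lin \<phi>" "inj_on \<phi> (Ksub p q X)"
    using 1(1) by (auto simp: tiso_def thom_def bij_betw_def e intro: inj_on_subset)
  moreover have "fv.subspace (Ksub p q X)" unfolding e by (rule subspace_Ksub) (rule F1)
  ultimately show ?thesis unfolding kdim_def using dim_inj_image by metis
qed

lemma Wsub_append: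
  "w \<in> Wsub p q (xs @ ys) \<longleftrightarrow> take_blocks (length xs) w \<in> Wsub p q xs \<and> drop_blocks (length xs) w \<in> Wsub p q ys"
proof
  assume w: "w \<in> Wsub p q (xs @ ys)"
  then have wV: "w \<in> VS (xs @ ys)" and c: "\<And>i j. w (i, j) \<noteq> 0 \<Longrightarrow> p \<le> j \<or> q \<le> j \<and> Suc j = (xs @ ys) ! i"
    by (auto simp: Wsub_def)
  have "p \<le> j \<or> q \<le> j \<and> Suc j = xs ! i" if "take_blocks (length xs) w (i, j) \<noteq> 0" for i j
    using c[of i j] that by (auto simp: nth_append split: if_splits)
  moreover have "p \<le> j \<or> q \<le> j \<and> Suc j = ys ! i" if "drop_blocks (length xs) w (i, j) \<noteq> 0" for i j
    using c[of "i + length xs" j] that by (auto simp: nth_append split: if_splits)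
  ultimately show "take_blocks (length xs) w \<in> Wsub p q xs \<and> drop_blocks (length xs) w \<in> Wsub p q ys"
    unfolding Wsub_def using take_blocks_VS[OF wV] drop_blocks_VS[OF wV] by blast
next
  assume a: "take_blocks (length xs) w \<in> Wsub p q xs \<and> drop_blocks (length xs) w \<in> Wsub p q ys"
  have "w = join_blocks (length xs) (take_blocks (length xs) w) (drop_blocks (length xs) w)" by simp
  then have "w \<in> VS (xs @ ys)" using a join_blocks_VS[of "take_blocks (length xs) w" xs "drop_blocks (length xs) w" ys]
    by (simp add: Wsub_def)
  moreover have "p \<le> j \<or> q \<le> j \<and> Suc j = (xs @ ys) ! i" if "w (i, j) \<noteq> 0" for i j
  proof (cases "i < length xs")
    case True
    then have "take_blocks (length xs) w (i, j) \<noteq> 0" using that by simp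
    then show ?thesis using a True unfolding Wsub_def by (auto simp: nth_append simp del: take_blocks_apply)
  next
    case False
    then have "drop_blocks (length xs) w (i - length xs, j) \<noteq> 0" using that by simp
    then show ?thesis using a False unfolding Wsub_def by (auto simp: nth_append simp del: drop_blocks_apply)
  qed
  ultimately show "w \<in> Wsub p q (xs @ ys)" by (simp add: Wsub_def)
qed

lemma kdim_fsum:
  assumes "hemb X" "hemb Y"
  shows "kdim p q (fsum X Y) = kdim p q X + kdim p q Y"
proof -
  obtain x1 y1 F1 x2 y2 F2 where e: "X = (x1, y1, F1)" "Y = (x2, y2, F2)"
    by (metis prod.exhaust)
  have F: "lin F1" "lin F2" "\<And>v. v \<in> VS x1 \<Longrightarrow> F1 v \<in> VS y1"
    using assms by (auto simp: e thom_def)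
  let ?n = "length x1"
  let ?i = "\<lambda>u :: idx \<Rightarrow> 'a. join_blocks ?n u 0" and ?j = "\<lambda>w :: idx \<Rightarrow> 'a. join_blocks ?n 0 w"
  have lid: "lin (\<lambda>v :: idx \<Rightarrow> 'a. v)" "lin (\<lambda>v :: idx \<Rightarrow> 'a. 0 :: idx \<Rightarrow> 'a)" by (rule linI; simp)+
  have li: "lin ?i" "lin ?j" using lin_join_blocks[OF lid] lin_join_blocks[OF lid(2,1)] by auto
  have sK: "fv.subspace (Ksub p q X)" "fv.subspace (Ksub p q Y)" unfolding e by (rule subspace_Ksub; rule F)+
  have z: "(0 :: idx \<Rightarrow> 'a) \<in> VS xs" for xs by (rule VS_I2) simp
  have iK: "?i ` Ksub p q X \<subseteq> VS (x1 @ x2)" using join_blocks_VS[OF _ z] by (auto simp: e)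
  have jK: "?j ` Ksub p q Y \<subseteq> VS (x1 @ x2)" using join_blocks_VS[OF z] by (auto simp: e)
  have inji: "inj_on ?i (Ksub p q X)"
  proof (rule inj_onI)
    fix u v assume uv: "u \<in> Ksub p q X" "v \<in> Ksub p q X" "?i u = ?i v"
    have "take_blocks ?n u = take_blocks ?n v" using arg_cong[OF uv(3), of "take_blocks ?n"] unfolding take_blocks_join_blocks .
    moreover have "u \<in> VS x1" "v \<in> VS x1" using uv(1,2) by (auto simp: e)
    ultimately show "u = v" by (metis take_blocks_id)
  qed
  have injj: "inj_on ?j (Ksub p q Y)" by (rule inj_onI) (metis drop_blocks_join_blocks)
  have "Ksub p q (fsum X Y) = {x + y |x y. x \<in> ?i ` Ksub p q X \<and> y \<in> ?j ` Ksub p q Y}"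
  proof (intro set_eqI iffI)
    fix v assume v: "v \<in> Ksub p q (fsum X Y)"
    then have vV: "v \<in> VS (x1 @ x2)" by (simp add: e)
    have "take_blocks ?n v \<in> Ksub p q X" "drop_blocks ?n v \<in> Ksub p q Y"
      using v take_blocks_VS[OF vV] drop_blocks_VS[OF vV] by (simp_all add: e Wsub_append take_blocks_id F)
    moreover have "v = ?i (take_blocks ?n v) + ?j (drop_blocks ?n v)" by (rule ext2) simp
    ultimately show "v \<in> {x + y |x y. x \<in> ?i ` Ksub p q X \<and> y \<in> ?j ` Ksub p q Y}" by blast
  next
    fix v assume "v \<in> {x + y |x y. x \<in> ?i ` Ksub p q X \<and> y \<in> ?j ` Ksub p q Y}"
    then obtain u w where uw: "u \<in> Ksub p q X" "w \<in> Ksub p q Y" "v = ?i u + ?j w" by blast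
    have "v = join_blocks ?n u w" unfolding uw(3) by (rule ext2) simp
    then show "v \<in> Ksub p q (fsum X Y)"
      using uw(1,2) join_blocks_VS[of u x1 w x2] by (simp add: e Wsub_append take_blocks_id F)
  qed
  moreover have "?i ` Ksub p q X \<inter> ?j ` Ksub p q Y \<subseteq> {0}"
  proof
    fix x assume "x \<in> ?i ` Ksub p q X \<inter> ?j ` Ksub p q Y"
    then obtain u w where "x = ?i u" "x = ?j w" by blast
    then have "x (i, j) = 0" for i j by (metis join_blocks_apply zero_fun_apply)
    then show "x \<in> {0}" by (auto intro: ext2)
  qed
  ultimately show ?thesis unfolding kdim_def
    using dim_direct_sum[OF fvv.linear_subspace_image[OF li(1) sK(1)] fvv.linear_subspace_image[OF li(2) sK(2)] iK jK finite_Bas]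
      dim_inj_image[OF li(1) sK(1) inji] dim_inj_image[OF li(2) sK(2) injj] by simp
qed

lemma kdim_fzero: "kdim p q fzero = 0"
proof -
  have "Ksub p q fzero = (coord_space {} :: (idx \<Rightarrow> 'a) set)"
  proof (intro set_eqI)
    have b: "Bas [] = {}" by (simp add: Bas_def)
    show "v \<in> Ksub p q fzero \<longleftrightarrow> v \<in> coord_space {}" for v :: "idx \<Rightarrow> 'a"
      unfolding fzero_def Ksub.simps mem_Collect_eq b using fv.subspace_0[OF subspace_Wsub[of p q "[]"]] by blast
  qed
  then show ?thesis unfolding kdim_def using dim_coord_space[of "{}"] by (metis card.empty finite.emptyI)
qed

lemma kdim_coord_space: "Ksub p q X = coord_space A \<Longrightarrow> finite A \<Longrightarrow> kdim p q X = card A"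
  by (simp add: kdim_def dim_coord_space)

lemma coord_space_subset_iff: "A \<subseteq> B \<Longrightarrow> v \<in> coord_space A \<longleftrightarrow> v \<in> coord_space B \<and> (\<forall>a\<in>B - A. v a = 0)"
  unfolding coord_space_def by blast

lemma coord_space_A2:
  "v \<in> coord_space ((if P then {(0, 0)} else {}) \<union> (if Q then {(0, 1)} else {})) \<longleftrightarrow>
   v \<in> VS [2] \<and> (v (0, 0) \<noteq> 0 \<longrightarrow> P) \<and> (v (0, 1) \<noteq> 0 \<longrightarrow> Q)"
  by (subst coord_space_subset_iff[of _ "Bas [2]"]) (auto simp: Bas_2)

text \<open>The three nonzero coordinates of the image are tested separately: level
  \<open>m - 2\<close> is not in the socle and needs \<open>p + 2 \<le> m\<close>, whereas levels
  \<open>r - 1\<close> and \<open>m - 1\<close> are tops of their blocks, so that only the weaker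
  bound by \<open>q\<close> matters there.\<close>

lemma kdim_arcF:
  assumes "q \<le> p" "1 \<le> r" "r < m"
  shows "kdim p q ([2], [m, r], arcF m r) = item_hom_count p q (Arc m r)"
proof -
  have "(\<forall>i j. arcF m r v (i, j) \<noteq> 0 \<longrightarrow> p \<le> j \<or> q \<le> j \<and> Suc j = [m, r] ! i) \<longleftrightarrow>
     (v (0, 0) \<noteq> 0 \<longrightarrow> p + 2 \<le> m \<and> q + 1 \<le> r) \<and> (v (0, 1) \<noteq> 0 \<longrightarrow> q + 1 \<le> m)" (is "?l \<longleftrightarrow> ?r") for v :: "idx \<Rightarrow> 'a"
  proof
    assume l: ?l
    have "2 \<le> m" using assms by simp
    then obtain m' where m': "m = m' + 2" by (metis add.commute le_Suc_ex)
    obtain r' where r': "r = r' + 1" using assms(2) by (metis add.commute le_Suc_ex)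
    show ?r using l[rule_format, of 0 m'] l[rule_format, of 0 "m' + 1"] l[rule_format, of 1 r'] assms
      by (auto simp: arcF_apply m' r')
  qed (use assms in \<open>auto simp: arcF_apply split: if_splits\<close>)
  then have "Ksub p q ([2], [m, r], arcF m r) =
     (coord_space ((if p + 2 \<le> m \<and> q + 1 \<le> r then {(0, 0)} else {}) \<union> (if q + 1 \<le> m then {(0, 1)} else {})) :: (idx \<Rightarrow> 'a) set)"
    unfolding set_eq_iff coord_space_A2 using thom_arcF[of r m, where 'a = 'a] assms by (auto simp: Wsub_def thom_def)
  then show ?thesis by (subst kdim_coord_space) auto
qed

text \<open>For \<open>r = m - 1\<close> the condition \<open>q + 1 \<le> r\<close> follows from
  \<open>p + 2 \<le> m\<close> and \<open>q \<le> p\<close>. This is why \<open>P_2^m\<close>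
  behaves like an arc \<open>(m, m - 1)\<close>.\<close>

lemma kdim_pickF2:
  assumes "q \<le> p" "2 \<le> m"
  shows "kdim p q ([2], [m], pickF 2 m) = item_hom_count p q (Arc m (m - 1))"
proof -
  have "(\<forall>i j. pickF 2 m v (i, j) \<noteq> 0 \<longrightarrow> p \<le> j \<or> q \<le> j \<and> Suc j = [m] ! i) \<longleftrightarrow>
     (v (0, 0) \<noteq> 0 \<longrightarrow> p + 2 \<le> m) \<and> (v (0, 1) \<noteq> 0 \<longrightarrow> q + 1 \<le> m)" (is "?l \<longleftrightarrow> ?r") for v :: "idx \<Rightarrow> 'a"
  proof
    assume l: ?l
    obtain m' where m': "m = m' + 2" using assms(2) by (metis add.commute le_Suc_ex)
    show ?r using l[rule_format, of 0 m'] l[rule_format, of 0 "m' + 1"] assms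
      by (auto simp: pickF_apply m')
  next
    assume r: ?r
    show ?l
    proof (intro allI impI)
      fix i j assume nz: "pickF 2 m v (i, j) \<noteq> 0"
      then have "i = 0" "j + 2 = m \<or> j + 1 = m" by (auto simp: pickF_apply split: if_splits)
      moreover have "j + 2 = m \<Longrightarrow> v (0, 0) \<noteq> 0" "j + 1 = m \<Longrightarrow> v (0, 1) \<noteq> 0"
        using nz assms by (auto simp: pickF_apply split: if_splits)
      ultimately show "p \<le> j \<or> q \<le> j \<and> Suc j = [m] ! i" using r by auto
    qed
  qed
  then have "Ksub p q ([2], [m], pickF 2 m) =
     (coord_space ((if p + 2 \<le> m then {(0, 0)} else {}) \<union> (if q + 1 \<le> m then {(0, 1)} else {})) :: (idx \<Rightarrow> 'a) set)"
    unfolding set_eq_iff coord_space_A2 using thom_pickF[of 2 m, where 'a = 'a] assms by (auto simp: Wsub_def thom_def)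
  then show ?thesis using assms by (subst kdim_coord_space) auto
qed

lemma kdim_pickF1:
  assumes "q \<le> p" "1 \<le> m"
  shows "kdim p q ([1], [m], pickF 1 m) = item_hom_count p q (Pole m)"
proof -
  have "(\<forall>i j. pickF 1 m v (i, j) \<noteq> 0 \<longrightarrow> p \<le> j \<or> q \<le> j \<and> Suc j = [m] ! i) \<longleftrightarrow>
     (v (0, 0) \<noteq> 0 \<longrightarrow> q + 1 \<le> m)" (is "?l \<longleftrightarrow> ?r") for v :: "idx \<Rightarrow> 'a"
  proof
    assume l: ?l
    show ?r using l[rule_format, of 0 "m - 1"] assms
      by (auto simp: pickF_apply)
  next
    assume r: ?r
    show ?l
    proof (intro allI impI)
      fix i j assume nz: "pickF 1 m v (i, j) \<noteq> 0"
      then have "i = 0" "j + 1 = m" by (auto simp: pickF_apply split: if_splits)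
      moreover have "v (0, 0) \<noteq> 0"
        using nz assms calculation by (auto simp: pickF_apply split: if_splits)
      ultimately show "p \<le> j \<or> q \<le> j \<and> Suc j = [m] ! i" using r by auto
    qed
  qed
  moreover have "v \<in> coord_space (if P then {(0, 0)} else {}) \<longleftrightarrow> v \<in> VS [1] \<and> (v (0, 0) \<noteq> 0 \<longrightarrow> P)" for P and v :: "idx \<Rightarrow> 'a"
  proof -
    have "Bas [1] = {(0, 0)}" by (auto simp: Bas_def)
    then show ?thesis by (subst coord_space_subset_iff[of _ "Bas [1]"]) auto
  qed
  ultimately have "Ksub p q ([1], [m], pickF 1 m) =
     (coord_space (if q + 1 \<le> m then {(0, 0)} else {}) :: (idx \<Rightarrow> 'a) set)"
    unfolding set_eq_iff using thom_pickF[of 1 m, where 'a = 'a] assms by (auto simp: Wsub_def thom_def)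
  then show ?thesis by (subst kdim_coord_space) auto
qed

lemma kdim_pickF0: "kdim p q ([0], [m], pickF 0 m) = 0"
proof -
  have "Bas [0] = {}" by (auto simp: Bas_def)
  then have "v \<in> coord_space {} \<longleftrightarrow> v \<in> VS [0]" for v :: "idx \<Rightarrow> 'a" by simp
  moreover have "pickF 0 m v \<in> Wsub p q [m]" if "v \<in> VS [0]" for v :: "idx \<Rightarrow> 'a"
  proof -
    have "pickF 0 m v = 0" by (rule ext2) (auto simp: pickF_apply)
    then show ?thesis using fv.subspace_0[OF subspace_Wsub[of p q "[m]"]] by metis
  qed
  ultimately have "Ksub p q ([0], [m], pickF 0 m) = (coord_space {} :: (idx \<Rightarrow> 'a) set)" by auto
  then show ?thesis by (simp add: kdim_coord_space)
qed

definition diag :: "summand list \<Rightarrow> arcitem multiset" where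
  "diag ss = sum_list (map summand_diag ss)"

lemma kdim_summand:
  assumes "valid_summand s" "q \<le> p"
  shows "kdim p q (fun_emb (summand_emb s) :: 'k::field femb) = hom_count p q (summand_diag s)"
proof (cases s)
  case (Bipicket m r)
  then show ?thesis using assms fun_emb_bipicket[of r m, where 'a = 'k] kdim_arcF[of q p r m, where 'a = 'k] by simp
next
  case (Picket l m)
  have "l = 0 \<or> l = 1 \<or> l = 2" using assms by (auto simp: Picket)
  then show ?thesis using assms fun_emb_picket[of l m, where 'a = 'k] kdim_pickF0[of p q m, where 'a = 'k]
      kdim_pickF1[of q p m, where 'a = 'k] kdim_pickF2[of q p m, where 'a = 'k]
    by (auto simp: Picket simp del: summand_emb.simps)
qed

lemma kdim_fsum_list: "list_all valid_summand ss \<Longrightarrow> q \<le> p \<Longrightarrow> kdim p q (fsum_list ss :: 'k::field femb) = hom_count p q (diag ss)"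
proof (induction ss)
  case Nil
  then show ?case by (simp add: fsum_list_Nil kdim_fzero diag_def)
next
  case (Cons s ss)
  then have "kdim p q (fsum_list (s # ss) :: 'k femb) = kdim p q (fun_emb (summand_emb s) :: 'k femb) + kdim p q (fsum_list ss :: 'k femb)"
    unfolding fsum_list_Cons by (intro kdim_fsum hemb_summand hemb_fsum_list) auto
  then show ?case using Cons kdim_summand[of s q p, where 'k = 'k] by (simp add: diag_def)
qed

subsection \<open>Uniqueness of the diagram\<close>

text \<open>A module seen as an embedding into itself. Its invariant at \<open>(q, q)\<close> is
  \<open>dim T^q N\<close>, so the machinery for embeddings also yields invariants of
  modules.\<close>

definition id_emb :: "nat list \<Rightarrow> 'k::field femb" where
  "id_emb xs = (xs, xs, \<lambda>v. v)"

lemma hemb_id_emb: "hemb (id_emb xs)"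
  unfolding id_emb_def hemb.simps using tiso_id unfolding tiso_def by blast

lemma id_emb_append: "id_emb (xs @ ys) = fsum (id_emb xs) (id_emb ys)"
  by (simp add: id_emb_def)

lemma kdim_id_emb_single: "kdim q q (id_emb [x] :: 'k::field femb) = x - q"
proof -
  have "Ksub q q (id_emb [x]) = (coord_space ((\<lambda>j. (0, j)) ` {q..<x}) :: (idx \<Rightarrow> 'k) set)"
  proof (intro set_eqI)
    fix v :: "idx \<Rightarrow> 'k"
    have "v \<in> coord_space ((\<lambda>j. (0, j)) ` {q..<x}) \<longleftrightarrow> v \<in> VS [x] \<and> (\<forall>a\<in>Bas [x] - (\<lambda>j. (0, j)) ` {q..<x}. v a = 0)"
      by (rule coord_space_subset_iff) (auto simp: Bas_single)
    also have "\<dots> \<longleftrightarrow> v \<in> VS [x] \<and> (\<forall>i j. v (i, j) \<noteq> 0 \<longrightarrow> q \<le> j)"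
    proof (intro conj_cong refl iffI allI impI ballI)
      fix i j assume v: "v \<in> VS [x]" and h: "\<forall>a\<in>Bas [x] - (\<lambda>j. (0, j)) ` {q..<x}. v a = 0" "v (i, j) \<noteq> 0"
      have "(i, j) \<in> Bas [x]" using VS_D[OF v] h(2) by blast
      then show "q \<le> j" using h by (cases "q \<le> j") (auto simp: Bas_single)
    next
      fix a assume h: "\<forall>i j. v (i, j) \<noteq> 0 \<longrightarrow> q \<le> j" "a \<in> Bas [x] - (\<lambda>j. (0, j)) ` {q..<x}"
      obtain i j where a: "a = (i, j)" by (cases a)
      have "\<not> q \<le> j" using h(2) by (auto simp: a Bas_single)
      then show "v a = 0" using h(1) a by blast
    qed
    also have "\<dots> \<longleftrightarrow> v \<in> Ksub q q (id_emb [x])"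
      by (auto simp: id_emb_def Wsub_def)
    finally show "v \<in> Ksub q q (id_emb [x]) \<longleftrightarrow> v \<in> coord_space ((\<lambda>j. (0, j)) ` {q..<x})" by blast
  qed
  then have "kdim q q (id_emb [x] :: 'k femb) = card ((\<lambda>j. (0::nat, j)) ` {q..<x})"
    by (rule kdim_coord_space) simp
  also have "\<dots> = x - q" by (subst card_image) (auto simp: inj_on_def)
  finally show ?thesis .
qed

lemma kdim_id_emb: "kdim q q (id_emb xs :: 'k::field femb) = (\<Sum>x\<leftarrow>xs. x - q)"
proof (induction xs)
  case Nil
  have "Ksub q q (id_emb []) = (coord_space {} :: (idx \<Rightarrow> 'k) set)"
    by (auto simp: id_emb_def Wsub_def coord_space_def Bas_def)
  then show ?case by (simp add: kdim_coord_space)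
next
  case (Cons x xs)
  have "id_emb (x # xs) = (fsum (id_emb [x]) (id_emb xs) :: 'k femb)" using id_emb_append[of "[x]" xs] by simp
  then show ?case
    using kdim_fsum[OF hemb_id_emb[of "[x]"] hemb_id_emb[of xs], of q q, where 'a = 'k] Cons
      kdim_id_emb_single[of q x, where 'k = 'k] by simp
qed

lemma tiso_sizes:
  assumes "tiso xs ys (F :: (idx \<Rightarrow> 'k::field) \<Rightarrow> idx \<Rightarrow> 'k)"
  shows "(\<Sum>x\<leftarrow>xs. x - q) = (\<Sum>x\<leftarrow>ys. x - q)"
proof -
  have "eqv (id_emb xs) (id_emb ys :: 'k femb)" unfolding id_emb_def eqv.simps emb_iso_fun_def using assms by blast
  then show ?thesis using kdim_eqv[OF _ hemb_id_emb, of xs "id_emb ys" q q] kdim_id_emb by metis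
qed

fun sub_shape :: "summand \<Rightarrow> nat list" where
  "sub_shape (Picket l m) = [l]" | "sub_shape (Bipicket m r) = [2]"

fun amb_shape :: "summand \<Rightarrow> nat list" where
  "amb_shape (Picket l m) = [m]" | "amb_shape (Bipicket m r) = [m, r]"

lemma dsum_list_shape: "fst (dsum_list ss :: 'k::comm_semiring_1 emb) = concat (map sub_shape ss)"
  "fst (snd (dsum_list ss :: 'k emb)) = concat (map amb_shape ss)"
proof (induction ss)
  case (Cons s ss)
  obtain a b c where d: "dsum_list ss = (a, b, c :: 'k mat)" by (metis prod.exhaust)
  { case 1 then show ?case using Cons d by (cases s) auto }
  { case 2 then show ?case using Cons d by (cases s) auto }
qed auto

lemma fsum_list_shape: "\<exists>F. fsum_list ss = (concat (map sub_shape ss), concat (map amb_shape ss), F)"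
proof -
  obtain a b c where d: "dsum_list ss = (a, b, c :: 'a mat)" by (metis prod.exhaust)
  then show ?thesis using dsum_list_shape[of ss, where 'k = 'a] by (simp add: fsum_list_def)
qed

lemma diag_Cons [simp]: "diag (s # ss) = summand_diag s + diag ss" by (simp add: diag_def)
lemma diag_Nil [simp]: "diag [] = {#}" by (simp add: diag_def)

text \<open>The parts of the source are at most \<open>2\<close>, and \<open>x - 1\<close> with
  truncation picks out the parts equal to \<open>2\<close>, one for each arc.\<close>

lemma num_arcs_diag:
  "list_all valid_summand ss \<Longrightarrow> num_arcs (diag ss) = (\<Sum>x\<leftarrow>concat (map sub_shape ss). x - 1)"
proof (induction ss)
  case (Cons s ss)
  then show ?case by (cases s) auto
qed simp

lemma valid_diag: "list_all valid_summand ss \<Longrightarrow> x \<in># diag ss \<Longrightarrow> valid_item x"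
proof (induction ss)
  case (Cons s ss)
  then show ?case by (cases s) (auto split: if_splits)
qed simp

lemma diag_unique:
  assumes "hemb X" "eqv X (fsum_list ss)" "eqv X (fsum_list ss')" "list_all valid_summand ss" "list_all valid_summand ss'"
  shows "diag ss = diag ss'"
proof (rule arc_moves_reachable(2))
  have k: "hom_count p q (diag ss) = hom_count p q (diag ss')" if "q \<le> p" for p q
    using kdim_eqv[OF assms(2,1)] kdim_eqv[OF assms(3,1)] kdim_fsum_list[OF assms(4) that] kdim_fsum_list[OF assms(5) that] by metis
  show "hom_count p q (diag ss) \<le> hom_count p q (diag ss')" if "q \<le> p" for p q using k[OF that] by simp
  show "hom_count q q (diag ss) = hom_count q q (diag ss')" for q using k by simp
  show "hom_count p q (diag ss) = hom_count p q (diag ss')" if "q \<le> p" for p q using k[OF that] by simp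
  show "\<forall>x\<in>#diag ss. valid_item x" "\<forall>x\<in>#diag ss'. valid_item x" using valid_diag assms(4,5) by blast+
  obtain xs ys F where X: "X = (xs, ys, F)" by (metis prod.exhaust)
  obtain F1 where F1: "fsum_list ss = (concat (map sub_shape ss), concat (map amb_shape ss), F1 :: (idx \<Rightarrow> 'a) \<Rightarrow> _)" using fsum_list_shape by blast
  obtain F2 where F2: "fsum_list ss' = (concat (map sub_shape ss'), concat (map amb_shape ss'), F2 :: (idx \<Rightarrow> 'a) \<Rightarrow> _)" using fsum_list_shape by blast
  obtain \<phi> where 1: "tiso xs (concat (map sub_shape ss)) (\<phi> :: (idx \<Rightarrow> 'a) \<Rightarrow> _)"
    using assms(2) unfolding X F1 eqv.simps emb_iso_fun_def by blast
  obtain \<phi>' where 2: "tiso xs (concat (map sub_shape ss')) (\<phi>' :: (idx \<Rightarrow> 'a) \<Rightarrow> _)"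
    using assms(3) unfolding X F2 eqv.simps emb_iso_fun_def by blast
  show "num_arcs (diag ss) = num_arcs (diag ss')"
    using tiso_sizes[OF 1, of 1] tiso_sizes[OF 2, of 1] num_arcs_diag assms(4,5) by metis
qed

section \<open>Recovering the summands from the diagram and the ambient module\<close>

fun is_p0 :: "summand \<Rightarrow> bool" where
  "is_p0 (Picket l m) = (l = 0)" | "is_p0 (Bipicket m r) = False"

fun item_summand :: "arcitem \<Rightarrow> summand" where
  "item_summand (Arc m r) = (if r + 2 \<le> m then Bipicket m r else Picket 2 m)"
| "item_summand (Pole m) = Picket 1 m"

lemma nonp0_diag: "list_all valid_summand ss \<Longrightarrow>
  filter_mset (\<lambda>s. \<not> is_p0 s) (mset ss) = image_mset item_summand (diag ss)"
proof (induction ss)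
  case (Cons s ss)
  then show ?case by (cases s) (auto simp: le_Suc_eq numeral_2_eq_2)
qed simp

lemma mset_concat_amb_shape: "mset (concat (map amb_shape ss)) = (\<Sum>s\<in>#mset ss. mset (amb_shape s))"
  by (induction ss) auto

lemma p0_sizes: "(\<And>s. s \<in># S \<Longrightarrow> is_p0 s) \<Longrightarrow> image_mset (Picket 0) (\<Sum>s\<in>#S. mset (amb_shape s)) = S"
proof (induction S)
  case (add s S)
  have "is_p0 s" by (rule add.prems) simp
  moreover have "image_mset (Picket 0) (\<Sum>s\<in>#S. mset (amb_shape s)) = S" by (rule add.IH, rule add.prems) simp
  ultimately show ?case by (cases s) auto
qed simp

text \<open>The multiplicity of a part \<open>m \<ge> 1\<close> is the second difference at
  \<open>m\<close> of the function sending \<open>q\<close> to the sum of the truncated differences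
  \<open>x - q\<close>.\<close>

lemma mset_parts_eq:
  fixes xs ys :: "nat list"
  assumes "\<And>q. (\<Sum>x\<leftarrow>xs. x - q) = (\<Sum>x\<leftarrow>ys. x - q)" "0 \<notin> set xs" "0 \<notin> set ys"
  shows "mset xs = mset ys"
proof (rule multiset_eqI)
  fix m
  have c: "(\<Sum>x\<leftarrow>zs. x - (m - 1)) + (\<Sum>x\<leftarrow>zs. x - (m + 1)) = 2 * (\<Sum>x\<leftarrow>zs. x - m) + count (mset zs) m"
    if "1 \<le> m" for zs using that by (induction zs) auto
  show "count (mset xs) m = count (mset ys) m"
  proof (cases "1 \<le> m")
    case True
    then show ?thesis using c[OF True, of xs, unfolded assms(1)] c[OF True, of ys] by simp
  next
    case False
    then have "m = 0" by simp
    then show ?thesis using assms(2,3) by (simp add: count_eq_zero_iff[THEN iffD2])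
  qed
qed

lemma amb_shape_pos: "list_all valid_summand ss \<Longrightarrow> 0 \<notin> set (concat (map amb_shape ss))"
proof (induction ss)
  case (Cons s ss)
  then show ?case by (cases s) auto
qed simp

text \<open>The diagram determines every summand except the pickets \<open>P_0^m\<close>. Their
  lengths are the parts of the ambient module that remain after removing those used by the other
  summands.\<close>

lemma mset_summands_eq:
  assumes "list_all valid_summand ss" "list_all valid_summand ss'" "diag ss = diag ss'"
    and q: "\<And>q. (\<Sum>x\<leftarrow>concat (map amb_shape ss). x - q) = (\<Sum>x\<leftarrow>concat (map amb_shape ss'). x - q)"
  shows "mset ss = mset ss'"
proof -
  let ?N = "\<lambda>ss. filter_mset (\<lambda>s. \<not> is_p0 s) (mset ss)" and ?P = "\<lambda>ss. filter_mset is_p0 (mset ss)"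
  have N: "?N ss = ?N ss'" using nonp0_diag[OF assms(1)] nonp0_diag[OF assms(2)] assms(3) by simp
  have split: "mset ss = ?P ss + ?N ss" for ss by (rule multiset_partition)
  have "mset (concat (map amb_shape ss)) = mset (concat (map amb_shape ss'))"
    by (rule mset_parts_eq[OF q amb_shape_pos[OF assms(1)] amb_shape_pos[OF assms(2)]])
  then have e: "(\<Sum>s\<in>#mset ss. mset (amb_shape s)) = (\<Sum>s\<in>#mset ss'. mset (amb_shape s))" unfolding mset_concat_amb_shape .
  have "(\<Sum>s\<in>#mset ss. mset (amb_shape s)) = (\<Sum>s\<in>#?P ss. mset (amb_shape s)) + (\<Sum>s\<in>#?N ss. mset (amb_shape s))" for ss
    using arg_cong[OF split[of ss], of "\<lambda>M. \<Sum>s\<in>#M. mset (amb_shape s)"]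
    by (simp only: image_mset_union sum_mset.union)
  then have "(\<Sum>s\<in>#?P ss. mset (amb_shape s)) = (\<Sum>s\<in>#?P ss'. mset (amb_shape s))" using e N by simp
  then have "?P ss = ?P ss'"
    using p0_sizes[of "?P ss"] p0_sizes[of "?P ss'"] by auto
  then show ?thesis using N split by metis
qed

lemma eqv_perm: "mset ss = mset ss' \<Longrightarrow> list_all valid_summand ss \<Longrightarrow> eqv (fsum_list ss :: 'k::field femb) (fsum_list ss')"
proof (induction ss arbitrary: ss')
  case Nil
  then show ?case by (simp add: eqv_refl)
next
  case (Cons s ss)
  then have "s \<in> set ss'" by (metis list.set_intros(1) mset_eq_setD)
  then obtain a b where ab: "ss' = a @ s # b" by (meson split_list)
  have m: "mset ss = mset (a @ b)" using Cons.prems ab by simp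
  have v': "list_all valid_summand ss'" using Cons.prems by (metis list_all_iff mset_eq_setD)
  have v: "valid_summand s" "list_all valid_summand ss" "list_all valid_summand a" "list_all valid_summand b"
    using Cons.prems(2) v' ab by auto
  have hs: "hemb (fun_emb (summand_emb s) :: 'k femb)" by (rule hemb_summand[OF v(1)])
  have h: "hemb (fsum_list a :: 'k femb)" "hemb (fsum_list b :: 'k femb)" "hemb (fsum_list ss :: 'k femb)"
    using v by (auto intro: hemb_fsum_list)
  have "eqv (fsum_list (s # ss) :: 'k femb) (fsum_list (s # a @ b))"
    unfolding fsum_list_Cons by (rule eqv_fsum[OF eqv_refl Cons.IH[OF m v(2)] hs h(3)])
  moreover have "eqv (fsum_list (s # a @ b) :: 'k femb) (fsum_list (a @ s # b))"
  proof -
    have "eqv (fsum (fsum (fun_emb (summand_emb s)) (fsum_list a)) (fsum_list b) :: 'k femb) (fsum (fsum (fsum_list a) (fun_emb (summand_emb s))) (fsum_list b))"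
      by (rule eqv_fsum[OF eqv_swap eqv_refl thom_fsum]) (use hs h in auto)
    then show ?thesis by (simp add: fsum_list_Cons fsum_list_append fsum_assoc)
  qed
  ultimately show ?case using ab eqv_trans by blast
qed

text \<open>The common ambient list \<open>fst (snd X)\<close> is what makes the diagram a complete
  invariant: it fixes the summands that leave no trace in the diagram.\<close>

lemma eqv_of_diag_eq:
  assumes "list_all valid_summand ss" "list_all valid_summand ss'" "diag ss = diag ss'"
    and "hemb X" "hemb X'" "eqv X (fsum_list ss)" "eqv X' (fsum_list ss')" "fst (snd X) = fst (snd X')"
  shows "eqv X (X' :: 'k::field femb)"
proof -
  obtain xs ys F xs' F' where X: "X = (xs, ys, F)" "X' = (xs', ys, F')"
    using assms(8) by (metis fst_conv snd_conv prod.exhaust)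
  obtain F1 where F1: "fsum_list ss = (concat (map sub_shape ss), concat (map amb_shape ss), F1 :: (idx \<Rightarrow> 'k) \<Rightarrow> _)" using fsum_list_shape by blast
  obtain F2 where F2: "fsum_list ss' = (concat (map sub_shape ss'), concat (map amb_shape ss'), F2 :: (idx \<Rightarrow> 'k) \<Rightarrow> _)" using fsum_list_shape by blast
  obtain \<phi> where 1: "tiso ys (concat (map amb_shape ss)) (\<phi> :: (idx \<Rightarrow> 'k) \<Rightarrow> _)"
    using assms(6) unfolding X F1 eqv.simps emb_iso_fun_def by blast
  obtain \<phi>' where 2: "tiso ys (concat (map amb_shape ss')) (\<phi>' :: (idx \<Rightarrow> 'k) \<Rightarrow> _)"
    using assms(7) unfolding X F2 eqv.simps emb_iso_fun_def by blast
  have "mset ss = mset ss'"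
    by (rule mset_summands_eq[OF assms(1-3)]) (use tiso_sizes[OF 1] tiso_sizes[OF 2] in simp)
  then have "eqv (fsum_list ss :: 'k femb) (fsum_list ss')" using eqv_perm assms(1) by blast
  then show ?thesis using assms eqv_trans eqv_sym by metis
qed

subsection \<open>Semicontinuity\<close>

lemma polyfun_diff: "p \<in> polyfun \<Longrightarrow> q \<in> polyfun \<Longrightarrow> (\<lambda>M. p M - q M) \<in> polyfun"
  using pf_add[OF _ pf_mult[OF pf_const[of "-1"]], of p q] by simp

lemma polyfun_sum: "(\<And>i. i \<in> I \<Longrightarrow> f i \<in> polyfun) \<Longrightarrow> (\<lambda>M. \<Sum>i\<in>I. f i M) \<in> polyfun"
  by (induction I rule: infinite_finite_induct) (auto intro: pf_const pf_add)

text \<open>Schur complements produce the polynomial that detects invertibility, so no determinants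
  are needed.\<close>

lemma schur_polynomial:
  fixes e :: "nat \<Rightarrow> nat \<Rightarrow> 'k::field mat \<Rightarrow> 'k"
  assumes "\<And>i j. i < n \<Longrightarrow> j < n \<Longrightarrow> e i j \<in> polyfun"
    and "\<And>i j. i < n \<Longrightarrow> j < n \<Longrightarrow> e i j g = (if i = j then 1 else 0)"
  shows "\<exists>p\<in>polyfun. p g \<noteq> 0 \<and>
    (\<forall>M c. p M \<noteq> 0 \<longrightarrow> (\<forall>i<n. (\<Sum>j<n. e i j M * c j) = 0) \<longrightarrow> (\<forall>j<n. c j = 0))"
  using assms
proof (induction n arbitrary: e)
  case 0
  then show ?case by (intro bexI[of _ "\<lambda>M. 1"]) (auto intro: pf_const)
next
  case (Suc n)
  \<comment> \<open>Elimination of the first unknown, multiplied out to avoid a division. At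
    \<open>g\<close> this is again the identity matrix, so the induction hypothesis applies.\<close>
  define e' where "e' = (\<lambda>i j M. e 0 0 M * e (Suc i) (Suc j) M - e (Suc i) 0 M * e 0 (Suc j) M)"
  have "\<exists>p\<in>polyfun. p g \<noteq> 0 \<and>
    (\<forall>M c. p M \<noteq> 0 \<longrightarrow> (\<forall>i<n. (\<Sum>j<n. e' i j M * c j) = 0) \<longrightarrow> (\<forall>j<n. c j = 0))"
    by (rule Suc.IH) (auto simp: e'_def Suc.prems intro!: polyfun_diff pf_mult)
  then obtain p where p: "p \<in> polyfun" "p g \<noteq> 0"
    "\<And>M c j. p M \<noteq> 0 \<Longrightarrow> (\<forall>i<n. (\<Sum>j<n. e' i j M * c j) = 0) \<Longrightarrow> j < n \<Longrightarrow> c j = 0"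
    by blast
  show ?case
  proof (intro bexI conjI allI impI)
    show "(\<lambda>M. e 0 0 M * p M) \<in> polyfun" using p Suc.prems by (auto intro: pf_mult)
    show "e 0 0 g * p g \<noteq> 0" using p Suc.prems by simp
    fix M c j assume nz: "e 0 0 M * p M \<noteq> 0" and z: "\<forall>i<Suc n. (\<Sum>j<Suc n. e i j M * c j) = 0" and j: "j < Suc n"
    have row: "e i 0 M * c 0 + (\<Sum>j<n. e i (Suc j) M * c (Suc j)) = 0" if "i < Suc n" for i
      using z that by (simp add: sum.lessThan_Suc_shift del: sum.lessThan_Suc)
    have "(\<Sum>j<n. e' i j M * c (Suc j)) = 0" if "i < n" for i
    proof -
      have "(\<Sum>j<n. e' i j M * c (Suc j)) =
          e 0 0 M * (\<Sum>j<n. e (Suc i) (Suc j) M * c (Suc j)) - e (Suc i) 0 M * (\<Sum>j<n. e 0 (Suc j) M * c (Suc j))"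
        by (simp add: e'_def sum_distrib_left sum_subtractf algebra_simps)
      also have "(\<Sum>j<n. e (Suc i) (Suc j) M * c (Suc j)) = - (e (Suc i) 0 M * c 0)"
        using row[of "Suc i"] that by (simp add: eq_neg_iff_add_eq_0 add.commute)
      also have "(\<Sum>j<n. e 0 (Suc j) M * c (Suc j)) = - (e 0 0 M * c 0)"
        using row[of 0] by (simp add: eq_neg_iff_add_eq_0 add.commute)
      finally show ?thesis by (simp add: algebra_simps)
    qed
    then have s: "c (Suc j) = 0" if "j < n" for j using p(3)[of M "\<lambda>j. c (Suc j)" j] nz that by simp
    then have "e 0 0 M * c 0 = 0" using row[of 0] by simp
    then show "c j = 0" using s nz j by (cases j) auto
  qed
qed

lemma lfun_sum: "lfun f \<Longrightarrow> f (\<Sum>i\<in>I. vscale (c i) (g i)) = (\<Sum>i\<in>I. c i * f (g i))"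
  by (simp add: fvk.linear_sum fvk.linear_scale)

lemma polyfun_functional:
  assumes "lfun f"
  shows "\<exists>p\<in>polyfun. \<forall>M\<in>Hom xs ys. p M = f (mv (Bas xs) M u)"
proof (intro bexI ballI)
  fix M :: "'a mat" assume M: "M \<in> Hom xs ys"
  have "f (mv (Bas xs) M u) = f (\<Sum>b\<in>Bas ys. vscale (mv (Bas xs) M u b) (unit_vec b))"
    using coord_space_expand[OF finite_Bas mv_VS[OF M, of u]] by simp
  also have "\<dots> = (\<Sum>b\<in>Bas ys. (\<Sum>a\<in>Bas xs. M b a * u a) * f (unit_vec b))"
    unfolding lfun_sum[OF assms] by (simp add: mv_def)
  finally show "(\<Sum>b\<in>Bas ys. (\<Sum>a\<in>Bas xs. M b a * u a) * f (unit_vec b)) = f (mv (Bas xs) M u)" ..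
qed (intro polyfun_sum pf_mult pf_coord pf_const)

lemma dim_intersection:
  assumes "fv.subspace S" "fv.subspace T" "S \<subseteq> coord_space A" "T \<subseteq> coord_space A" "finite A"
    "card A < fv.dim S + fv.dim T"
  shows "\<exists>x. x \<in> S \<and> x \<in> T \<and> x \<noteq> 0"
proof (rule ccontr)
  assume "\<not> ?thesis"
  then have "S \<inter> T \<subseteq> {0}" by blast
  then have "fv.dim {x + y |x y. x \<in> S \<and> y \<in> T} = fv.dim S + fv.dim T"
    using dim_direct_sum assms by blast
  moreover have sub: "{x + y |x y. x \<in> S \<and> y \<in> T} \<subseteq> coord_space A"
  proof
    fix z assume "z \<in> {x + y |x y. x \<in> S \<and> y \<in> T}"
    then obtain x y where "z = x + y" "x \<in> S" "y \<in> T" by blast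
    then show "z \<in> coord_space A" using assms(3,4) fv.subspace_add[OF subspace_coord_space] by blast
  qed
  have "fv.dim {x + y |x y. x \<in> S \<and> y \<in> T} \<le> fv.dim (coord_space A :: (idx \<Rightarrow> 'a) set)"
    by (rule dim_subset_le[OF sub order_refl assms(5)])
  ultimately show False using assms(6) dim_coord_space[OF assms(5), where 'k = 'a] by simp
qed

text \<open>On a complement of \<open>K g\<close> the map \<open>g\<close> is injective modulo
  \<open>W\<close>, witnessed by functionals that vanish on \<open>W\<close> and are dual to the
  images of a basis. Replacing \<open>g\<close> by \<open>M\<close> gives a matrix of polynomials
  that is the identity at \<open>g\<close>. Where the detecting polynomial is nonzero,
  \<open>M\<close> is injective modulo \<open>W\<close> on the same complement, so
  \<open>K M\<close> cannot be larger than \<open>K g\<close>.\<close>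

lemma semicontinuity:
  fixes g :: "'k::field mat"
  assumes g: "g \<in> Hom xs ys" and W: "fv.subspace W"
    and less: "fv.dim {v \<in> VS xs. mv (Bas xs) g v \<in> W} < d"
  shows "\<exists>p\<in>polyfun. p g \<noteq> 0 \<and>
    (\<forall>M\<in>Hom xs ys. d \<le> fv.dim {v \<in> VS xs. mv (Bas xs) M v \<in> W} \<longrightarrow> p M = 0)"
proof -
  define K where "K = (\<lambda>M :: 'k mat. {v \<in> VS xs. mv (Bas xs) M v \<in> W})"
  have sK: "fv.subspace (K M)" for M
  proof -
    have "K M = VS xs \<inter> mv (Bas xs) M -` W" by (auto simp: K_def)
    then show ?thesis
      by (metis fv.subspace_inter subspace_coord_space fvv.linear_subspace_vimage lin_mv W)
  qed
  have KV: "K M \<subseteq> VS xs" for M by (auto simp: K_def)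
  obtain B0 where B0: "B0 \<subseteq> K g" "fv.independent B0" "K g \<subseteq> fv.span B0" "card B0 = fv.dim (K g)"
    using fv.basis_exists[of "K g"] by blast
  have sB0: "fv.span B0 = K g" using fv.span_minimal[OF B0(1) sK] B0(3) by blast
  have B0V: "B0 \<subseteq> VS xs" using B0(1) KV by blast
  obtain B where B: "B0 \<subseteq> B" "B \<subseteq> VS xs" "fv.independent B" "VS xs \<subseteq> fv.span B"
    using fv.maximal_independent_subset_extend[OF B0V B0(2)] by blast
  have finB: "finite B" using independent_finite[OF B(3,2)] by simp
  have cB: "card B = card (Bas xs)"
    using fv.basis_card_eq_dim[OF B(2,4,3)] dim_coord_space[of "Bas xs"] by (metis finite_Bas)
  \<comment> \<open>A basis of a complement of \<open>K g\<close> in \<open>VS xs\<close>.\<close>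
  define C where "C = B - B0"
  define n where "n = card C"
  have finC: "finite C" using finB by (simp add: C_def)
  have nC: "n = card (Bas xs) - fv.dim (K g)" "fv.dim (K g) \<le> card (Bas xs)"
    using card_Diff_subset[of B0 B] card_mono[OF finB B(1)] B(1) finB cB B0(4)
    by (auto simp: n_def C_def intro: finite_subset)
  obtain u where u: "bij_betw u {..<n} C" using ex_bij_betw_nat_finite[OF finC] unfolding n_def lessThan_atLeast0 by blast
  have iC: "fv.independent C" using fv.independent_mono[OF B(3)] by (auto simp: C_def)
  have indep: "mv (Bas xs) g x \<notin> W" if x: "x \<in> fv.span C" "x \<noteq> 0" for x
  proof
    assume "mv (Bas xs) g x \<in> W"
    moreover have "x \<in> VS xs" using x(1) fv.span_minimal[OF _ subspace_coord_space, of C "Bas xs"] B(2) by (auto simp: C_def)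
    ultimately have xB0: "x \<in> fv.span B0" by (simp add: sB0 K_def)
    \<comment> \<open>The projection onto \<open>span C\<close> along \<open>span B0\<close> shows
      that the two spans meet only in \<open>0\<close>.\<close>
    obtain P where P: "lin P" "\<forall>b\<in>B. P b = (if b \<in> C then b else 0)"
      using fvv.linear_independent_extend[OF B(3), of "\<lambda>b. if b \<in> C then b else 0"] by blast
    have "P x = 0"
      by (rule fvv.linear_eq_0_on_span[OF P(1) _ xB0]) (use P(2) B(1) in \<open>auto simp: C_def\<close>)
    moreover have "P x = (\<lambda>v. v) x"
      by (rule fvv.linear_eq_on[OF P(1) _ x(1)]) (use P(2) in \<open>auto simp: C_def intro: linI\<close>)
    ultimately show False using x(2) by metis
  qed
  have ex: "\<exists>f. lfun f \<and> (\<forall>w\<in>W. f w = 0) \<and> (\<forall>c'\<in>C. f (mv (Bas xs) g c') = (if c = c' then 1 else 0))"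
    if c: "c \<in> C" for c
  proof -
    \<comment> \<open>Functional for \<open>c\<close>: it has to vanish on \<open>W\<close> and on
      the images of the other members of \<open>C\<close>, and independence modulo \<open>W\<close>
      keeps the image of \<open>c\<close> outside.\<close>
    define S where "S = {w + y |w y. w \<in> W \<and> y \<in> mv (Bas xs) g ` fv.span (C - {c})}"
    have sS: "fv.subspace S" unfolding S_def
      by (intro fv.subspace_sums W fvv.linear_subspace_image lin_mv fv.subspace_span)
    have "mv (Bas xs) g c \<notin> S"
    proof
      assume "mv (Bas xs) g c \<in> S"
      then obtain w y where wy: "mv (Bas xs) g c = w + mv (Bas xs) g y" "w \<in> W" "y \<in> fv.span (C - {c})"
        by (auto simp: S_def)
      have "mv (Bas xs) g (c - y) = w" unfolding lin_diff[OF lin_mv] wy(1) by simp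
      moreover have "c - y \<in> fv.span C"
      proof (rule fv.span_diff)
        show "c \<in> fv.span C" using c by (rule fv.span_base)
        show "y \<in> fv.span C" using wy(3) fv.span_mono[of "C - {c}" C] by blast
      qed
      ultimately have "c - y = 0" using indep wy(2) by metis
      then have "c \<in> fv.span (C - {c})" using wy(3) by simp
      then show False using iC c unfolding fv.dependent_def by blast
    qed
    then obtain f where f: "lfun f" "\<And>x. x \<in> S \<Longrightarrow> f x = 0" "f (mv (Bas xs) g c) = 1"
      using functional_exists[OF sS] by blast
    have "w \<in> S" if "w \<in> W" for w
    proof -
      have "mv (Bas xs) g 0 \<in> mv (Bas xs) g ` fv.span (C - {c})" using fv.span_zero by blast
      then have "w + mv (Bas xs) g 0 \<in> S" unfolding S_def using that by blast
      then show ?thesis by (simp add: lin_0[OF lin_mv])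
    qed
    moreover have "mv (Bas xs) g c' \<in> S" if "c' \<in> C" "c \<noteq> c'" for c'
    proof -
      have "mv (Bas xs) g c' \<in> mv (Bas xs) g ` fv.span (C - {c})"
        using fv.span_base[of c' "C - {c}"] that by blast
      then have "0 + mv (Bas xs) g c' \<in> S" unfolding S_def using fv.subspace_0[OF W] by blast
      then show ?thesis by (metis add_0)
    qed
    ultimately show ?thesis using f by (intro exI[of _ f]) auto
  qed
  then obtain l where l: "\<And>c. c \<in> C \<Longrightarrow> lfun (l c)" "\<And>c w. c \<in> C \<Longrightarrow> w \<in> W \<Longrightarrow> l c w = 0"
    "\<And>c c'. c \<in> C \<Longrightarrow> c' \<in> C \<Longrightarrow> l c (mv (Bas xs) g c') = (if c = c' then 1 else 0)"
    by metis
  have "\<exists>p. p \<in> polyfun \<and> (\<forall>M\<in>Hom xs ys. p M = l (u i) (mv (Bas xs) M (u j)))" if "i < n" for i j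
  proof -
    have "u i \<in> C" using u that by (auto simp: bij_betw_def)
    then show ?thesis using polyfun_functional[OF l(1), of "u i" xs ys "u j"] by blast
  qed
  then obtain e where e: "\<And>i j. i < n \<Longrightarrow> e i j \<in> polyfun"
    "\<And>i j M. i < n \<Longrightarrow> M \<in> Hom xs ys \<Longrightarrow> e i j M = l (u i) (mv (Bas xs) M (u j))"
    by metis
  have uC: "u i \<in> C" if "i < n" for i using u that by (auto simp: bij_betw_def)
  have uinj: "u i = u j \<longleftrightarrow> i = j" if "i < n" "j < n" for i j
    using u that by (auto simp: bij_betw_def inj_on_def)
  have "\<exists>p\<in>polyfun. p g \<noteq> 0 \<and>
    (\<forall>M c. p M \<noteq> 0 \<longrightarrow> (\<forall>i<n. (\<Sum>j<n. e i j M * c j) = 0) \<longrightarrow> (\<forall>j<n. c j = 0))"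
    by (rule schur_polynomial) (use e g l(3) uC uinj in auto)
  then obtain p where p: "p \<in> polyfun" "p g \<noteq> 0"
    "\<And>M c j. p M \<noteq> 0 \<Longrightarrow> (\<forall>i<n. (\<Sum>j<n. e i j M * c j) = 0) \<Longrightarrow> j < n \<Longrightarrow> c j = 0"
    by blast
  have "p M = 0" if M: "M \<in> Hom xs ys" and dM: "d \<le> fv.dim (K M)" for M
  proof (rule ccontr)
    assume pM: "p M \<noteq> 0"
    have CV: "fv.span C \<subseteq> VS xs" by (rule fv.span_minimal[OF _ subspace_coord_space]) (use B(2) in \<open>auto simp: C_def\<close>)
    \<comment> \<open>If \<open>K M\<close> were too large, the dimension formula would give it a
      nonzero vector in \<open>span C\<close>; its coordinates solve the homogeneous system, hence
      vanish.\<close>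
    have "card (Bas xs) < fv.dim (fv.span C) + fv.dim (K M)"
      using nC dM less fv.dim_span_eq_card_independent[OF iC] by (simp add: n_def K_def)
    then obtain x where x: "x \<in> fv.span C" "x \<in> K M" "x \<noteq> 0"
      using dim_intersection[OF fv.subspace_span sK CV KV finite_Bas] by blast
    obtain a where a: "x = (\<Sum>v\<in>C. vscale (a v) v)" using x(1) unfolding fv.span_finite[OF finC] by blast
    have xs: "x = (\<Sum>j<n. vscale (a (u j)) (u j))" unfolding a
      using sum.reindex_bij_betw[OF u, of "\<lambda>v. vscale (a v) v"] by simp
    have "(\<Sum>j<n. e i j M * a (u j)) = 0" if i: "i < n" for i
    proof -
      have "(\<Sum>j<n. e i j M * a (u j)) = (\<Sum>j<n. a (u j) * l (u i) (mv (Bas xs) M (u j)))"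
        using e(2)[OF i M] by (simp add: mult.commute)
      also have "\<dots> = l (u i) (\<Sum>j<n. vscale (a (u j)) (mv (Bas xs) M (u j)))"
        by (rule lfun_sum[OF l(1)[OF uC[OF i]], symmetric])
      also have "(\<Sum>j<n. vscale (a (u j)) (mv (Bas xs) M (u j))) = mv (Bas xs) M x"
        unfolding xs by (simp only: lin_sum[OF lin_mv] lin_vscale[OF lin_mv])
      also have "l (u i) (mv (Bas xs) M x) = 0" using l(2)[OF uC[OF i]] x(2) by (simp add: K_def)
      finally show ?thesis .
    qed
    then have "a (u j) = 0" if "j < n" for j using p(3)[OF pM, of "\<lambda>j. a (u j)"] that by blast
    then have "x = 0" unfolding xs by (intro sum.neutral) (simp add: fv.scale_zero_left)
    then show False using x(3) by blast
  qed
  then show ?thesis using p(1,2) unfolding K_def by blast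
qed

subsection \<open>Existence of the decomposition\<close>

text \<open>A coordinate-free \<open>eqv\<close>: \<open>\<psi>\<close> identifies
  \<open>N_ys\<close> with \<open>B\<close> under \<open>T\<close> and carries the image of
  \<open>F\<close> onto \<open>A\<close>. Only images are compared; the map between the sources is
  recovered in \<open>decomposition_exists\<close> from injectivity.\<close>

fun decomposes :: "((idx \<Rightarrow> 'k::field) \<Rightarrow> idx \<Rightarrow> 'k) \<Rightarrow> (idx \<Rightarrow> 'k) set \<Rightarrow> (idx \<Rightarrow> 'k) set \<Rightarrow> 'k femb \<Rightarrow> bool" where
  "decomposes T A B (xs, ys, F) \<longleftrightarrow>
     (\<exists>\<psi>. lin \<psi> \<and> bij_betw \<psi> (VS ys) B \<and> (\<forall>v\<in>VS ys. \<psi> (tshift ys v) = T (\<psi> v)) \<and> \<psi> ` F ` VS xs = A)"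

lemma lin_pow: "lin T \<Longrightarrow> lin (T ^^ n)"
proof (induction n)
  case 0
  have "T ^^ 0 = (\<lambda>v. v)" by auto
  moreover have "lin (\<lambda>v. v)" by (rule linI) simp_all
  ultimately show ?case by metis
next
  case (Suc n)
  have "T ^^ Suc n = (\<lambda>v. T ((T ^^ n) v))" by auto
  then show ?case using lin_comp[OF Suc.IH[OF Suc.prems] Suc.prems] by metis
qed

lemma tshift_nilpotent: "v \<in> VS ys \<Longrightarrow> (tshift ys ^^ sum_list ys) v = 0"
proof (rule ext2)
  fix i j assume v: "v \<in> VS ys"
  have "(i, j) \<in> Bas ys \<Longrightarrow> j < sum_list ys"
    using member_le_sum_list[of "ys ! i" ys] by (auto simp: mem_Bas)
  then show "(tshift ys ^^ sum_list ys) v (i, j) = 0 (i, j)" unfolding tshift_pow[OF v] by auto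
qed

text \<open>The last nonzero multiple of a nonzero kernel element under powers of \<open>T\<close>
  would be a nonzero socle element in the kernel.\<close>

lemma inj_on_socle:
  assumes c: "lin c" "\<And>v. v \<in> VS ys \<Longrightarrow> c (tshift ys v) = T (c v)" "lin T"
    and soc: "\<And>v. v \<in> VS ys \<Longrightarrow> tshift ys v = 0 \<Longrightarrow> c v = 0 \<Longrightarrow> v = 0"
  shows "inj_on c (VS ys)"
proof -
  have "v = 0" if v: "v \<in> VS ys" "c v = 0" for v
  proof (rule ccontr)
    assume nz: "v \<noteq> 0"
    let ?P = "\<lambda>n. (tshift ys ^^ n) v = 0"
    define n where "n = (LEAST n. ?P n)"
    have Pn: "?P n" unfolding n_def using tshift_nilpotent[OF v(1)] by (rule LeastI)
    have "n \<noteq> 0" using Pn nz by (cases n) auto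
    then obtain k where k: "n = Suc k" by (cases n) auto
    have nk: "\<not> ?P k" using not_less_Least[of k ?P] unfolding n_def[symmetric] k by simp
    have "c ((tshift ys ^^ j) v) = 0" for j
    proof (induction j)
      case (Suc j)
      have "c ((tshift ys ^^ Suc j) v) = T (c ((tshift ys ^^ j) v))" using c(2)[OF tshift_pow_VS[OF v(1)], of j] by simp
      also have "\<dots> = 0" unfolding Suc by (rule lin_0[OF c(3)])
      finally show ?case .
    qed (use v in simp)
    then have "(tshift ys ^^ k) v = 0" using soc[OF tshift_pow_VS[OF v(1)]] Pn k by simp
    then show False using nk by blast
  qed
  then show ?thesis using fvv.linear_inj_on_iff_eq_0[OF c(1) subspace_coord_space] by blast
qed

text \<open>Splitting criterion. Here \<open>cyclic_proj\<close> is an arbitrary linear map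
  \<open>B \<rightarrow> N_y1\<close> whose composite with \<open>i\<close> is injective, so that
  \<open>B\<close> is the sum of the image of \<open>i\<close> and the kernel of
  \<open>cyclic_proj\<close>. The conditions linking \<open>i\<close> and \<open>cyclic_proj\<close>
  with \<open>A\<close> make \<open>A\<close> split compatibly.\<close>

lemma decomposes_fsum:
  assumes T: "lin T" and sA: "fv.subspace A" and sB: "fv.subspace B" and AB: "A \<subseteq> B"
    and i: "lin i" "\<And>v. v \<in> VS y1 \<Longrightarrow> i v \<in> B" "\<And>v. v \<in> VS y1 \<Longrightarrow> i (tshift y1 v) = T (i v)"
      "\<And>v. v \<in> VS x1 \<Longrightarrow> i (F1 v) \<in> A"
    and cyclic_proj: "lin cyclic_proj" "\<And>b. b \<in> B \<Longrightarrow> cyclic_proj b \<in> VS y1" "\<And>a. a \<in> A \<Longrightarrow> cyclic_proj a \<in> F1 ` VS x1"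
    and inj: "inj_on (\<lambda>v. cyclic_proj (i v)) (VS y1)"
    and h: "hemb (x1, y1, F1)" "hemb X2"
    and d: "decomposes T {a \<in> A. cyclic_proj a = 0} {b \<in> B. cyclic_proj b = 0} X2"
  shows "decomposes T A B (fsum (x1, y1, F1) X2)"
proof -
  obtain x2 y2 F2 where X2: "X2 = (x2, y2, F2)" by (metis prod.exhaust)
  obtain \<psi> where \<psi>: "lin \<psi>" "bij_betw \<psi> (VS y2) {b \<in> B. cyclic_proj b = 0}"
    "\<And>v. v \<in> VS y2 \<Longrightarrow> \<psi> (tshift y2 v) = T (\<psi> v)" "\<psi> ` F2 ` VS x2 = {a \<in> A. cyclic_proj a = 0}"
    using d unfolding X2 by auto
  have \<psi>B: "\<psi> v \<in> B" "cyclic_proj (\<psi> v) = 0" if "v \<in> VS y2" for v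
    using \<psi>(2) that by (auto simp: bij_betw_def)
  have F1: "lin F1" "\<And>v. v \<in> VS x1 \<Longrightarrow> F1 v \<in> VS y1" using h(1) by (auto simp: thom_def)
  have F2: "\<And>v. v \<in> VS x2 \<Longrightarrow> F2 v \<in> VS y2" using h(2) by (auto simp: thom_def X2)
  let ?c = "\<lambda>v. cyclic_proj (i v)"
  have lc: "lin ?c" using i(1) cyclic_proj(1) by (rule lin_comp)
  have c1: "?c ` VS y1 = VS y1"
    by (rule lin_inj_surj[OF lc subspace_coord_space order_refl finite_Bas inj]) (use i cyclic_proj in auto)
  have A1: "F1 ` VS x1 \<subseteq> VS y1" using F1 by auto
  have c2: "?c ` F1 ` VS x1 = F1 ` VS x1"
    by (rule lin_inj_surj[OF lc fvv.linear_subspace_image[OF F1(1) subspace_coord_space] A1 finite_Bas])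
       (use inj A1 i cyclic_proj in \<open>auto intro: inj_on_subset\<close>)
  let ?n = "length y1"
  define \<Psi> where "\<Psi> = (\<lambda>v. i (take_blocks ?n v) + \<psi> (drop_blocks ?n v))"
  have l\<Psi>: "lin \<Psi>" unfolding \<Psi>_def
    using lin_comp[OF lin_take_blocks[of ?n] i(1)] lin_comp[OF lin_drop_blocks[of ?n] \<psi>(1)] by (rule fvv.linear_compose_add)
  have \<Psi>B: "\<Psi> v \<in> B" if v: "v \<in> VS (y1 @ y2)" for v
    unfolding \<Psi>_def using i(2)[OF take_blocks_VS[OF v]] \<psi>B(1)[OF drop_blocks_VS[OF v]] by (rule fv.subspace_add[OF sB])
  have join_blocks: "\<Psi> (join_blocks ?n u w) = i u + \<psi> w" if "u \<in> VS y1" for u w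
    unfolding \<Psi>_def by (simp add: take_blocks_id[OF that])
  have "inj_on \<Psi> (VS (y1 @ y2))"
  proof -
    have "v = 0" if v: "v \<in> VS (y1 @ y2)" "\<Psi> v = 0" for v
    proof -
      note vv = take_blocks_VS[OF v(1)] drop_blocks_VS[OF v(1)]
      have "cyclic_proj (\<Psi> v) = ?c (take_blocks ?n v) + cyclic_proj (\<psi> (drop_blocks ?n v))" unfolding \<Psi>_def by (rule lin_add[OF cyclic_proj(1)])
      then have "?c (take_blocks ?n v) = 0" using v(2) lin_0[OF cyclic_proj(1)] \<psi>B(2)[OF vv(2)] by simp
      then have t: "take_blocks ?n v = 0"
        using inj vv(1) fvv.linear_inj_on_iff_eq_0[OF lc subspace_coord_space] by blast
      then have "\<psi> (drop_blocks ?n v) = 0" using v(2) lin_0[OF i(1)] by (simp add: \<Psi>_def)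
      moreover have "inj_on \<psi> (VS y2)" using \<psi>(2) by (simp add: bij_betw_def)
      ultimately have "drop_blocks ?n v = 0"
        using vv(2) fvv.linear_inj_on_iff_eq_0[OF \<psi>(1) subspace_coord_space] by blast
      moreover have "join_blocks ?n (0 :: idx \<Rightarrow> 'a) 0 = 0" by (rule ext2) simp
      ultimately show ?thesis using t join_blocks_take_blocks_drop_blocks[of ?n v] by metis
    qed
    then show ?thesis using fvv.linear_inj_on_iff_eq_0[OF l\<Psi> subspace_coord_space] by blast
  qed
  moreover have "\<Psi> ` VS (y1 @ y2) = B"
  proof
    show "\<Psi> ` VS (y1 @ y2) \<subseteq> B" using \<Psi>B by blast
    show "B \<subseteq> \<Psi> ` VS (y1 @ y2)"
    proof
      fix b assume b: "b \<in> B"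
      then have "cyclic_proj b \<in> ?c ` VS y1" using cyclic_proj(2) c1 by simp
      then obtain u where u: "u \<in> VS y1" "cyclic_proj b = ?c u" by blast
      have "b - i u \<in> B" using b i(2)[OF u(1)] by (rule fv.subspace_diff[OF sB])
      moreover have "cyclic_proj (b - i u) = 0" unfolding lin_diff[OF cyclic_proj(1)] u(2) by simp
      ultimately have "b - i u \<in> \<psi> ` VS y2" using \<psi>(2) by (simp add: bij_betw_def)
      then obtain w where w: "w \<in> VS y2" "b - i u = \<psi> w" by blast
      have "b = \<Psi> (join_blocks ?n u w)" unfolding join_blocks[OF u(1)] w(2)[symmetric] by simp
      then show "b \<in> \<Psi> ` VS (y1 @ y2)" using join_blocks_VS[OF u(1) w(1)] by blast
    qed
  qed
  ultimately have bij: "bij_betw \<Psi> (VS (y1 @ y2)) B" by (simp add: bij_betw_def)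
  have comm: "\<Psi> (tshift (y1 @ y2) v) = T (\<Psi> v)" if v: "v \<in> VS (y1 @ y2)" for v
    unfolding \<Psi>_def take_blocks_tshift drop_blocks_tshift lin_add[OF T] using i(3)[OF take_blocks_VS[OF v]] \<psi>(3)[OF drop_blocks_VS[OF v]] by simp
  have im: "\<Psi> ` (\<lambda>v. join_blocks ?n (F1 (take_blocks (length x1) v)) (F2 (drop_blocks (length x1) v))) ` VS (x1 @ x2) = A"
  proof (intro equalityI subsetI)
    fix x assume "x \<in> \<Psi> ` (\<lambda>v. join_blocks ?n (F1 (take_blocks (length x1) v)) (F2 (drop_blocks (length x1) v))) ` VS (x1 @ x2)"
    then obtain v where v: "v \<in> VS (x1 @ x2)" "x = \<Psi> (join_blocks ?n (F1 (take_blocks (length x1) v)) (F2 (drop_blocks (length x1) v)))" by blast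
    note vv = take_blocks_VS[OF v(1)] drop_blocks_VS[OF v(1)]
    have "x = i (F1 (take_blocks (length x1) v)) + \<psi> (F2 (drop_blocks (length x1) v))"
      unfolding v(2) by (rule join_blocks) (use F1 vv in auto)
    moreover have "\<psi> (F2 (drop_blocks (length x1) v)) \<in> A" using \<psi>(4) vv(2) by blast
    ultimately show "x \<in> A" using i(4)[OF vv(1)] fv.subspace_add[OF sA] by metis
  next
    fix x assume x: "x \<in> A"
    then have "cyclic_proj x \<in> ?c ` F1 ` VS x1" using cyclic_proj(3) c2 by simp
    then obtain u where u: "u \<in> VS x1" "cyclic_proj x = ?c (F1 u)" by blast
    have "x - i (F1 u) \<in> A" using x i(4)[OF u(1)] by (rule fv.subspace_diff[OF sA])
    moreover have "cyclic_proj (x - i (F1 u)) = 0" unfolding lin_diff[OF cyclic_proj(1)] u(2) by simp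
    ultimately have "x - i (F1 u) \<in> \<psi> ` F2 ` VS x2" using \<psi>(4) by simp
    then obtain w where w: "w \<in> VS x2" "x - i (F1 u) = \<psi> (F2 w)" by blast
    let ?v = "join_blocks (length x1) u w"
    have "x = \<Psi> (join_blocks ?n (F1 u) (F2 w))" unfolding join_blocks[OF F1(2)[OF u(1)]] w(2)[symmetric] by simp
    also have "\<dots> = \<Psi> (join_blocks ?n (F1 (take_blocks (length x1) ?v)) (F2 (drop_blocks (length x1) ?v)))" by (simp add: take_blocks_id[OF u(1)])
    finally show "x \<in> \<Psi> ` (\<lambda>v. join_blocks ?n (F1 (take_blocks (length x1) v)) (F2 (drop_blocks (length x1) v))) ` VS (x1 @ x2)"
      using join_blocks_VS[OF u(1) w(1)] by blast
  qed
  show ?thesis unfolding X2 fsum.simps decomposes.simps using l\<Psi> bij comm im by blast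
qed

text \<open>\<open>cyclic_emb T m e\<close> is the module map \<open>k[T]/(T^m) \<rightarrow> B\<close> sending the generator to \<open>e\<close>; \<open>cyclic_proj T m f\<close> is
  the module map \<open>B \<rightarrow> k[T]/(T^m)\<close> whose socle coefficient is the functional \<open>f\<close>.\<close>

definition cyclic_emb :: "((idx \<Rightarrow> 'k::field) \<Rightarrow> idx \<Rightarrow> 'k) \<Rightarrow> nat \<Rightarrow> (idx \<Rightarrow> 'k) \<Rightarrow> (idx \<Rightarrow> 'k) \<Rightarrow> idx \<Rightarrow> 'k" where
  "cyclic_emb T m e v = (\<Sum>j<m. vscale (v (0, j)) ((T ^^ j) e))"

definition cyclic_proj :: "((idx \<Rightarrow> 'k::field) \<Rightarrow> idx \<Rightarrow> 'k) \<Rightarrow> nat \<Rightarrow> ((idx \<Rightarrow> 'k) \<Rightarrow> 'k) \<Rightarrow> (idx \<Rightarrow> 'k) \<Rightarrow> idx \<Rightarrow> 'k" where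
  "cyclic_proj T m f b = (\<lambda>(i, j). if i = 0 \<and> j < m then f ((T ^^ (m - 1 - j)) b) else 0)"

lemma cyclic_proj_apply: "cyclic_proj T m f b (i, j) = (if i = 0 \<and> j < m then f ((T ^^ (m - 1 - j)) b) else 0)"
  by (simp add: cyclic_proj_def)

lemma lin_cyclic_emb: "lin (cyclic_emb T m e)"
  by (rule linI) (simp_all add: cyclic_emb_def fv.scale_left_distrib sum.distrib fv.scale_sum_right)

lemma cyclic_emb_tshift:
  assumes "lin T" "(T ^^ m) e = 0"
  shows "cyclic_emb T m e (tshift [m] v) = T (cyclic_emb T m e v)"
proof (cases m)
  case 0
  then show ?thesis using lin_0[OF assms(1)] by (simp add: cyclic_emb_def)
next
  case (Suc n)
  have "cyclic_emb T m e (tshift [m] v) = (\<Sum>j<n. vscale (v (0, j)) ((T ^^ Suc j) e))"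
    unfolding cyclic_emb_def Suc sum.lessThan_Suc_shift by (simp add: tshift_apply Bas_single fv.scale_zero_left)
  moreover have "T (cyclic_emb T m e v) = (\<Sum>j<n. vscale (v (0, j)) ((T ^^ Suc j) e)) + vscale (v (0, n)) ((T ^^ m) e)"
    unfolding cyclic_emb_def Suc by (simp add: lin_add[OF assms(1)] lin_sum[OF assms(1)] lin_vscale[OF assms(1)])
  ultimately show ?thesis unfolding assms(2) by (simp add: fv.scale_zero_right)
qed

lemma cyclic_emb_socle:
  assumes "v \<in> VS [m]" "tshift [m] v = 0" "m \<ge> 1"
  shows "cyclic_emb T m e v = vscale (v (0, m - 1)) ((T ^^ (m - 1)) e)" "\<And>i j. v (i, j) \<noteq> 0 \<Longrightarrow> i = 0 \<and> j = m - 1"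
proof -
  show z: "i = 0 \<and> j = m - 1" if nz: "v (i, j) \<noteq> 0" for i j
  proof -
    have "(i, j) \<in> Bas [m]" using VS_D[OF assms(1)] nz by blast
    then have ij: "i = 0" "j < m" by (auto simp: Bas_single)
    have "tshift [m] v (0, Suc j) = 0" using assms(2) by simp
    then show ?thesis using nz ij by (auto simp: tshift_apply Bas_single split: if_splits)
  qed
  obtain n where n: "m = Suc n" using assms(3) by (cases m) auto
  have "(\<Sum>j<n. vscale (v (0, j)) ((T ^^ j) e)) = 0"
  proof (rule sum.neutral, intro ballI)
    fix j assume "j \<in> {..<n}"
    then have "v (0, j) = 0" using z[of 0 j] n by auto
    then show "vscale (v (0, j)) ((T ^^ j) e) = 0" by (metis fv.scale_zero_left)
  qed
  then show "cyclic_emb T m e v = vscale (v (0, m - 1)) ((T ^^ (m - 1)) e)" by (simp add: cyclic_emb_def n)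
qed

lemma lin_cyclic_proj: "lin T \<Longrightarrow> lfun f \<Longrightarrow> lin (cyclic_proj T m f)"
  by (rule linI; rule ext2)
     (auto simp: cyclic_proj_apply lin_add[OF lin_pow] lin_vscale[OF lin_pow] fvk.linear_add fvk.linear_scale)

lemma cyclic_proj_VS: "cyclic_proj T m f b \<in> VS [m]"
  by (rule VS_I2) (auto simp: cyclic_proj_apply Bas_single)

text \<open>Applying \<open>T\<close> moves every coefficient up by one level; the only discrepancy
  is the bottom coefficient \<open>f (T^m b)\<close>, which has to vanish.\<close>

lemma cyclic_proj_tshift:
  assumes "f ((T ^^ m) b) = 0"
  shows "cyclic_proj T m f (T b) = tshift [m] (cyclic_proj T m f b)"
proof (rule ext2)
  fix i j
  have s: "(T ^^ n) (T b) = (T ^^ Suc n) b" for n by (simp add: funpow_swap1)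
  show "cyclic_proj T m f (T b) (i, j) = tshift [m] (cyclic_proj T m f b) (i, j)"
  proof (cases "i = 0 \<and> j < m")
    case True
    show ?thesis
    proof (cases j)
      case 0
      then show ?thesis using True assms unfolding cyclic_proj_apply s by (simp add: tshift_apply del: funpow.simps)
    next
      case (Suc k)
      then have "Suc (m - 1 - j) = m - 1 - k" using True by (simp add: Suc_diff_Suc)
      then show ?thesis using True Suc unfolding cyclic_proj_apply s by (simp add: tshift_apply Bas_single cyclic_proj_apply del: funpow.simps)
    qed
  qed (auto simp: cyclic_proj_apply tshift_apply Bas_single)
qed

text \<open>Submodules of a fixed coordinate space stand in for quotient modules: a summand is split off by
  passing from \<open>(A, B)\<close> to the kernels of a projection.\<close>

locale nilpotent_pair =
  fixes T :: "(idx \<Rightarrow> 'k::field) \<Rightarrow> idx \<Rightarrow> 'k" and A B :: "(idx \<Rightarrow> 'k) set" and Z :: "idx set" and N :: nat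
  assumes lT: "lin T" and sA: "fv.subspace A" and sB: "fv.subspace B" and AB: "A \<subseteq> B"
    and TB: "b \<in> B \<Longrightarrow> T b \<in> B" and TA: "a \<in> A \<Longrightarrow> T a \<in> A"
    and TTA: "a \<in> A \<Longrightarrow> T (T a) = 0"
    and BZ: "B \<subseteq> coord_space Z" and finZ: "finite Z" and nil: "b \<in> B \<Longrightarrow> (T ^^ N) b = 0"
begin

lemma TnB: "b \<in> B \<Longrightarrow> (T ^^ n) b \<in> B"
  by (induction n) (auto intro: TB)

lemma Tn_sub: "fv.subspace ((T ^^ n) ` B)"
  by (rule fvv.linear_subspace_image[OF lin_pow[OF lT] sB])

lemma Tn0: "(T ^^ n) 0 = 0"
  by (rule lin_0[OF lin_pow[OF lT]])

lemma Tn_Suc: "(T ^^ n) (T b) = (T ^^ Suc n) b"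
  by (simp add: funpow_swap1)

lemma Tn_add: "(T ^^ m) ((T ^^ n) b) = (T ^^ (m + n)) b"
  by (simp add: funpow_add)

lemma TnA: "a \<in> A \<Longrightarrow> 2 \<le> n \<Longrightarrow> (T ^^ n) a = 0"
proof -
  assume a: "a \<in> A" and "2 \<le> n"
  then obtain k where "n = k + 2" by (metis add.commute le_Suc_ex)
  then have "(T ^^ n) a = (T ^^ k) (T (T a))" unfolding Tn_Suc by simp
  then show ?thesis using TTA[OF a] Tn0 by metis
qed

lemma cyclic_emb_B: "e \<in> B \<Longrightarrow> cyclic_emb T m e v \<in> B"
  unfolding cyclic_emb_def by (intro fv.subspace_sum[OF sB] fv.subspace_scale[OF sB] TnB)

lemma restrict: "lin p \<Longrightarrow> (\<And>b. b \<in> B \<Longrightarrow> p (T b) = tshift y (p b)) \<Longrightarrow> nilpotent_pair T {a \<in> A. p a = 0} {b \<in> B. p b = 0} Z N"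
proof (rule nilpotent_pair.intro)
  assume p: "lin p" "\<And>b. b \<in> B \<Longrightarrow> p (T b) = tshift y (p b)"
  have k: "fv.subspace {x \<in> S. p x = 0}" if S: "fv.subspace S" for S
  proof -
    have "{x \<in> S. p x = 0} = S \<inter> {x. p x = 0}" by blast
    then show ?thesis using fv.subspace_inter[OF S fvv.linear_subspace_kernel[OF p(1)]] by metis
  qed
  show "fv.subspace {a \<in> A. p a = 0}" "fv.subspace {b \<in> B. p b = 0}" using k sA sB by blast+
  show "{a \<in> A. p a = 0} \<subseteq> {b \<in> B. p b = 0}" using AB by blast
  have pT: "p (T b) = 0" if "b \<in> B" "p b = 0" for b
    unfolding p(2)[OF that(1)] that(2) by (rule lin_0[OF lin_tshift])
  show "T b \<in> {b \<in> B. p b = 0}" if "b \<in> {b \<in> B. p b = 0}" for b using that TB pT by blast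
  show "T a \<in> {a \<in> A. p a = 0}" if "a \<in> {a \<in> A. p a = 0}" for a using that TA pT AB by blast
  show "T (T a) = 0" if "a \<in> {a \<in> A. p a = 0}" for a using that TTA by blast
  show "{b \<in> B. p b = 0} \<subseteq> coord_space Z" using BZ by blast
  show "(T ^^ N) b = 0" if "b \<in> {b \<in> B. p b = 0}" for b using that nil by blast
qed (rule lT finZ)+

text \<open>Since \<open>T^(m-1) e\<close> is not in \<open>T^m B\<close>, a functional can vanish
  on \<open>T^m B\<close> and be \<open>1\<close> there. The first makes the projection
  \<open>T\<close>-linear, the second makes it injective on the socle of the cyclic module generated
  by \<open>e\<close>.\<close>

lemma picket_split:
  assumes l: "l \<le> 2" "l \<le> m" "1 \<le> m" and e: "e \<in> B" "(T ^^ m) e = 0" "(T ^^ (m - 1)) e \<notin> (T ^^ m) ` B"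
    and Al: "\<And>x n. x \<in> A \<Longrightarrow> l \<le> n \<Longrightarrow> (T ^^ n) x = 0"
    and eA: "\<And>j. m - l \<le> j \<Longrightarrow> (T ^^ j) e \<in> A"
  shows "\<exists>p. lin p \<and> (\<forall>b\<in>B. p (T b) = tshift [m] (p b)) \<and> (\<exists>b\<in>B. p b \<noteq> 0) \<and>
    (\<forall>X. hemb X \<longrightarrow> decomposes T {a \<in> A. p a = 0} {b \<in> B. p b = 0} X \<longrightarrow> decomposes T A B (fsum ([l], [m], pickF l m) X))"
proof -
  obtain f where f: "lfun f" "\<And>x. x \<in> (T ^^ m) ` B \<Longrightarrow> f x = 0" "f ((T ^^ (m - 1)) e) = 1"
    using functional_exists[OF Tn_sub e(3)] by blast
  let ?p = "cyclic_proj T m f" and ?i = "cyclic_emb T m e"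
  have lp: "lin ?p" by (rule lin_cyclic_proj[OF lT f(1)])
  have pT: "?p (T b) = tshift [m] (?p b)" if "b \<in> B" for b by (rule cyclic_proj_tshift) (use f(2) that in blast)
  have iT: "?i (tshift [m] v) = T (?i v)" for v by (rule cyclic_emb_tshift[OF lT e(2)])
  have iA: "?i (pickF l m v) \<in> A" for v
    unfolding cyclic_emb_def
  proof (rule fv.subspace_sum[OF sA])
    fix j
    show "vscale (pickF l m v (0, j)) ((T ^^ j) e) \<in> A"
    proof (cases "m - l \<le> j")
      case False
      then have "pickF l m v (0, j) = 0" by (simp add: pickF_apply)
      then show ?thesis using fv.subspace_0[OF sA] by (metis fv.scale_zero_left)
    qed (intro fv.subspace_scale[OF sA] eA)
  qed
  \<comment> \<open>As \<open>T^l\<close> kills \<open>A\<close>, only the top \<open>l\<close>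
    coefficients of the projection of \<open>a\<close> survive, which is the image of
    \<open>pickF\<close>.\<close>
  have pA: "?p a \<in> pickF l m ` VS [l]" if a: "a \<in> A" for a
  proof
    let ?v = "\<lambda>(i, j). if i = 0 \<and> j < l then f ((T ^^ (l - 1 - j)) a) else 0"
    show "?v \<in> VS [l]" by (rule VS_I2) (auto simp: Bas_single)
    show "?p a = pickF l m ?v"
    proof (rule ext2)
      fix i j
      have "f ((T ^^ (m - 1 - j)) a) = 0" if "j < m" "\<not> m - l \<le> j"
      proof -
        have "l \<le> m - 1 - j" using that by simp
        then show ?thesis using Al[OF a] fvk.linear_0[OF f(1)] by metis
      qed
      moreover have "l - 1 - (j - (m - l)) = m - 1 - j" if "j < m" "m - l \<le> j" using that l by simp
      moreover have "j - (m - l) < l" if "j < m" "m - l \<le> j" using that l by simp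
      ultimately show "?p a (i, j) = pickF l m ?v (i, j)" by (auto simp: cyclic_proj_apply pickF_apply)
    qed
  qed
  have inj: "inj_on (\<lambda>v. ?p (?i v)) (VS [m])"
  proof (rule inj_on_socle[OF lin_comp[OF lin_cyclic_emb lp] _ lin_tshift])
    show "?p (?i (tshift [m] v)) = tshift [m] (?p (?i v))" for v unfolding iT by (rule pT[OF cyclic_emb_B[OF e(1)]])
    fix v :: "idx \<Rightarrow> 'k" assume v: "v \<in> VS [m]" "tshift [m] v = 0" and z: "?p (?i v) = 0"
    note s = cyclic_emb_socle[OF v l(3)]
    have "?p (?i v) (0, m - 1) = 0" using z by simp
    then have "f (vscale (v (0, m - 1)) ((T ^^ (m - 1)) e)) = 0" unfolding cyclic_proj_apply s(1) using l(3) by simp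
    then have "v (0, m - 1) = 0" unfolding fvk.linear_scale[OF f(1)] f(3) by simp
    then show "v = 0" using s(2) by (intro ext2) (metis zero_fun_apply)
  qed
  have nz: "?p e \<noteq> 0"
  proof
    assume "?p e = 0"
    then have "?p e (0, 0) = 0" by simp
    then show False using f(3) l(3) by (simp add: cyclic_proj_apply)
  qed
  have h: "hemb ([l], [m], pickF l m)" using thom_pickF[OF l(2)] by simp
  have "decomposes T A B (fsum ([l], [m], pickF l m) X)"
    if "hemb X" "decomposes T {a \<in> A. ?p a = 0} {b \<in> B. ?p b = 0} X" for X
    by (rule decomposes_fsum[OF lT sA sB AB lin_cyclic_emb cyclic_emb_B[OF e(1)] iT iA lp cyclic_proj_VS pA inj h that])
  then show ?thesis using lp pT nz e(1) by blast
qed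

text \<open>\<open>T a\<close> has the largest height \<open>k\<close> among nonzero elements of
  \<open>T A\<close>, and \<open>a\<close> has the largest height \<open>s\<close> among the
  elements of \<open>A\<close> with such an image. Two functionals \<open>f1\<close>,
  \<open>f2\<close> give the projections to the long and the short block; they must satisfy
  \<open>f2 = f1 \<circ> T\<close> on \<open>A\<close> for the image of \<open>A\<close> to match
  \<open>arcF\<close>.\<close>

lemma bipicket_split:
  assumes a: "a \<in> A" "b \<in> B" "b' \<in> B" "T a = (T ^^ k) b" "T a \<noteq> 0" "a = (T ^^ s) b'" and sk: "s + 2 \<le> k"
    and kmax: "\<And>x y j. x \<in> A \<Longrightarrow> y \<in> B \<Longrightarrow> T x = (T ^^ j) y \<Longrightarrow> T x \<noteq> 0 \<Longrightarrow> j \<le> k"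
    and smax: "\<And>x y y' j. x \<in> A \<Longrightarrow> y \<in> B \<Longrightarrow> y' \<in> B \<Longrightarrow> T x = (T ^^ k) y \<Longrightarrow> T x \<noteq> 0 \<Longrightarrow>
      x = (T ^^ j) y' \<Longrightarrow> j + 1 \<le> k \<Longrightarrow> j \<le> s"
  defines "m \<equiv> k + 1" and "r \<equiv> s + 1"
  shows "\<exists>p. lin p \<and> (\<forall>b\<in>B. p (T b) = tshift [m, r] (p b)) \<and> (\<exists>b\<in>B. p b \<noteq> 0) \<and>
    (\<forall>X. hemb X \<longrightarrow> decomposes T {a \<in> A. p a = 0} {b \<in> B. p b = 0} X \<longrightarrow> decomposes T A B (fsum ([2], [m, r], arcF m r) X))"
proof -
  have mr: "1 \<le> r" "r + 2 \<le> m" "1 \<le> m" "2 \<le> m" using sk by (simp_all add: m_def r_def)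
  obtain d where d: "k = Suc (s + Suc d)" using sk by (metis add_2_eq_Suc' add_Suc_right le_Suc_ex add.assoc add_Suc)
  \<comment> \<open>With \<open>k = s + d + 2\<close> one gets \<open>T^s e = a - T^(m-2) b\<close>.
    This is killed by \<open>T\<close> because \<open>T a = T^k b\<close>, so \<open>e\<close>
    generates the short block of length \<open>r\<close>, and \<open>a\<close> takes the form of
    \<open>\<delta>(1)\<close>.\<close>
  define e where "e = b' - (T ^^ Suc d) b"
  have eB: "e \<in> B" unfolding e_def by (intro fv.subspace_diff[OF sB] a TnB)
  have ae: "a = (T ^^ (m - 2)) b + (T ^^ s) e"
    unfolding e_def lin_diff[OF lin_pow[OF lT]] Tn_add a(6)[symmetric] by (simp add: m_def d del: funpow.simps)
  have bm: "(T ^^ m) b = 0"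
    using TTA[OF a(1)] unfolding a(4) by (simp add: m_def)
  have bm1: "(T ^^ (m - 1)) b = T a" using a(4) by (simp add: m_def)
  have er: "(T ^^ r) e = 0"
  proof -
    have "T a = (T ^^ Suc (m - 2)) b + (T ^^ r) e" using arg_cong[OF ae, of T] by (simp add: lin_add[OF lT] r_def)
    moreover have "Suc (m - 2) = k" using mr by (simp add: m_def)
    ultimately show ?thesis using a(4) by simp
  qed
  \<comment> \<open>Vanishing on \<open>T^m B\<close> gives \<open>T\<close>-linearity of the long
    projection. Vanishing on \<open>T (A \<inter> T^r B)\<close> is imposed so that
    \<open>f2\<close> can vanish on \<open>T^r B\<close> and still agree with
    \<open>f1 \<circ> T\<close> on \<open>A\<close>.\<close>
  define S1 where "S1 = {x + y |x y. x \<in> (T ^^ m) ` B \<and> y \<in> T ` (A \<inter> (T ^^ r) ` B)}"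
  have sS1: "fv.subspace S1" unfolding S1_def
    by (intro fv.subspace_sums Tn_sub fvv.linear_subspace_image[OF lT] fv.subspace_inter sA)
  have nS1: "T a \<notin> S1"
  proof
    assume "T a \<in> S1"
    then obtain y x y' where y: "y \<in> B" "x \<in> A" "y' \<in> B" "x = (T ^^ r) y'" "T a = (T ^^ m) y + T x"
      unfolding S1_def by blast
    have ax: "a - x \<in> A" using a(1) y(2) by (rule fv.subspace_diff[OF sA])
    have "T (a - x) = (T ^^ m) y" unfolding lin_diff[OF lT] y(5) by simp
    \<comment> \<open>A nonzero value would be an element of \<open>T A\<close> of height at least
      \<open>m = k + 1\<close>. Hence \<open>T x = T a\<close>, and \<open>x\<close> in
      \<open>T^r B\<close> contradicts the maximality of \<open>s\<close>.\<close>
    then have "T (a - x) = 0" using kmax[OF ax y(1), of m] by (auto simp: m_def)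
    then have "T x = T a" unfolding lin_diff[OF lT] by simp
    then have "r \<le> s" using smax[OF y(2) a(2) y(3) _ _ y(4)] a(4,5) sk by (simp add: r_def)
    then show False by (simp add: r_def)
  qed
  obtain f1 where f1: "lfun f1" "\<And>x. x \<in> S1 \<Longrightarrow> f1 x = 0" "f1 (T a) = 1"
    using functional_exists[OF sS1 nS1] by blast
  have f1B: "f1 ((T ^^ m) y) = 0" if "y \<in> B" for y
  proof (rule f1(2))
    have "0 \<in> T ` (A \<inter> (T ^^ r) ` B)"
      by (rule fv.subspace_0) (intro fvv.linear_subspace_image[OF lT] fv.subspace_inter sA Tn_sub)
    then have "(T ^^ m) y + 0 \<in> S1" unfolding S1_def using that by blast
    then show "(T ^^ m) y \<in> S1" by simp
  qed
  have f1A: "f1 (T x) = 0" if "x \<in> A" "x \<in> (T ^^ r) ` B" for x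
  proof (rule f1(2))
    have "0 + T x \<in> S1" unfolding S1_def using that fv.subspace_0[OF Tn_sub[of m]] by blast
    then show "T x \<in> S1" by simp
  qed
  define K1 where "K1 = {x \<in> A. f1 (T x) = 0}"
  have sK1: "fv.subspace K1"
    using sA unfolding fv.subspace_def K1_def
    by (auto simp: lin_0[OF lT] lin_add[OF lT] lin_vscale[OF lT] fvk.linear_0[OF f1(1)] fvk.linear_add[OF f1(1)] fvk.linear_scale[OF f1(1)])
  \<comment> \<open>Killing \<open>K1\<close> together with \<open>f2 a = 1\<close> forces the
    relation \<open>f2 = f1 \<circ> T\<close> on \<open>A\<close>, since \<open>A\<close> is spanned
    by \<open>K1\<close> and \<open>a\<close>.\<close>
  define S2 where "S2 = {x + y |x y. x \<in> (T ^^ r) ` B \<and> y \<in> K1}"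
  have sS2: "fv.subspace S2" unfolding S2_def by (intro fv.subspace_sums Tn_sub sK1)
  have nS2: "a \<notin> S2"
  proof
    assume "a \<in> S2"
    then obtain x y where xy: "x \<in> (T ^^ r) ` B" "y \<in> A" "f1 (T y) = 0" "a = x + y" unfolding S2_def K1_def by blast
    have "x = a - y" using xy(4) by simp
    then have "x \<in> A" using fv.subspace_diff[OF sA a(1) xy(2)] by simp
    then have "f1 (T x) = 0" using f1A xy(1) by blast
    then show False using xy(3,4) f1(3) by (simp add: lin_add[OF lT] fvk.linear_add[OF f1(1)])
  qed
  obtain f2 where f2: "lfun f2" "\<And>x. x \<in> S2 \<Longrightarrow> f2 x = 0" "f2 a = 1"
    using functional_exists[OF sS2 nS2] by blast
  have f2B: "f2 ((T ^^ r) y) = 0" if "y \<in> B" for y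
  proof (rule f2(2))
    have "(T ^^ r) y + 0 \<in> S2" unfolding S2_def using that fv.subspace_0[OF sK1] by blast
    then show "(T ^^ r) y \<in> S2" by simp
  qed
  have f2K: "f2 x = 0" if "x \<in> K1" for x
  proof (rule f2(2))
    have "0 + x \<in> S2" unfolding S2_def using that fv.subspace_0[OF Tn_sub[of r]] by blast
    then show "x \<in> S2" by simp
  qed
  have f2A: "f2 x = f1 (T x)" if x: "x \<in> A" for x
  proof -
    have "x - vscale (f1 (T x)) a \<in> K1" unfolding K1_def
      using fv.subspace_diff[OF sA x fv.subspace_scale[OF sA a(1)], of "f1 (T x)"] f1(3)
      by (simp add: lin_diff[OF lT] lin_vscale[OF lT] fvk.linear_diff[OF f1(1)] fvk.linear_scale[OF f1(1)])
    then have "f2 (x - vscale (f1 (T x)) a) = 0" by (rule f2K)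
    then show ?thesis by (simp add: fvk.linear_diff[OF f2(1)] fvk.linear_scale[OF f2(1)] f2(3))
  qed
  have f2T: "f2 (T x) = 0" if "x \<in> A" for x
    using f2A[OF TA[OF that]] TTA[OF that] fvk.linear_0[OF f1(1)] by simp
  have f2e: "f2 ((T ^^ s) e) = 1"
  proof -
    have "m - 2 = r + d" using d by (simp add: m_def r_def)
    then have "(T ^^ (m - 2)) b = (T ^^ r) ((T ^^ d) b)" unfolding Tn_add by simp
    then have "f2 ((T ^^ (m - 2)) b) = 0" using f2B[OF TnB[OF a(2)]] by simp
    then show ?thesis using f2(3) arg_cong[OF ae, of f2] by (simp add: fvk.linear_add[OF f2(1)])
  qed
  let ?p = "\<lambda>x. join_blocks 1 (cyclic_proj T m f1 x) (cyclic_proj T r f2 x)" and ?i = "\<lambda>v. cyclic_emb T m b (take_blocks 1 v) + cyclic_emb T r e (drop_blocks 1 v)"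
  have lp: "lin ?p" by (intro lin_join_blocks lin_cyclic_proj lT f1 f2)
  have li: "lin ?i" by (intro fvv.linear_compose_add lin_comp[OF lin_take_blocks lin_cyclic_emb] lin_comp[OF lin_drop_blocks lin_cyclic_emb])
  have pT: "?p (T x) = tshift [m, r] (?p x)" if "x \<in> B" for x
    using cyclic_proj_tshift[where f = f1 and T = T, OF f1B[OF that]] cyclic_proj_tshift[where f = f2 and T = T, OF f2B[OF that]]
      tshift_join_blocks[of "[m]" "[r]" "cyclic_proj T m f1 x" "cyclic_proj T r f2 x"] by simp
  have tks: "take_blocks 1 (tshift [m, r] v) = tshift [m] (take_blocks 1 v)" "drop_blocks 1 (tshift [m, r] v) = tshift [r] (drop_blocks 1 v)" for v :: "idx \<Rightarrow> 'k"
    using take_blocks_tshift[of "[m]" "[r]" v] drop_blocks_tshift[of "[m]" "[r]" v] by simp_all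
  have iT: "?i (tshift [m, r] v) = T (?i v)" for v
    unfolding tks cyclic_emb_tshift[OF lT bm] cyclic_emb_tshift[OF lT er] lin_add[OF lT] ..
  have iB: "?i v \<in> B" for v by (intro fv.subspace_add[OF sB] cyclic_emb_B a eB)
  have pV: "?p x \<in> VS [m, r]" for x
    using join_blocks_VS[of "cyclic_proj T m f1 x" "[m]" "cyclic_proj T r f2 x" "[r]"] by (simp add: cyclic_proj_VS)
  have iA: "?i (arcF m r v) \<in> A" for v
  proof -
    have 1: "cyclic_emb T m b (take_blocks 1 (arcF m r v)) = vscale (v (0, 0)) ((T ^^ (m - 2)) b) + vscale (v (0, 1)) (T a)"
    proof -
      obtain n where n: "m = Suc (Suc n)" using mr(4) by (metis add_2_eq_Suc le_Suc_ex)
      have "(\<Sum>j<n. vscale (take_blocks 1 (arcF m r v) (0, j)) ((T ^^ j) b)) = 0"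
        by (rule sum.neutral) (auto simp: arcF_apply n fun_eq_iff)
      then show ?thesis using bm1 by (simp add: cyclic_emb_def n arcF_apply)
    qed
    have 2: "cyclic_emb T r e (drop_blocks 1 (arcF m r v)) = vscale (v (0, 0)) ((T ^^ s) e)"
    proof -
      have "(\<Sum>j<s. vscale (drop_blocks 1 (arcF m r v) (0, j)) ((T ^^ j) e)) = 0"
        by (rule sum.neutral) (auto simp: arcF_apply r_def fun_eq_iff)
      then show ?thesis by (simp add: cyclic_emb_def r_def arcF_apply)
    qed
    have "?i (arcF m r v) = vscale (v (0, 0)) a + vscale (v (0, 1)) (T a)"
      unfolding 1 2 by (subst ae) (simp add: fv.scale_right_distrib)
    then show ?thesis using fv.subspace_add[OF sA fv.subspace_scale[OF sA a(1)] fv.subspace_scale[OF sA TA[OF a(1)]]] by metis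
  qed
  have pA: "?p x \<in> arcF m r ` VS [2]" if x: "x \<in> A" for x
  proof
    let ?v = "\<lambda>(i, j). if i = 0 \<and> j = 0 then f1 (T x) else if i = 0 \<and> j = 1 then f1 x else 0"
    show "?v \<in> VS [2]" by (rule VS_I2) (auto simp: Bas_single)
    have z: "f ((T ^^ n) x) = 0" if "2 \<le> n" "lfun f" for f n
      using TnA[OF x that(1)] fvk.linear_0[OF that(2)] by metis
    have c1: "f1 ((T ^^ (m - 1 - j)) x) = (if j + 2 = m then f1 (T x) else if j + 1 = m then f1 x else 0)" if jm: "j < m" for j
    proof -
      consider "j + 1 = m" | "j + 2 = m" | "2 \<le> m - 1 - j" using jm by linarith
      then show ?thesis using z[OF _ f1(1), of "m - 1 - j"] by cases (auto simp: numeral_2_eq_2)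
    qed
    have c2: "f2 ((T ^^ (r - 1 - j)) x) = (if j + 1 = r then f1 (T x) else 0)" if jm: "j < r" for j
    proof -
      consider "j + 1 = r" | "j + 2 = r" | "2 \<le> r - 1 - j" using jm by linarith
      then show ?thesis using z[OF _ f2(1), of "r - 1 - j"] f2A[OF x] f2T[OF x] by cases (auto simp: numeral_2_eq_2)
    qed
    show "?p x = arcF m r ?v"
    proof (rule ext2)
      fix i j :: nat
      consider "i = 0" "j < m" | "i = 0" "\<not> j < m" | "i = 1" "j < r" | "i = 1" "\<not> j < r" | "2 \<le> i" by linarith
      then show "?p x (i, j) = arcF m r ?v (i, j)"
        using mr c1[of j] c2[of j] by cases (auto simp: cyclic_proj_apply arcF_apply)
    qed
  qed
  have inj: "inj_on (\<lambda>v. ?p (?i v)) (VS [m, r])"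
  proof (rule inj_on_socle[OF lin_comp[OF li lp] _ lin_tshift])
    show "?p (?i (tshift [m, r] v)) = tshift [m, r] (?p (?i v))" for v unfolding iT by (rule pT[OF iB])
    fix v :: "idx \<Rightarrow> 'k" assume v: "v \<in> VS [m, r]" "tshift [m, r] v = 0" and z: "?p (?i v) = 0"
    have vv: "take_blocks 1 v \<in> VS [m]" "drop_blocks 1 v \<in> VS [r]" using take_blocks_VS[of v "[m]" "[r]"] drop_blocks_VS[of v "[m]" "[r]"] v(1) by simp_all
    have "take_blocks 1 (0 :: idx \<Rightarrow> 'k) = 0" "drop_blocks 1 (0 :: idx \<Rightarrow> 'k) = 0" using lin_0[OF lin_take_blocks] lin_0[OF lin_drop_blocks] by blast+
    then have sv: "tshift [m] (take_blocks 1 v) = 0" "tshift [r] (drop_blocks 1 v) = 0" using tks[of v] v(2) by simp_all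
    note s1 = cyclic_emb_socle[OF vv(1) sv(1) mr(3)] and s2 = cyclic_emb_socle[OF vv(2) sv(2) mr(1)]
    let ?a = "v (0, m - 1)" and ?b = "v (1, r - 1)"
    \<comment> \<open>On the two socle generators \<open>T a\<close> and \<open>T^s e\<close> the
      functionals are triangular: \<open>f2\<close> is \<open>0\<close> and \<open>1\<close>, and
      \<open>f1\<close> is \<open>1\<close> on the first. The two coefficients vanish in
      turn.\<close>
    have iv: "?i v = vscale ?a (T a) + vscale ?b ((T ^^ s) e)"
      unfolding s1(1) s2(1) bm1 by (simp add: r_def)
    have "?p (?i v) (1, r - 1) = 0" using z by simp
    then have "f2 (?i v) = 0" using mr(1) by (simp add: cyclic_proj_apply)
    then have b0: "?b = 0" unfolding iv using f2e f2T[OF a(1)]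
      by (simp add: fvk.linear_add[OF f2(1)] fvk.linear_scale[OF f2(1)])
    have "?p (?i v) (0, m - 1) = 0" using z by simp
    then have "f1 (?i v) = 0" using mr(3) by (simp add: cyclic_proj_apply)
    then have a0: "?a = 0" unfolding iv b0 using f1(3)
      by (simp add: fvk.linear_add[OF f1(1)] fvk.linear_scale[OF f1(1)] fvk.linear_0[OF f1(1)])
    have "take_blocks 1 v = 0" using s1(2) a0 by (intro ext2) (metis take_blocks_apply zero_fun_apply)
    moreover have "drop_blocks 1 v = 0"
    proof (rule ext2)
      fix i j show "drop_blocks 1 v (i, j) = 0 (i, j)" using s2(2)[of i j] b0 by (cases "drop_blocks 1 v (i, j) = 0") auto
    qed
    moreover have "join_blocks 1 (0 :: idx \<Rightarrow> 'k) 0 = 0" by (rule ext2) simp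
    ultimately show "v = 0" using join_blocks_take_blocks_drop_blocks[of 1 v] by metis
  qed
  have nz: "?p b \<noteq> 0"
  proof
    assume "?p b = 0"
    then have "?p b (0, 0) = 0" by simp
    then show False using f1(3) bm1 mr(3) by (simp add: cyclic_proj_apply)
  qed
  have h: "hemb ([2], [m, r], arcF m r)" using thom_arcF[OF mr(1,4)] by simp
  have "decomposes T A B (fsum ([2], [m, r], arcF m r) X)"
    if "hemb X" "decomposes T {a \<in> A. ?p a = 0} {b \<in> B. ?p b = 0} X" for X
    by (rule decomposes_fsum[OF lT sA sB AB li iB iT iA lp pV pA inj h that])
  then show ?thesis using lp pT nz a(2) by blast
qed

lemma nat_max:
  fixes P :: "nat \<Rightarrow> bool"
  assumes "P j" "\<And>n. P n \<Longrightarrow> n \<le> b"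
  shows "\<exists>k. P k \<and> (\<forall>n. P n \<longrightarrow> n \<le> k)"
  using GreatestI_nat[of P j b] Greatest_le_nat[of P _ b] assms by blast

lemma Tn_large: "b \<in> B \<Longrightarrow> N \<le> n \<Longrightarrow> (T ^^ n) b = 0"
proof -
  assume b: "b \<in> B" and "N \<le> n"
  then obtain d where "n = d + N" by (metis add.commute le_Suc_ex)
  then have "(T ^^ n) b = (T ^^ d) ((T ^^ N) b)" unfolding Tn_add by simp
  then show ?thesis using nil[OF b] Tn0 by simp
qed

text \<open>The summand is dictated by heights: if \<open>T A\<close> is nonzero, a picket
  \<open>P_2\<close> or a bipicket; if only \<open>A\<close> is nonzero, a picket \<open>P_1\<close>
  at an element of \<open>A\<close> of largest height; if \<open>A = {0}\<close>, a picket
  \<open>P_0\<close> of the largest length in \<open>B\<close>.\<close>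

lemma split_exists:
  assumes "B \<noteq> {0}"
  shows "\<exists>ss p y. list_all valid_summand ss \<and> lin p \<and> (\<forall>b\<in>B. p (T b) = tshift y (p b)) \<and> (\<exists>b\<in>B. p b \<noteq> 0) \<and>
    (\<forall>X. hemb X \<longrightarrow> decomposes T {a \<in> A. p a = 0} {b \<in> B. p b = 0} X \<longrightarrow> decomposes T A B (fsum (fsum_list ss) X))"
proof -
  have pick: ?thesis
    if "l \<le> 2" "l \<le> m" "1 \<le> m" "e \<in> B" "(T ^^ m) e = 0" "(T ^^ (m - 1)) e \<notin> (T ^^ m) ` B"
      "\<And>x n. x \<in> A \<Longrightarrow> l \<le> n \<Longrightarrow> (T ^^ n) x = 0" "\<And>j. m - l \<le> j \<Longrightarrow> (T ^^ j) e \<in> A" for l m e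
  proof -
    have fun_emb: "fsum_list [Picket l m] = (([l], [m], pickF l m) :: 'k femb)"
      using fsum_list_Cons[of "Picket l m" "[]", where 'a = 'k] fun_emb_picket[OF that(2), where 'a = 'k]
      by (simp add: fsum_list_Nil fzero_def del: summand_emb.simps) (auto simp: fun_eq_iff join_blocks_def pickF_def take_blocks_def)
    have v: "list_all valid_summand [Picket l m]" using that by simp
    show ?thesis using picket_split[OF that, folded fun_emb] v by blast
  qed
  show ?thesis
  proof (cases "\<exists>a\<in>A. T a \<noteq> 0")
    case True
    then obtain a0 where a0: "a0 \<in> A" "T a0 \<noteq> 0" by blast
    define P where "P j \<longleftrightarrow> (\<exists>x\<in>A. \<exists>y\<in>B. T x = (T ^^ j) y \<and> T x \<noteq> 0)" for j
    have "T a0 = (T ^^ 1) a0" by simp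
    then have P1: "P 1" unfolding P_def using a0 AB by blast
    have b: "n \<le> N" if "P n" for n using that Tn_large[of _ n] unfolding P_def by (metis nat_le_linear)
    obtain k where k: "P k" "\<And>n. P n \<Longrightarrow> n \<le> k" using nat_max[of P, OF P1 b] by blast
    have k1: "1 \<le> k" using k(2) P1 by blast
    \<comment> \<open>Second maximisation: heights of those \<open>x\<close> in \<open>A\<close> for
      which \<open>T x\<close> already attains the largest height \<open>k\<close>.\<close>
    define Q where "Q j \<longleftrightarrow> j + 1 \<le> k \<and> (\<exists>x\<in>A. \<exists>y\<in>B. \<exists>y'\<in>B. T x = (T ^^ k) y \<and> T x \<noteq> 0 \<and> x = (T ^^ j) y')" for j
    have Q0: "Q 0"
    proof -
      obtain x y where "x \<in> A" "y \<in> B" "T x = (T ^^ k) y" "T x \<noteq> 0" using k(1) unfolding P_def by blast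
      moreover have "x = (T ^^ 0) x" "x \<in> B" using AB \<open>x \<in> A\<close> by auto
      ultimately show ?thesis using k1 unfolding Q_def by (metis add_0)
    qed
    have b: "n \<le> k" if "Q n" for n using that unfolding Q_def by simp
    obtain s where s: "Q s" "\<And>n. Q n \<Longrightarrow> n \<le> s" using nat_max[of Q, OF Q0 b] by blast
    obtain a b b' where a: "a \<in> A" "b \<in> B" "b' \<in> B" "T a = (T ^^ k) b" "T a \<noteq> 0" "a = (T ^^ s) b'"
      using s(1) unfolding Q_def by blast
    show ?thesis
    \<comment> \<open>If the heights of \<open>a\<close> and \<open>T a\<close> are consecutive, a
      single cyclic summand generated by \<open>b'\<close> contains both and gives
      \<open>P_2\<close>. A larger gap needs the second block of a bipicket.\<close>
    proof (cases "s + 1 = k")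
      case True
      have e: "(T ^^ k) b' = T a" unfolding a(6) using True by auto
      show ?thesis
      proof (rule pick[of 2 "k + 1" b'])
        show "(T ^^ (k + 1)) b' = 0" using TTA[OF a(1)] e by simp
        show "(T ^^ (k + 1 - 1)) b' \<notin> (T ^^ (k + 1)) ` B"
        proof
          assume "(T ^^ (k + 1 - 1)) b' \<in> (T ^^ (k + 1)) ` B"
          then obtain y where "y \<in> B" "(T ^^ k) b' = (T ^^ (k + 1)) y" by auto
          then have "P (k + 1)" unfolding P_def using e a(1,5) by metis
          then show False using k(2)[of "k + 1"] by simp
        qed
        show "(T ^^ n) x = 0" if "x \<in> A" "2 \<le> n" for x n using TnA that by blast
        show "(T ^^ j) b' \<in> A" if "k + 1 - 2 \<le> j" for j
        proof -
          have "s \<le> j" using that True by simp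
          then obtain d where "j = d + s" by (metis add.commute le_Suc_ex)
          then have "(T ^^ j) b' = (T ^^ d) a" unfolding a(6) Tn_add by simp
          moreover have "(T ^^ d) a \<in> A" by (induction d) (auto intro: TA a)
          ultimately show ?thesis by simp
        qed
      qed (use k1 a in auto)
    next
      case False
      then have sk: "s + 2 \<le> k" using s(1) unfolding Q_def by simp
      have fun_emb: "fsum_list [Bipicket (k + 1) (s + 1)] = (([2], [k + 1, s + 1], arcF (k + 1) (s + 1)) :: 'k femb)"
        using fsum_list_Cons[of "Bipicket (k + 1) (s + 1)" "[]", where 'a = 'k] fun_emb_bipicket[of "s + 1" "k + 1", where 'a = 'k] sk
        by (simp add: fsum_list_Nil fzero_def del: summand_emb.simps) (auto simp: fun_eq_iff join_blocks_def arcF_def take_blocks_def)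
      have v: "list_all valid_summand [Bipicket (k + 1) (s + 1)]" using sk by simp
      have "\<exists>p. lin p \<and> (\<forall>b\<in>B. p (T b) = tshift [k + 1, s + 1] (p b)) \<and> (\<exists>b\<in>B. p b \<noteq> 0) \<and>
        (\<forall>X. hemb X \<longrightarrow> decomposes T {a \<in> A. p a = 0} {b \<in> B. p b = 0} X \<longrightarrow>
          decomposes T A B (fsum ([2], [k + 1, s + 1], arcF (k + 1) (s + 1)) X))"
        by (rule bipicket_split[OF a sk]) (use k(2) s(2) in \<open>unfold P_def Q_def, blast\<close>)+
      then show ?thesis unfolding fun_emb[symmetric] using v by blast
    qed
  next
    case False
    then have T0: "T x = 0" if "x \<in> A" for x using that by blast
    show ?thesis
    proof (cases "A = {0}")
      case False
      then obtain a0 where a0: "a0 \<in> A" "a0 \<noteq> 0" using fv.subspace_0[OF sA] by blast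
      define P where "P j \<longleftrightarrow> (\<exists>y\<in>B. (T ^^ j) y \<in> A \<and> (T ^^ j) y \<noteq> 0)" for j
      have P0: "P 0" unfolding P_def using a0 AB by auto
      have b: "n \<le> N" if "P n" for n using that Tn_large[of _ n] unfolding P_def by (metis nat_le_linear)
      obtain k where k: "P k" "\<And>n. P n \<Longrightarrow> n \<le> k" using nat_max[of P, OF P0 b] by blast
      obtain e where e: "e \<in> B" "(T ^^ k) e \<in> A" "(T ^^ k) e \<noteq> 0" using k(1) unfolding P_def by blast
      have z: "(T ^^ n) x = 0" if xn: "x \<in> A" "1 \<le> n" for x n
      proof -
        obtain d where "n = Suc d" using xn(2) by (cases n) auto
        then show ?thesis using T0[OF xn(1)] Tn0[of d] Tn_Suc[of d x] by simp
      qed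
      show ?thesis
      proof (rule pick[of 1 "k + 1" e])
        show "(T ^^ (k + 1)) e = 0" using T0[OF e(2)] by simp
        show "(T ^^ (k + 1 - 1)) e \<notin> (T ^^ (k + 1)) ` B"
        proof
          assume "(T ^^ (k + 1 - 1)) e \<in> (T ^^ (k + 1)) ` B"
          then obtain y where "y \<in> B" "(T ^^ k) e = (T ^^ (k + 1)) y" by auto
          then have "P (k + 1)" unfolding P_def using e(1,2,3) by metis
          then show False using k(2)[of "k + 1"] by simp
        qed
        show "(T ^^ j) e \<in> A" if "k + 1 - 1 \<le> j" for j
        proof (cases "j = k")
          case False
          have d: "j = (j - k - 1 + 1) + k" using that False by simp
          then have "(T ^^ j) e = 0" using z[OF e(2), of "j - k - 1 + 1"] unfolding Tn_add by (simp add: d[symmetric])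
          then show ?thesis using fv.subspace_0[OF sA] by simp
        qed (use e in simp)
      qed (use e z in auto)
    next
      case True
      obtain b0 where b0: "b0 \<in> B" "b0 \<noteq> 0" using assms fv.subspace_0[OF sB] by blast
      define P where "P j \<longleftrightarrow> (\<exists>y\<in>B. (T ^^ j) y \<noteq> 0)" for j
      have P0: "P 0" unfolding P_def using b0 by auto
      have b: "n \<le> N" if "P n" for n using that Tn_large[of _ n] unfolding P_def by (metis nat_le_linear)
      obtain k where k: "P k" "\<And>n. P n \<Longrightarrow> n \<le> k" using nat_max[of P, OF P0 b] by blast
      obtain e where e: "e \<in> B" "(T ^^ k) e \<noteq> 0" using k(1) unfolding P_def by blast
      have z: "(T ^^ j) x = 0" if "x \<in> B" "k + 1 \<le> j" for x j using k(2)[of j] that unfolding P_def by fastforce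
      show ?thesis
      proof (rule pick[of 0 "k + 1" e])
        show "(T ^^ (k + 1)) e = 0" using z e by blast
        show "(T ^^ (k + 1 - 1)) e \<notin> (T ^^ (k + 1)) ` B" using z[of _ "k + 1"] e(2) by auto
        show "(T ^^ n) x = 0" if "x \<in> A" for x n using that Tn0 True by simp
        show "(T ^^ j) e \<in> A" if "k + 1 - 0 \<le> j" for j using z[OF e(1), of j] that True by simp
      qed (use e in auto)
    qed
  qed
qed

end

lemma nilpotent_pair_decomposition:
  "nilpotent_pair T A B Z N \<Longrightarrow> \<exists>ss. list_all valid_summand ss \<and> decomposes T A B (fsum_list ss)"
proof (induction "fv.dim B" arbitrary: A B rule: less_induct)
  case less
  interpret nilpotent_pair T A B Z N by (rule less.prems)
  show ?case
  proof (cases "B = {0}")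
    case True
    then have A: "A = {0}" using AB fv.subspace_0[OF sA] by blast
    have b: "Bas [] = {}" by (simp add: Bas_def)
    have c: "coord_space {} = {0 :: idx \<Rightarrow> 'a}" by (auto simp: coord_space_def fun_eq_iff)
    have "decomposes T A B fzero" unfolding fzero_def decomposes.simps b c
      by (rule exI[of _ "\<lambda>v. 0"]) (use True A lin_0[OF lT] in \<open>auto simp: bij_betw_def linI\<close>)
    then show ?thesis by (intro exI[of _ "[]"]) (simp add: fsum_list_Nil)
  next
    case False
    obtain ss p y where p: "list_all valid_summand ss" "lin p" "\<forall>b\<in>B. p (T b) = tshift y (p b)"
      "\<exists>b\<in>B. p b \<noteq> 0"
      "\<forall>X. hemb X \<longrightarrow> decomposes T {a \<in> A. p a = 0} {b \<in> B. p b = 0} X \<longrightarrow> decomposes T A B (fsum (fsum_list ss) X)"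
      using split_exists[OF False] by (elim exE conjE) (rule that)
    let ?B = "{b \<in> B. p b = 0}"
    have t: "nilpotent_pair T {a \<in> A. p a = 0} ?B Z N" by (rule restrict[OF p(2) p(3)[rule_format]])
    have sub: "?B \<subseteq> B" by blast
    \<comment> \<open>The kernel is a proper subspace because the projection is not zero on
      \<open>B\<close>; this is the descent.\<close>
    have nle: "\<not> fv.dim B \<le> fv.dim ?B"
      using subspace_dim_eq[OF nilpotent_pair.sB[OF t] sub BZ finZ] p(4) by blast
    then have lt: "fv.dim ?B < fv.dim B" by simp
    obtain ts where ts: "list_all valid_summand ts" "decomposes T {a \<in> A. p a = 0} ?B (fsum_list ts)"
      using less.hyps[OF lt t] by blast
    have "decomposes T A B (fsum_list (ss @ ts))" unfolding fsum_list_append by (rule p(5)[rule_format, OF hemb_fsum_list[OF ts(1)] ts(2)])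
    then show ?thesis using p(1) ts(1) by (intro exI[of _ "ss @ ts"]) simp
  qed
qed

section \<open>From pairs of a module and a submodule back to embeddings\<close>

fun inj_emb :: "'k::field femb \<Rightarrow> bool" where
  "inj_emb (xs, ys, F) \<longleftrightarrow> inj_on F (VS xs)"

lemma inj_emb_summand:
  assumes "valid_summand s"
  shows "inj_emb (fun_emb (summand_emb s) :: 'k::field femb)"
proof (cases s)
  case (Picket l m)
  have lm: "l \<le> m" using assms Picket by simp
  have "u = v" if uv: "u \<in> VS [l]" "v \<in> VS [l]" "pickF l m u = pickF l m v" for u v :: "idx \<Rightarrow> 'k"
  proof (rule ext2)
    fix i j
    show "u (i, j) = v (i, j)"
    proof (cases "i = 0 \<and> j < l")
      case True
      obtain d where d: "m = d + l" using lm by (metis add.commute le_Suc_ex)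
      then show ?thesis using fun_cong[OF uv(3), of "(0, j + d)"] True by (simp add: pickF_apply)
    qed (use VS_single_D[OF uv(1)] VS_single_D[OF uv(2)] in metis)
  qed
  then show ?thesis unfolding Picket fun_emb_picket[OF lm] inj_emb.simps by (rule inj_onI)
next
  case (Bipicket m r)
  have mr: "1 \<le> r" "2 \<le> m" using assms Bipicket by auto
  obtain n where n: "m = n + 2" using mr(2) by (metis add.commute le_Suc_ex)
  have "u = v" if uv: "u \<in> VS [2]" "v \<in> VS [2]" "arcF m r u = arcF m r v" for u v :: "idx \<Rightarrow> 'k"
  proof (rule ext2)
    fix i j :: nat
    consider "i = 0" "j = 0" | "i = 0" "j = 1" | "\<not> (i = 0 \<and> j < 2)" by linarith
    then show "u (i, j) = v (i, j)"
    proof cases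
      case 1
      then show ?thesis using fun_cong[OF uv(3), of "(0, n)"] by (simp add: arcF_apply n)
    next
      case 2
      then show ?thesis using fun_cong[OF uv(3), of "(0, n + 1)"] by (simp add: arcF_apply n)
    qed (use VS_single_D[OF uv(1)] VS_single_D[OF uv(2)] in metis)
  qed
  then show ?thesis unfolding Bipicket fun_emb_bipicket[OF mr] inj_emb.simps by (rule inj_onI)
qed

lemma inj_emb_fsum:
  assumes "inj_emb X" "inj_emb Y" "hemb X"
  shows "inj_emb (fsum X Y)"
proof -
  obtain x1 y1 F1 x2 y2 F2 where e: "X = (x1, y1, F1)" "Y = (x2, y2, F2)"
    by (metis prod.exhaust)
  have F: "\<And>v. v \<in> VS x1 \<Longrightarrow> F1 v \<in> VS y1" "inj_on F1 (VS x1)" "inj_on F2 (VS x2)"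
    using assms by (auto simp: e thom_def)
  have "u = v" if uv: "u \<in> VS (x1 @ x2)" "v \<in> VS (x1 @ x2)"
    "join_blocks (length y1) (F1 (take_blocks (length x1) u)) (F2 (drop_blocks (length x1) u)) = join_blocks (length y1) (F1 (take_blocks (length x1) v)) (F2 (drop_blocks (length x1) v))" for u v
  proof -
    note t = take_blocks_VS[OF uv(1)] take_blocks_VS[OF uv(2)] and d = drop_blocks_VS[OF uv(1)] drop_blocks_VS[OF uv(2)]
    have "F1 (take_blocks (length x1) u) = F1 (take_blocks (length x1) v)"
      using arg_cong[OF uv(3), of "take_blocks (length y1)"] unfolding take_blocks_join_blocks take_blocks_id[OF F(1)[OF t(1)]] take_blocks_id[OF F(1)[OF t(2)]] .
    then have "take_blocks (length x1) u = take_blocks (length x1) v" using inj_onD[OF F(2) _ t] by blast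
    moreover have "F2 (drop_blocks (length x1) u) = F2 (drop_blocks (length x1) v)"
      using arg_cong[OF uv(3), of "drop_blocks (length y1)"] unfolding drop_blocks_join_blocks .
    then have "drop_blocks (length x1) u = drop_blocks (length x1) v" using inj_onD[OF F(3) _ d] by blast
    ultimately show ?thesis using join_blocks_take_blocks_drop_blocks by metis
  qed
  then show ?thesis unfolding e fsum.simps inj_emb.simps by (intro inj_onI)
qed

lemma inj_emb_fsum_list: "list_all valid_summand ss \<Longrightarrow> inj_emb (fsum_list ss :: 'k::field femb)"
proof (induction ss)
  case Nil
  have b: "Bas [] = {}" by (simp add: Bas_def)
  have "coord_space {} = {0 :: idx \<Rightarrow> 'k}" by (auto simp: coord_space_def fun_eq_iff)
  then show ?case by (simp add: fsum_list_Nil fzero_def b)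
next
  case (Cons s ss)
  then show ?case unfolding fsum_list_Cons by (intro inj_emb_fsum inj_emb_summand hemb_summand) auto
qed

lemma decomposition_exists:
  fixes F :: "(idx \<Rightarrow> 'k::field) \<Rightarrow> idx \<Rightarrow> 'k"
  assumes F: "thom xs ys F" and inj: "inj_on F (VS xs)" and le2: "\<forall>x\<in>set xs. x \<le> 2"
  shows "\<exists>ss. list_all valid_summand ss \<and> eqv (xs, ys, F) (fsum_list ss)"
proof -
  have lF: "lin F" "\<And>v. v \<in> VS xs \<Longrightarrow> F v \<in> VS ys" "\<And>v. v \<in> VS xs \<Longrightarrow> F (tshift xs v) = tshift ys (F v)"
    using F by (auto simp: thom_def)
  have sh2: "tshift xs (tshift xs v) = 0" for v :: "idx \<Rightarrow> 'k"
  proof (rule ext2)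
    fix i j
    have "i < length xs \<Longrightarrow> xs ! i \<le> 2" using le2 nth_mem by blast
    then show "tshift xs (tshift xs v) (i, j) = 0 (i, j)" by (auto simp: tshift_apply mem_Bas)
  qed
  have "nilpotent_pair (tshift ys) (F ` VS xs) (VS ys) (Bas ys) (sum_list ys)"
  proof
    show "fv.subspace (F ` VS xs)" by (rule fvv.linear_subspace_image[OF lF(1) subspace_coord_space])
    show "tshift ys (tshift ys a) = 0" if a: "a \<in> F ` VS xs" for a
    proof -
      obtain v where v: "v \<in> VS xs" "a = F v" using a by blast
      have "tshift ys (tshift ys a) = F (tshift xs (tshift xs v))" using lF(3) v by simp
      then show ?thesis unfolding sh2 lin_0[OF lF(1)] .
    qed
    show "tshift ys a \<in> F ` VS xs" if a: "a \<in> F ` VS xs" for a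
    proof -
      obtain v where v: "v \<in> VS xs" "a = F v" using a by blast
      then have "tshift ys a = F (tshift xs v)" using lF(3) by simp
      then show ?thesis using imageI[OF tshift_VS] by metis
    qed
  qed (use lF subspace_coord_space tshift_nilpotent in \<open>auto simp: lin_tshift lin_add[OF lin_tshift] lin_vscale[OF lin_tshift]\<close>)
  then obtain ss where ss: "list_all valid_summand ss" "decomposes (tshift ys) (F ` VS xs) (VS ys) (fsum_list ss)"
    using nilpotent_pair_decomposition by blast
  obtain x1 y1 F1 where X: "fsum_list ss = (x1, y1, F1 :: (idx \<Rightarrow> 'k) \<Rightarrow> _)" by (metis prod.exhaust)
  obtain \<psi> where \<psi>: "lin \<psi>" "bij_betw \<psi> (VS y1) (VS ys)" "\<And>v. v \<in> VS y1 \<Longrightarrow> \<psi> (tshift y1 v) = tshift ys (\<psi> v)"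
    "\<psi> ` F1 ` VS x1 = F ` VS xs"
    using ss(2) unfolding X by auto
  have F1: "lin F1" "\<And>v. v \<in> VS x1 \<Longrightarrow> F1 v \<in> VS y1" "\<And>v. v \<in> VS x1 \<Longrightarrow> F1 (tshift x1 v) = tshift y1 (F1 v)"
    using hemb_fsum_list[OF ss(1), where 'a = 'k] unfolding X by (auto simp: thom_def)
  have iF1: "inj_on F1 (VS x1)" using inj_emb_fsum_list[OF ss(1), where 'k = 'k] unfolding X by simp
  have i\<psi>: "inj_on \<psi> (VS y1)" using \<psi>(2) by (simp add: bij_betw_def)
  obtain G where G: "lin G" "\<forall>v\<in>VS xs. G (F v) = v"
    using fvv.linear_exists_left_inverse_on[OF lF(1) subspace_coord_space inj] by blast
  \<comment> \<open>Both \<open>F\<close> and the standard embedding are injective with images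
    corresponding under \<open>\<psi>\<close>, so the isomorphism of the sources is
    \<open>\<psi>\<close> pulled back along them.\<close>
  define \<phi> where "\<phi> = (\<lambda>v. G (\<psi> (F1 v)))"
  have \<phi>: "\<phi> u \<in> VS xs \<and> F (\<phi> u) = \<psi> (F1 u)" if u: "u \<in> VS x1" for u
  proof -
    have "\<psi> (F1 u) \<in> F ` VS xs" using \<psi>(4) u by blast
    then obtain v where "v \<in> VS xs" "\<psi> (F1 u) = F v" by blast
    then show ?thesis using G(2) by (simp add: \<phi>_def)
  qed
  have "lin \<phi>" unfolding \<phi>_def by (intro lin_comp[OF lin_comp[OF F1(1) \<psi>(1)] G(1)])
  moreover have "\<phi> (tshift x1 u) = tshift xs (\<phi> u)" if u: "u \<in> VS x1" for u
  proof (rule inj_onD[OF inj])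
    show "F (\<phi> (tshift x1 u)) = F (tshift xs (\<phi> u))"
      using \<phi>[OF u] \<phi>[OF tshift_VS, of u] F1(3)[OF u] \<psi>(3)[OF F1(2)[OF u]] lF(3)[of "\<phi> u"] by simp
  qed (use \<phi>[OF u] \<phi>[OF tshift_VS, of u] in auto)
  ultimately have t\<phi>: "thom x1 xs \<phi>" using \<phi> by (simp add: thom_def)
  have "inj_on \<phi> (VS x1)"
  proof (rule inj_onI)
    fix u v assume uv: "u \<in> VS x1" "v \<in> VS x1" "\<phi> u = \<phi> v"
    then have "\<psi> (F1 u) = \<psi> (F1 v)" using \<phi> by metis
    then show "u = v" using inj_onD[OF iF1 inj_onD[OF i\<psi>]] F1(2) uv(1,2) by blast
  qed
  moreover have "\<phi> ` VS x1 = VS xs"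
  proof
    show "\<phi> ` VS x1 \<subseteq> VS xs" using \<phi> by blast
    show "VS xs \<subseteq> \<phi> ` VS x1"
    proof
      fix v :: "idx \<Rightarrow> 'k" assume v: "v \<in> VS xs"
      then have "F v \<in> \<psi> ` F1 ` VS x1" unfolding \<psi>(4) by (rule imageI)
      then obtain u where u: "u \<in> VS x1" "F v = \<psi> (F1 u)" by blast
      then have "\<phi> u = v" using G(2) v unfolding \<phi>_def u(2)[symmetric] by simp
      then show "v \<in> \<phi> ` VS x1" using u(1) by blast
    qed
  qed
  ultimately have 1: "tiso x1 xs \<phi>" using t\<phi> by (simp add: tiso_def bij_betw_def)
  have 2: "tiso y1 ys \<psi>" using \<psi> lF by (auto simp: tiso_def thom_def bij_betw_def)
  have "eqv (fsum_list ss) (xs, ys, F)" unfolding X eqv.simps emb_iso_fun_def using 1 2 \<phi> by metis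
  then have "eqv (xs, ys, F) (fsum_list ss)" by (rule eqv_sym) (rule hemb_fsum_list[OF ss(1)])
  then show ?thesis using ss(1) by blast
qed

subsection \<open>Realising the moves by one-parameter families\<close>

text \<open>Elementary row operation: \<open>l T^c\<close> times block \<open>i\<close> is added to
  block \<open>k\<close>.\<close>

definition elem_op :: "nat \<Rightarrow> nat \<Rightarrow> nat \<Rightarrow> 'k::field \<Rightarrow> nat list \<Rightarrow> (idx \<Rightarrow> 'k) \<Rightarrow> idx \<Rightarrow> 'k" where
  "elem_op i k c l ys w = (\<lambda>(x, j). if x = k \<and> (k, j) \<in> Bas ys \<and> c \<le> j then w (k, j) + l * w (i, j - c) else w (x, j))"

lemma elem_op_apply: "elem_op i k c l ys w (x, j) =
  (if x = k \<and> (k, j) \<in> Bas ys \<and> c \<le> j then w (k, j) + l * w (i, j - c) else w (x, j))"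
  by (simp add: elem_op_def)

text \<open>The inequality says that sending the generator of block \<open>i\<close> to
  \<open>T^c\<close> in block \<open>k\<close> is a well-defined homomorphism. As
  \<open>i \<noteq> k\<close>, the operation with \<open>- l\<close> is the inverse.\<close>

lemma elem_op_tiso:
  assumes "i \<noteq> k" "i < length ys" "ys ! k \<le> ys ! i + c"
  shows "tiso ys ys (elem_op i k c l ys :: (idx \<Rightarrow> 'k::field) \<Rightarrow> idx \<Rightarrow> 'k)"
proof -
  have V: "elem_op i k c l ys w \<in> VS ys" if "w \<in> VS ys" for l and w :: "idx \<Rightarrow> 'k"
    by (rule VS_I2) (use VS_D[OF that] in \<open>auto simp: elem_op_apply\<close>)
  have inv: "elem_op i k c (- l) ys (elem_op i k c l ys w) = w" for l and w :: "idx \<Rightarrow> 'k"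
    by (rule ext2) (use assms(1) in \<open>auto simp: elem_op_apply\<close>)
  have "lin (elem_op i k c l ys)" by (rule linI; rule ext2) (auto simp: elem_op_apply algebra_simps)
  moreover have "elem_op i k c l ys (tshift ys w) = tshift ys (elem_op i k c l ys w)" for w :: "idx \<Rightarrow> 'k"
  proof (rule ext2)
    fix x j
    show "elem_op i k c l ys (tshift ys w) (x, j) = tshift ys (elem_op i k c l ys w) (x, j)"
    proof (cases "x = k \<and> (k, j) \<in> Bas ys \<and> c \<le> j")
      case True
      then have "(i, j - c) \<in> Bas ys" "(k, j - 1) \<in> Bas ys" using assms by (auto simp: mem_Bas)
      then show ?thesis using True by (auto simp: elem_op_apply tshift_apply diff_right_commute)
    qed (auto simp: elem_op_apply tshift_apply)
  qed
  moreover have "bij_betw (elem_op i k c l ys) (VS ys) (VS ys :: (idx \<Rightarrow> 'k) set)"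
  proof (rule bij_betw_byWitness[where f' = "elem_op i k c (- l) ys"])
    show "\<forall>a\<in>VS ys. elem_op i k c (- l) ys (elem_op i k c l ys a) = (a :: idx \<Rightarrow> 'k)" using inv by blast
    show "\<forall>a\<in>VS ys. elem_op i k c l ys (elem_op i k c (- l) ys a) = (a :: idx \<Rightarrow> 'k)" using inv[of "- l"] by simp
  qed (use V in blast)+
  ultimately show ?thesis using V unfolding tiso_def thom_def by blast
qed

definition monomial_op :: "nat list \<Rightarrow> 'k::field list \<Rightarrow> nat list \<Rightarrow> (idx \<Rightarrow> 'k) \<Rightarrow> idx \<Rightarrow> 'k" where
  "monomial_op \<sigma> \<mu> ys w = (\<lambda>(i, j). if (i, j) \<in> Bas ys then \<mu> ! i * w (\<sigma> ! i, j) else 0)"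

lemma monomial_op_apply: "monomial_op \<sigma> \<mu> ys w (i, j) = (if (i, j) \<in> Bas ys then \<mu> ! i * w (\<sigma> ! i, j) else 0)"
  by (simp add: monomial_op_def)

text \<open>Rescaling combined with a permutation of blocks that is an involution, so the same
  permutation serves for the inverse.\<close>

lemma monomial_op_tiso:
  assumes "length ys = length ys'"
    and "\<And>i. i < length ys \<Longrightarrow> \<sigma> ! i < length ys \<and> \<sigma> ! (\<sigma> ! i) = i \<and> ys' ! i = ys ! (\<sigma> ! i) \<and> \<mu> ! i \<noteq> 0"
  shows "tiso ys ys' (monomial_op \<sigma> \<mu> ys' :: (idx \<Rightarrow> 'k::field) \<Rightarrow> idx \<Rightarrow> 'k)"
proof -
  have B: "(\<sigma> ! i, j) \<in> Bas ys \<longleftrightarrow> (i, j) \<in> Bas ys'" if "i < length ys" for i j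
    using assms that by (auto simp: mem_Bas)
  have B': "(\<sigma> ! i, j) \<in> Bas ys' \<longleftrightarrow> (i, j) \<in> Bas ys" if "i < length ys" for i j
    using assms(1) assms(2)[OF that] assms(2)[of "\<sigma> ! i"] that by (auto simp: mem_Bas)
  have len: "(i, j) \<in> Bas ys' \<Longrightarrow> i < length ys" "(i, j) \<in> Bas ys \<Longrightarrow> i < length ys" for i j
    using assms(1) by (auto simp: mem_Bas)
  let ?inv = "\<lambda>w (i, j). if (i, j) \<in> Bas ys then w (\<sigma> ! i, j) / \<mu> ! (\<sigma> ! i) else (0::'k)"
  have V: "monomial_op \<sigma> \<mu> ys' w \<in> VS ys'" for w :: "idx \<Rightarrow> 'k" by (rule VS_I2) (simp add: monomial_op_apply)
  have "lin (monomial_op \<sigma> \<mu> ys')" by (rule linI; rule ext2) (auto simp: monomial_op_apply algebra_simps)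
  moreover have "monomial_op \<sigma> \<mu> ys' (tshift ys w) = tshift ys' (monomial_op \<sigma> \<mu> ys' w)" for w :: "idx \<Rightarrow> 'k"
  proof (rule ext2)
    fix i j
    show "monomial_op \<sigma> \<mu> ys' (tshift ys w) (i, j) = tshift ys' (monomial_op \<sigma> \<mu> ys' w) (i, j)"
    proof (cases "(i, j) \<in> Bas ys'")
      case True
      then have "(i, j - 1) \<in> Bas ys'" by (auto simp: mem_Bas)
      then show ?thesis using True B[OF len(1)[OF True], of j] by (simp add: monomial_op_apply tshift_apply)
    qed (simp add: monomial_op_apply tshift_apply)
  qed
  moreover have "bij_betw (monomial_op \<sigma> \<mu> ys') (VS ys) (VS ys' :: (idx \<Rightarrow> 'k) set)"
  proof (rule bij_betw_byWitness[where f' = ?inv])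
    show "\<forall>a\<in>VS ys. ?inv (monomial_op \<sigma> \<mu> ys' a) = (a :: idx \<Rightarrow> 'k)"
    proof
      fix a :: "idx \<Rightarrow> 'k" assume a: "a \<in> VS ys"
      show "?inv (monomial_op \<sigma> \<mu> ys' a) = a"
      proof (rule ext2)
        fix i j
        show "?inv (monomial_op \<sigma> \<mu> ys' a) (i, j) = a (i, j)"
        proof (cases "(i, j) \<in> Bas ys")
          case True
          note i = len(2)[OF True]
          show ?thesis using True B'[OF i, of j] assms(2)[OF i] assms(2)[of "\<sigma> ! i"] by (simp add: monomial_op_apply)
        qed (simp add: VS_D[OF a])
      qed
    qed
    show "\<forall>a\<in>VS ys'. monomial_op \<sigma> \<mu> ys' (?inv a) = (a :: idx \<Rightarrow> 'k)"
    proof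
      fix a :: "idx \<Rightarrow> 'k" assume a: "a \<in> VS ys'"
      show "monomial_op \<sigma> \<mu> ys' (?inv a) = a"
      proof (rule ext2)
        fix i j
        show "monomial_op \<sigma> \<mu> ys' (?inv a) (i, j) = a (i, j)"
        proof (cases "(i, j) \<in> Bas ys'")
          case True
          note i = len(1)[OF True]
          show ?thesis using True B[OF i, of j] assms(2)[OF i] by (simp add: monomial_op_apply)
        qed (simp add: VS_D[OF a] monomial_op_apply)
      qed
    qed
    show "?inv ` VS ys' \<subseteq> VS ys" by (intro image_subsetI VS_I2) simp
  qed (use V in blast)
  ultimately show ?thesis using V unfolding tiso_def thom_def by blast
qed

definition arc_emb :: "nat \<Rightarrow> nat \<Rightarrow> 'k::field femb" where
  "arc_emb m r = ([2], [m, r], arcF m r)"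

definition pole_emb :: "nat \<Rightarrow> 'k::field femb" where
  "pole_emb m = ([1], [m], pickF 1 m)"

text \<open>A move can create an arc of length one, which stands for \<open>P_2^m\<close>; as the
  block of length \<open>r = m - 1\<close> is still present in the ambient module, a picket
  \<open>P_0^r\<close> accompanies it.\<close>

definition arc_summand :: "nat \<Rightarrow> nat \<Rightarrow> summand list" where
  "arc_summand m r = (if r + 2 \<le> m then [Bipicket m r] else [Picket 2 m, Picket 0 r])"

lemma fsum_list_bipicket:
  assumes "1 \<le> r" "2 \<le> m"
  shows "fsum_list [Bipicket m r] = arc_emb m r"
proof -
  have "(\<lambda>v :: idx \<Rightarrow> 'a. join_blocks 2 (arcF m r (take_blocks 1 v)) 0) = arcF m r"
    by (intro ext ext2) (auto simp: arcF_apply)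
  then show ?thesis unfolding fsum_list_Cons fsum_list_Nil fun_emb_bipicket[OF assms] by (simp add: fzero_def arc_emb_def numeral_2_eq_2)
qed

lemma fsum_list_picket:
  assumes "l \<le> m"
  shows "fsum_list [Picket l m] = ([l], [m], pickF l m)"
proof -
  have "(\<lambda>v :: idx \<Rightarrow> 'a. join_blocks 1 (pickF l m (take_blocks 1 v)) 0) = pickF l m"
    by (intro ext ext2) (auto simp: pickF_apply)
  then show ?thesis unfolding fsum_list_Cons fsum_list_Nil fun_emb_picket[OF assms] by (simp add: fzero_def)
qed

lemma eqvI: "tiso xs xs' \<phi> \<Longrightarrow> tiso ys ys' \<psi> \<Longrightarrow> (\<And>v. v \<in> VS xs \<Longrightarrow> \<psi> (F v) = F' (\<phi> v)) \<Longrightarrow> eqv (xs, ys, F) (xs', ys', F')"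
  unfolding eqv.simps emb_iso_fun_def by blast

text \<open>For \<open>r = m - 1\<close> the two components of the generator sit at the same level
  \<open>m - 2 = r - 1\<close>, so subtracting the long block from the short one clears the short
  block.\<close>

lemma arc_summand_eqv:
  assumes "1 \<le> r" "r < m"
  shows "eqv (arc_emb m r :: 'k::field femb) (fsum_list (arc_summand m r))" "list_all valid_summand (arc_summand m r)" "diag (arc_summand m r) = {#Arc m r#}"
proof -
  show "list_all valid_summand (arc_summand m r)" using assms by (auto simp: arc_summand_def)
  show "diag (arc_summand m r) = {#Arc m r#}" using assms by (auto simp: arc_summand_def)
  show "eqv (arc_emb m r :: 'k femb) (fsum_list (arc_summand m r))"
  proof (cases "r + 2 \<le> m")
    case True
    then show ?thesis using fsum_list_bipicket[of r m, where 'a = 'k] assms by (simp add: arc_summand_def eqv_refl)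
  next
    case False
    then have m: "m = Suc r" using assms by simp
    have B: "Bas [2, 0] = Bas [2]"
      by (intro set_eqI) (auto simp: Bas_def less_Suc_eq)
    have f: "fsum_list (arc_summand m r) = ([2, 0], [m, r], \<lambda>v :: idx \<Rightarrow> 'k. join_blocks 1 (pickF 2 m (take_blocks 1 v)) (pickF 0 r (drop_blocks 1 v)))"
      using fsum_list_append[of "[Picket 2 m]" "[Picket 0 r]", where 'a = 'k] fsum_list_picket[of 2 m, where 'a = 'k]
        fsum_list_picket[of 0 r, where 'a = 'k] False assms by (simp add: arc_summand_def)
    show ?thesis unfolding f arc_emb_def
    proof (rule eqvI[where \<phi> = "\<lambda>v. v" and \<psi> = "elem_op 0 1 0 (- 1) [m, r]"])
      have "(i, j) \<in> Bas [2, 0] \<longleftrightarrow> (i, j) \<in> Bas [2]" for i j using B by simp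
      then have "tshift [2, 0] v = tshift [2] v" for v :: "idx \<Rightarrow> 'k" by (intro ext2) (simp add: tshift_apply)
      then show "tiso [2] [2, 0] (\<lambda>v :: idx \<Rightarrow> 'k. v)" using tiso_id[of "[2]", where 'a = 'k] by (simp add: tiso_def thom_def B)
      show "tiso [m, r] [m, r] (elem_op 0 1 0 (- 1 :: 'k) [m, r])" by (rule elem_op_tiso) (use assms in auto)
      show "elem_op 0 1 0 (- 1) [m, r] (arcF m r v) = join_blocks 1 (pickF 2 m (take_blocks 1 v)) (pickF 0 r (drop_blocks 1 v))" for v :: "idx \<Rightarrow> 'k"
      proof (rule ext2)
        fix i j :: nat
        consider "i = 0" | "i = 1" | "2 \<le> i" by linarith
        then show "elem_op 0 1 0 (- 1) [m, r] (arcF m r v) (i, j) = join_blocks 1 (pickF 2 m (take_blocks 1 v)) (pickF 0 r (drop_blocks 1 v)) (i, j)"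
          by cases (use assms m in \<open>auto simp: elem_op_apply arcF_apply pickF_apply Bas_pair le_Suc_eq less_Suc_eq\<close>)
      qed
    qed
  qed
qed

lemma Bas_nth4: "(i, j) \<in> Bas [a, b, c, d] \<longleftrightarrow> i = 0 \<and> j < a \<or> i = 1 \<and> j < b \<or> i = 2 \<and> j < c \<or> i = 3 \<and> j < d"
  unfolding mem_Bas by (auto simp: less_Suc_eq numeral_2_eq_2 numeral_3_eq_3)

lemma Bas_nth3: "(i, j) \<in> Bas [a, b, c] \<longleftrightarrow> i = 0 \<and> j < a \<or> i = 1 \<and> j < b \<or> i = 2 \<and> j < c"
  unfolding mem_Bas by (auto simp: less_Suc_eq numeral_2_eq_2)

text \<open>Affine lines through the sums belonging to the left-hand sides of the moves (A), (C), (B), (D),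
  attained at \<open>t = 0\<close>; for \<open>t \<noteq> 0\<close> one gets the right-hand sides.\<close>

definition famA :: "'k::field \<Rightarrow> nat \<Rightarrow> nat \<Rightarrow> nat \<Rightarrow> nat \<Rightarrow> (idx \<Rightarrow> 'k) \<Rightarrow> idx \<Rightarrow> 'k" where
  "famA t m r n s v = (\<lambda>(i, j). if i = 0 \<and> j + 2 = m then v (0, 0) else if i = 0 \<and> j + 1 = m then v (0, 1)
     else if i = 1 \<and> j + 1 = r then v (0, 0) else if i = 2 \<and> j + 2 = n then v (1, 0)
     else if i = 2 \<and> j + 1 = n then v (1, 1) else if i = 3 \<and> j + 1 = s then t * v (0, 0) + v (1, 0) else 0)"

definition famC :: "'k::field \<Rightarrow> nat \<Rightarrow> nat \<Rightarrow> nat \<Rightarrow> nat \<Rightarrow> (idx \<Rightarrow> 'k) \<Rightarrow> idx \<Rightarrow> 'k" where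
  "famC t m r n s v = (\<lambda>(i, j). if i = 0 \<and> j + 2 = m then v (0, 0) else if i = 0 \<and> j + 1 = m then v (0, 1)
     else if i = 1 \<and> j + 1 = r then v (0, 0) + t * v (1, 1) else if i = 1 \<and> j + 2 = r then t * v (1, 0)
     else if i = 2 \<and> j + 2 = n then v (1, 0)
     else if i = 2 \<and> j + 1 = n then v (1, 1) else if i = 3 \<and> j + 1 = s then v (1, 0) else 0)"

definition famB :: "'k::field \<Rightarrow> nat \<Rightarrow> nat \<Rightarrow> nat \<Rightarrow> (idx \<Rightarrow> 'k) \<Rightarrow> idx \<Rightarrow> 'k" where
  "famB t m s r v = (\<lambda>(i, j). if i = 0 \<and> j + 2 = m then v (0, 0) else if i = 0 \<and> j + 1 = m then v (0, 1)
     else if i = 1 \<and> j + 1 = s then v (0, 0) + t * v (1, 0) else if i = 2 \<and> j + 1 = r then v (1, 0) else 0)"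

definition famD :: "'k::field \<Rightarrow> nat \<Rightarrow> nat \<Rightarrow> nat \<Rightarrow> (idx \<Rightarrow> 'k) \<Rightarrow> idx \<Rightarrow> 'k" where
  "famD t m s r v = (\<lambda>(i, j). if i = 0 \<and> j + 2 = m then v (0, 0) else if i = 0 \<and> j + 1 = m then v (0, 1)
     else if i = 1 \<and> j + 1 = s then v (0, 0) else if i = 2 \<and> j + 2 = r then t * v (0, 0)
     else if i = 2 \<and> j + 1 = r then v (1, 0) + t * v (0, 1) else 0)"

lemma famA_apply: "famA t m r n s v (i, j) = (if i = 0 \<and> j + 2 = m then v (0, 0) else if i = 0 \<and> j + 1 = m then v (0, 1)
     else if i = 1 \<and> j + 1 = r then v (0, 0) else if i = 2 \<and> j + 2 = n then v (1, 0)
     else if i = 2 \<and> j + 1 = n then v (1, 1) else if i = 3 \<and> j + 1 = s then t * v (0, 0) + v (1, 0) else 0)"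
  by (simp add: famA_def)

lemma famC_apply: "famC t m r n s v (i, j) = (if i = 0 \<and> j + 2 = m then v (0, 0) else if i = 0 \<and> j + 1 = m then v (0, 1)
     else if i = 1 \<and> j + 1 = r then v (0, 0) + t * v (1, 1) else if i = 1 \<and> j + 2 = r then t * v (1, 0)
     else if i = 2 \<and> j + 2 = n then v (1, 0)
     else if i = 2 \<and> j + 1 = n then v (1, 1) else if i = 3 \<and> j + 1 = s then v (1, 0) else 0)"
  by (simp add: famC_def)

lemma famB_apply: "famB t m s r v (i, j) = (if i = 0 \<and> j + 2 = m then v (0, 0) else if i = 0 \<and> j + 1 = m then v (0, 1)
     else if i = 1 \<and> j + 1 = s then v (0, 0) + t * v (1, 0) else if i = 2 \<and> j + 1 = r then v (1, 0) else 0)"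
  by (simp add: famB_def)

lemma famD_apply: "famD t m s r v (i, j) = (if i = 0 \<and> j + 2 = m then v (0, 0) else if i = 0 \<and> j + 1 = m then v (0, 1)
     else if i = 1 \<and> j + 1 = s then v (0, 0) else if i = 2 \<and> j + 2 = r then t * v (0, 0)
     else if i = 2 \<and> j + 1 = r then v (1, 0) + t * v (0, 1) else 0)"
  by (simp add: famD_def)

lemma famA_0: "([2, 2], [m, r, n, s], famA 0 m r n s) = fsum (arc_emb m r) (arc_emb n s)"
  by (auto simp: arc_emb_def intro!: ext ext2) (auto simp: famA_apply arcF_apply)

lemma famC_0: "([2, 2], [m, r, n, s], famC 0 m r n s) = fsum (arc_emb m r) (arc_emb n s)"
  by (auto simp: arc_emb_def intro!: ext ext2) (auto simp: famC_apply arcF_apply)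

lemma famB_0: "1 \<le> r \<Longrightarrow> ([2, 1], [m, s, r], famB 0 m s r) = fsum (arc_emb m s) (pole_emb r)"
  by (auto simp: arc_emb_def pole_emb_def intro!: ext ext2) (auto simp: famB_apply arcF_apply pickF_apply)

lemma famD_0: "1 \<le> r \<Longrightarrow> ([2, 1], [m, s, r], famD 0 m s r) = fsum (arc_emb m s) (pole_emb r)"
  by (auto simp: arc_emb_def pole_emb_def intro!: ext ext2) (auto simp: famD_apply arcF_apply pickF_apply)

lemma mult_inverse_cancel: "t \<noteq> 0 \<Longrightarrow> t * (inverse t * x) = (x :: 'k::field)"
  by (simp add: mult.assoc[symmetric])

lemma less4: "i < Suc (Suc (Suc (Suc 0))) \<longleftrightarrow> i = 0 \<or> i = 1 \<or> i = 2 \<or> i = (3::nat)"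
  by auto

text \<open>With the new source coordinate \<open>v0 + v1 / t\<close> the block of length
  \<open>s\<close> carries \<open>t\<close> times the first generator. Multiples of this block and
  of the block of length \<open>n\<close> then clear the mixed entries, leaving
  \<open>- v1 / t\<close> in the block of length \<open>r\<close>; the monomial map reorders and
  rescales. The embeddings \<open>T^(r-s)\<close> and \<open>T^(m-n)\<close> exist because
  \<open>s < r\<close> and \<open>n < m\<close>.\<close>

lemma famA_eqv:
  assumes "m > n" "n > r" "r > s" "1 \<le> s" "t \<noteq> 0"
  shows "eqv ([2, 2], [m, r, n, s], famA t m r n s) (fsum (arc_emb m s) (arc_emb n r))"
proof -
  let ?ys = "[m, r, n, s]"
  let ?p = "\<lambda>w. monomial_op [0, 3, 2, 1] [1, inverse t, 1, - t] [m, s, n, r] (elem_op 2 0 (m - n) (inverse t) ?ys (elem_op 3 1 (r - s) (- inverse t) ?ys w))"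
  have p1: "tiso ?ys ?ys (elem_op 3 1 (r - s) (- inverse t) ?ys)" by (rule elem_op_tiso) (use assms in auto)
  have p2: "tiso ?ys ?ys (elem_op 2 0 (m - n) (inverse t) ?ys)" by (rule elem_op_tiso) (use assms in auto)
  have p3: "tiso ?ys [m, s, n, r] (monomial_op [0, 3, 2, 1] [1, inverse t, 1, - t] [m, s, n, r])"
    by (rule monomial_op_tiso) (use assms in \<open>auto simp: less4\<close>)
  note p = tiso_comp[OF tiso_comp[OF p1 p2] p3]
  \<comment> \<open>The offsets \<open>d\<close> and \<open>e\<close> turn the truncated differences
    inside \<open>elem_op\<close> into plain indices.\<close>
  obtain d where d: "m = n + d" using assms(1) by (metis le_Suc_ex less_imp_le)
  obtain e where e: "r = s + e" using assms(3) by (metis le_Suc_ex less_imp_le)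
  show ?thesis unfolding arc_emb_def fsum.simps append.simps
  proof (rule eqvI[OF _ p])
    show "tiso [2, 2] [2, 2] (elem_op 1 0 0 (inverse t) [2, 2])" by (rule elem_op_tiso) auto
    show "?p (famA t m r n s v) =
       join_blocks (length [m, s]) (arcF m s (take_blocks (length [2]) (elem_op 1 0 0 (inverse t) [2, 2] v)))
         (arcF n r (drop_blocks (length [2]) (elem_op 1 0 0 (inverse t) [2, 2] v)))" for v
    proof (rule ext2)
      fix i j :: nat
      consider "i = 0" | "i = 1" | "i = 2" | "i = 3" | "4 \<le> i" by linarith
      then show "?p (famA t m r n s v) (i, j) =
       join_blocks (length [m, s]) (arcF m s (take_blocks (length [2]) (elem_op 1 0 0 (inverse t) [2, 2] v)))
         (arcF n r (drop_blocks (length [2]) (elem_op 1 0 0 (inverse t) [2, 2] v))) (i, j)"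
      proof cases
        case 1
        show ?thesis
        proof (cases "d \<le> j")
          case True
          then obtain j' where "j = d + j'" by (metis le_Suc_ex)
          then show ?thesis using assms 1 d e by (auto simp: monomial_op_apply elem_op_apply famA_apply arcF_apply Bas_nth4 Bas_pair algebra_simps mult_inverse_cancel)
        qed (use assms 1 d e in \<open>auto simp: monomial_op_apply elem_op_apply famA_apply arcF_apply Bas_nth4 Bas_pair algebra_simps\<close>)
      next
        case 2
        then show ?thesis using assms by (auto simp: monomial_op_apply elem_op_apply famA_apply arcF_apply Bas_nth4 Bas_pair algebra_simps mult_inverse_cancel)
      next
        case 3
        then show ?thesis using assms by (auto simp: monomial_op_apply elem_op_apply famA_apply arcF_apply Bas_nth4 Bas_pair algebra_simps mult_inverse_cancel)
      next
        case 4
        show ?thesis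
        proof (cases "e \<le> j")
          case True
          then obtain j' where "j = e + j'" by (metis le_Suc_ex)
          then show ?thesis using assms 4 d e by (auto simp: monomial_op_apply elem_op_apply famA_apply arcF_apply Bas_nth4 Bas_pair algebra_simps mult_inverse_cancel)
        qed (use assms 4 d e in \<open>auto simp: monomial_op_apply elem_op_apply famA_apply arcF_apply Bas_nth4 Bas_pair algebra_simps\<close>)
      next
        case 5
        then show ?thesis using assms by (auto simp: monomial_op_apply elem_op_apply famA_apply arcF_apply Bas_nth4 Bas_pair algebra_simps mult_inverse_cancel)
      qed
    qed
  qed
qed

text \<open>The perturbation makes the block of length \<open>r\<close> carry \<open>t\<close> times
  the second generator, changed by \<open>T / t\<close> times the first source generator. Clearing
  the block of length \<open>n\<close> with it leaves there only the socle term
  \<open>- v(0,0) / t\<close>, so the first generator now joins \<open>m\<close> and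
  \<open>n\<close>, the second \<open>r\<close> and \<open>s\<close>.\<close>

lemma famC_eqv:
  assumes "m > n" "n > r" "r > s" "1 \<le> s" "t \<noteq> 0"
  shows "eqv ([2, 2], [m, r, n, s], famC t m r n s) (fsum (arc_emb m n) (arc_emb r s))"
proof -
  let ?ys = "[m, r, n, s]"
  let ?p = "\<lambda>w. monomial_op [0, 2, 1, 3] [1, - t, inverse t, 1] [m, n, r, s] (elem_op 1 2 (n - r) (- inverse t) ?ys w)"
  have "tiso ?ys ?ys (elem_op 1 2 (n - r) (- inverse t) ?ys)" by (rule elem_op_tiso) (use assms in auto)
  moreover have "tiso ?ys [m, n, r, s] (monomial_op [0, 2, 1, 3] [1, - t, inverse t, 1] [m, n, r, s])"
    by (rule monomial_op_tiso) (use assms in \<open>auto simp: less4\<close>)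
  ultimately have p: "tiso ?ys [m, n, r, s] ?p" by (rule tiso_comp)
  obtain d where d: "n = r + d" using assms(2) by (metis le_Suc_ex less_imp_le)
  show ?thesis unfolding arc_emb_def fsum.simps append.simps
  proof (rule eqvI[OF _ p])
    show "tiso [2, 2] [2, 2] (elem_op 0 1 1 (inverse t) [2, 2])" by (rule elem_op_tiso) auto
    show "?p (famC t m r n s v) =
       join_blocks (length [m, n]) (arcF m n (take_blocks (length [2]) (elem_op 0 1 1 (inverse t) [2, 2] v)))
         (arcF r s (drop_blocks (length [2]) (elem_op 0 1 1 (inverse t) [2, 2] v)))" for v
    proof (rule ext2)
      fix i j :: nat
      consider "i = 0" | "i = 1" | "i = 2" | "i = 3" | "4 \<le> i" by linarith
      then show "?p (famC t m r n s v) (i, j) =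
       join_blocks (length [m, n]) (arcF m n (take_blocks (length [2]) (elem_op 0 1 1 (inverse t) [2, 2] v)))
         (arcF r s (drop_blocks (length [2]) (elem_op 0 1 1 (inverse t) [2, 2] v))) (i, j)"
      proof cases
        case 1
        then show ?thesis using assms by (auto simp: monomial_op_apply elem_op_apply famC_apply arcF_apply Bas_nth4 Bas_pair algebra_simps mult_inverse_cancel)
      next
        case 2
        show ?thesis
        proof (cases "d \<le> j")
          case True
          then obtain j' where "j = d + j'" by (metis le_Suc_ex)
          then show ?thesis using assms 2 d by (auto simp: monomial_op_apply elem_op_apply famC_apply arcF_apply Bas_nth4 Bas_pair algebra_simps mult_inverse_cancel)
        qed (use assms 2 d in \<open>auto simp: monomial_op_apply elem_op_apply famC_apply arcF_apply Bas_nth4 Bas_pair algebra_simps\<close>)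
      next
        case 3
        then show ?thesis using assms by (auto simp: monomial_op_apply elem_op_apply famC_apply arcF_apply Bas_nth4 Bas_pair algebra_simps mult_inverse_cancel)
      next
        case 4
        then show ?thesis using assms by (auto simp: monomial_op_apply elem_op_apply famC_apply arcF_apply Bas_nth4 Bas_pair algebra_simps mult_inverse_cancel)
      next
        case 5
        then show ?thesis using assms by (auto simp: monomial_op_apply elem_op_apply famC_apply arcF_apply Bas_nth4 Bas_pair algebra_simps mult_inverse_cancel)
      qed
    qed
  qed
qed

text \<open>The pole is moved to the block of length \<open>s\<close> by the source change
  \<open>v1 + v0 / t\<close>; clearing the longer block of length \<open>r\<close> leaves
  \<open>- v0 / t\<close> at its top, the short end of the new arc.\<close>

lemma famB_eqv:
  assumes "m > r" "r > s" "1 \<le> s" "t \<noteq> 0"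
  shows "eqv ([2, 1], [m, s, r], famB t m s r) (fsum (arc_emb m r) (pole_emb s))"
proof -
  let ?ys = "[m, s, r]"
  let ?p = "\<lambda>w. monomial_op [0, 2, 1] [1, - t, inverse t] [m, r, s] (elem_op 1 2 (r - s) (- inverse t) ?ys w)"
  have "tiso ?ys ?ys (elem_op 1 2 (r - s) (- inverse t) ?ys)" by (rule elem_op_tiso) (use assms in auto)
  moreover have "tiso ?ys [m, r, s] (monomial_op [0, 2, 1] [1, - t, inverse t] [m, r, s])"
    by (rule monomial_op_tiso) (use assms in \<open>auto simp: less_Suc_eq numeral_2_eq_2\<close>)
  ultimately have p: "tiso ?ys [m, r, s] ?p" by (rule tiso_comp)
  obtain d where d: "r = s + d" using assms(2) by (metis le_Suc_ex less_imp_le)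
  show ?thesis unfolding arc_emb_def pole_emb_def fsum.simps append.simps
  proof (rule eqvI[OF _ p])
    show "tiso [2, 1] [2, 1] (elem_op 0 1 0 (inverse t) [2, 1])" by (rule elem_op_tiso) auto
    show "?p (famB t m s r v) =
       join_blocks (length [m, r]) (arcF m r (take_blocks (length [2]) (elem_op 0 1 0 (inverse t) [2, 1] v)))
         (pickF 1 s (drop_blocks (length [2]) (elem_op 0 1 0 (inverse t) [2, 1] v)))" for v
    proof (rule ext2)
      fix i j :: nat
      consider "i = 0" | "i = 1" | "i = 2" | "3 \<le> i" by linarith
      then show "?p (famB t m s r v) (i, j) =
       join_blocks (length [m, r]) (arcF m r (take_blocks (length [2]) (elem_op 0 1 0 (inverse t) [2, 1] v)))
         (pickF 1 s (drop_blocks (length [2]) (elem_op 0 1 0 (inverse t) [2, 1] v))) (i, j)"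
      proof cases
        case 1
        then show ?thesis using assms by (auto simp: monomial_op_apply elem_op_apply famB_apply arcF_apply pickF_apply Bas_nth3 Bas_pair algebra_simps mult_inverse_cancel)
      next
        case 2
        show ?thesis
        proof (cases "d \<le> j")
          case True
          then obtain j' where "j = d + j'" by (metis le_Suc_ex)
          then show ?thesis using assms 2 d by (auto simp: monomial_op_apply elem_op_apply famB_apply arcF_apply pickF_apply Bas_nth3 Bas_pair algebra_simps mult_inverse_cancel)
        qed (use assms 2 d in \<open>auto simp: monomial_op_apply elem_op_apply famB_apply arcF_apply pickF_apply Bas_nth3 Bas_pair algebra_simps\<close>)
      next
        case 3
        then show ?thesis using assms by (auto simp: monomial_op_apply elem_op_apply famB_apply arcF_apply pickF_apply Bas_nth3 Bas_pair algebra_simps mult_inverse_cancel)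
      next
        case 4
        then show ?thesis using assms by (auto simp: monomial_op_apply elem_op_apply famB_apply arcF_apply pickF_apply Bas_nth3 Bas_pair algebra_simps mult_inverse_cancel)
      qed
    qed
  qed
qed

text \<open>The block of length \<open>r\<close> now contains \<open>t\<close> times the whole
  generator of \<open>N_(2)\<close>, up to adding the pole to its image under \<open>T\<close>. It
  clears the block of length \<open>m\<close> except for the top term \<open>- v(1,0) / t\<close>,
  which becomes the pole at \<open>m\<close>.\<close>

lemma famD_eqv:
  assumes "m > r" "r > s" "1 \<le> s" "t \<noteq> 0"
  shows "eqv ([2, 1], [m, s, r], famD t m s r) (fsum (arc_emb r s) (pole_emb m))"
proof -
  let ?ys = "[m, s, r]"
  let ?p = "\<lambda>w. monomial_op [2, 1, 0] [inverse t, 1, - t] [r, s, m] (elem_op 2 0 (m - r) (- inverse t) ?ys w)"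
  have "tiso ?ys ?ys (elem_op 2 0 (m - r) (- inverse t) ?ys)" by (rule elem_op_tiso) (use assms in auto)
  moreover have "tiso ?ys [r, s, m] (monomial_op [2, 1, 0] [inverse t, 1, - t] [r, s, m])"
    by (rule monomial_op_tiso) (use assms in \<open>auto simp: less_Suc_eq numeral_2_eq_2\<close>)
  ultimately have p: "tiso ?ys [r, s, m] ?p" by (rule tiso_comp)
  obtain d where d: "m = r + d" using assms(1) by (metis le_Suc_ex less_imp_le)
  show ?thesis unfolding arc_emb_def pole_emb_def fsum.simps append.simps
  proof (rule eqvI[OF _ p])
    show "tiso [2, 1] [2, 1] (elem_op 1 0 1 (inverse t) [2, 1])" by (rule elem_op_tiso) auto
    show "?p (famD t m s r v) =
       join_blocks (length [r, s]) (arcF r s (take_blocks (length [2]) (elem_op 1 0 1 (inverse t) [2, 1] v)))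
         (pickF 1 m (drop_blocks (length [2]) (elem_op 1 0 1 (inverse t) [2, 1] v)))" for v
    proof (rule ext2)
      fix i j :: nat
      consider "i = 0" | "i = 1" | "i = 2" | "3 \<le> i" by linarith
      then show "?p (famD t m s r v) (i, j) =
       join_blocks (length [r, s]) (arcF r s (take_blocks (length [2]) (elem_op 1 0 1 (inverse t) [2, 1] v)))
         (pickF 1 m (drop_blocks (length [2]) (elem_op 1 0 1 (inverse t) [2, 1] v))) (i, j)"
      proof cases
        case 1
        then show ?thesis using assms by (auto simp: monomial_op_apply elem_op_apply famD_apply arcF_apply pickF_apply Bas_nth3 Bas_pair algebra_simps mult_inverse_cancel)
      next
        case 2
        then show ?thesis using assms by (auto simp: monomial_op_apply elem_op_apply famD_apply arcF_apply pickF_apply Bas_nth3 Bas_pair algebra_simps mult_inverse_cancel)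
      next
        case 3
        show ?thesis
        proof (cases "d \<le> j")
          case True
          then obtain j' where "j = d + j'" by (metis le_Suc_ex)
          then show ?thesis using assms 3 d by (auto simp: monomial_op_apply elem_op_apply famD_apply arcF_apply pickF_apply Bas_nth3 Bas_pair algebra_simps mult_inverse_cancel)
        qed (use assms 3 d in \<open>auto simp: monomial_op_apply elem_op_apply famD_apply arcF_apply pickF_apply Bas_nth3 Bas_pair algebra_simps\<close>)
      next
        case 4
        then show ?thesis using assms by (auto simp: monomial_op_apply elem_op_apply famD_apply arcF_apply pickF_apply Bas_nth3 Bas_pair algebra_simps mult_inverse_cancel)
      qed
    qed
  qed
qed

section \<open>Degenerations along affine lines\<close>

lemma polyfun_subst:
  assumes "p \<in> polyfun" "\<And>b a. (\<lambda>X. S X b a) \<in> polyfun"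
  shows "(\<lambda>X. p (S X)) \<in> polyfun"
  using assms(1) by induction (use assms(2) in \<open>auto intro: pf_const pf_add pf_mult\<close>)

lemma orbit_trans:
  assumes "M \<in> Hom xs ys" "N \<in> orbit xs ys M" "L \<in> orbit xs ys N"
  shows "L \<in> orbit xs ys (M :: 'k::field mat)"
proof -
  have N: "N \<in> Hom xs ys" using orbit_Hom assms by blast
  show ?thesis using assms(2,3) unfolding orbit_iff[OF assms(1)] orbit_iff[OF N]
    using emb_iso_fun_trans by blast
qed

text \<open>Closure of orbits expressed by vanishing polynomials on the whole affine space. It is
  visibly transitive and does not mention the cokernel, so intermediate maps need not be checked to
  lie in \<open>Vset\<close>.\<close>

definition degen :: "nat list \<Rightarrow> nat list \<Rightarrow> 'k::field mat \<Rightarrow> 'k mat \<Rightarrow> bool" where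
  "degen as bs f g \<longleftrightarrow> (\<forall>p\<in>polyfun. (\<forall>M\<in>orbit as bs f. p M = 0) \<longrightarrow> (\<forall>M\<in>orbit as bs g. p M = 0))"

lemma degen_refl: "degen as bs f f" by (simp add: degen_def)

lemma degen_trans: "degen as bs f g \<Longrightarrow> degen as bs g h \<Longrightarrow> degen as bs f h"
  by (simp add: degen_def)

text \<open>It is enough to look at \<open>g\<close> itself: acting by a fixed pair of automorphisms
  is a polynomial substitution and preserves the orbit of \<open>f\<close>.\<close>

lemma degenI:
  assumes f: "f \<in> Hom as bs" and g: "g \<in> Hom as bs"
    and van: "\<And>p. p \<in> polyfun \<Longrightarrow> (\<And>M. M \<in> orbit as bs f \<Longrightarrow> p M = 0) \<Longrightarrow> p g = 0"
  shows "degen as bs f (g :: 'k::field mat)"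
  unfolding degen_def
proof (intro ballI impI)
  fix p M assume p: "p \<in> polyfun" and z: "\<forall>M\<in>orbit as bs f. p M = 0" and M: "M \<in> orbit as bs g"
  obtain A H where AH: "A \<in> Aut as" "H \<in> Aut bs" "M = mmul (Bas as) (mmul (Bas bs) H g) A"
    using M by (auto simp: orbit_def)
  let ?S = "\<lambda>X. mmul (Bas as) (mmul (Bas bs) H X) A"
  have "(\<lambda>X. p (?S X)) \<in> polyfun"
    by (rule polyfun_subst[OF p]) (unfold mmul_def, intro polyfun_sum pf_mult pf_coord pf_const)
  moreover have "p (?S N) = 0" if N: "N \<in> orbit as bs f" for N
  proof -
    have "?S N \<in> orbit as bs N" using AH unfolding orbit_def by blast
    then show ?thesis using orbit_trans[OF f N] z by blast
  qed
  ultimately show "p M = 0" unfolding AH(3) by (rule van)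
qed

text \<open>Over a finite field the product of all \<open>x - a\<close>, increased by
  \<open>1\<close>, would have no root.\<close>

lemma infinite_alg_closed: "infinite (UNIV :: 'k::alg_closed_field set)"
proof
  assume fin: "finite (UNIV :: 'k set)"
  define p :: "'k poly" where "p = (\<Prod>a\<in>UNIV. [:- a, 1:])"
  have r: "poly p x = 0" for x unfolding p_def poly_prod using fin by (intro prod_zero) auto
  have "degree p = card (UNIV :: 'k set)" unfolding p_def
    by (subst degree_prod_eq_sum_degree) auto
  then have d: "degree p > 0" using fin by (simp add: card_gt_0_iff)
  then have "degree (p + 1) > 0" by (simp add: degree_add_eq_left)
  then obtain x where "poly (p + 1) x = 0" using alg_closed_imp_poly_has_root by blast
  then show False using r[of x] by simp
qed

lemma polyfun_line:
  "p \<in> polyfun \<Longrightarrow> \<exists>P. \<forall>t. poly P t = p (\<lambda>b a. g b a + t * N b (a :: idx) :: 'k::field)"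
proof (induction rule: polyfun.induct)
  case (pf_const c)
  show ?case by (rule exI[of _ "[:c:]"]) simp
next
  case (pf_coord b a)
  show ?case by (rule exI[of _ "[:g b a, N b a:]"]) simp
next
  case (pf_add p q)
  then obtain P Q where "\<forall>t. poly P t = p (\<lambda>b a. g b a + t * N b a)" "\<forall>t. poly Q t = q (\<lambda>b a. g b a + t * N b a)" by blast
  then show ?case by (intro exI[of _ "P + Q"]) simp
next
  case (pf_mult p q)
  then obtain P Q where "\<forall>t. poly P t = p (\<lambda>b a. g b a + t * N b a)" "\<forall>t. poly Q t = q (\<lambda>b a. g b a + t * N b a)" by blast
  then show ?case by (intro exI[of _ "P * Q"]) simp
qed

lemma line_vanish:
  fixes g N :: "'k::alg_closed_field mat"
  assumes p: "p \<in> polyfun" and z: "\<And>t. t \<noteq> 0 \<Longrightarrow> p (\<lambda>b a. g b a + t * N b a) = 0"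
  shows "p g = 0"
proof -
  obtain P where P: "\<And>t. poly P t = p (\<lambda>b a. g b a + t * N b a)" using polyfun_line[OF p] by blast
  have "UNIV - {0} \<subseteq> {t. poly P t = 0}" using P z by auto
  moreover have "infinite (UNIV - {0 :: 'k})" using infinite_alg_closed by simp
  ultimately have "infinite {t. poly P t = 0}" using finite_subset by blast
  then have "P = 0" using poly_roots_finite by blast
  then show ?thesis using P[of 0] by simp
qed

text \<open>The family is transported along the isomorphism at \<open>t = 0\<close> to an affine
  line through \<open>g\<close> in \<open>Hom as bs\<close>. All its points with
  \<open>t \<noteq> 0\<close> are isomorphic to \<open>Y\<close> plus \<open>R\<close>, hence lie in
  one orbit, represented by the point at \<open>t = 1\<close>; a polynomial vanishing on that orbit
  vanishes at all but one parameter and therefore also at \<open>g\<close>.\<close>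

lemma family_degen:
  fixes g :: "'k::alg_closed_field mat"
  assumes g: "g \<in> Hom as bs" and tg: "thom as bs (mv (Bas as) g)"
    and e: "eqv (as, bs, mv (Bas as) g) (fsum (xs, ys, fam 0) R)" and R: "hemb R"
    and fam: "\<And>t v. fam t v = fam 0 v + vscale t (fam 1 v - fam 0 v)"
    and h: "\<And>t. hemb (xs, ys, fam t)"
    and Y: "\<And>t. t \<noteq> 0 \<Longrightarrow> eqv (xs, ys, fam t) Y"
  shows "\<exists>f. f \<in> Hom as bs \<and> thom as bs (mv (Bas as) f) \<and> eqv (as, bs, mv (Bas as) f) (fsum Y R) \<and> degen as bs f g"
proof -
  obtain xr yr FR where R': "R = (xr, yr, FR)" by (metis prod.exhaust)
  let ?G = "\<lambda>t v. join_blocks (length ys) (fam t (take_blocks (length xs) v)) (FR (drop_blocks (length xs) v))"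
  obtain \<phi> \<psi> where 1: "tiso as (xs @ xr) \<phi>" "tiso bs (ys @ yr) \<psi>" "\<And>v. v \<in> VS as \<Longrightarrow> \<psi> (mv (Bas as) g v) = ?G 0 (\<phi> v)"
    using e unfolding R' fsum.simps eqv.simps emb_iso_fun_def by blast
  obtain \<psi>' where q: "tiso (ys @ yr) bs \<psi>'" "\<And>v. v \<in> VS bs \<Longrightarrow> \<psi>' (\<psi> v) = v" "\<And>w. w \<in> VS (ys @ yr) \<Longrightarrow> \<psi> (\<psi>' w) = w"
    using tiso_inverse[OF 1(2)] by blast
  have l: "lin \<phi>" "lin \<psi>'" "\<And>v. v \<in> VS as \<Longrightarrow> \<phi> v \<in> VS (xs @ xr)" "\<And>w. w \<in> VS (ys @ yr) \<Longrightarrow> \<psi>' w \<in> VS bs"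
    using 1(1) q(1) by (auto simp: tiso_def thom_def)
  have tG: "thom (xs @ xr) (ys @ yr) (?G t)" for t
    using thom_fsum[OF h[of t] R] by (simp add: R')
  have tGt: "thom as bs (\<lambda>v. \<psi>' (?G t (\<phi> v)))" for t
    by (rule thom_comp[OF thom_comp[OF _ tG]]) (use 1(1) q(1) in \<open>auto simp: tiso_def\<close>)
  \<comment> \<open>The direction of the line, read off from the parameters \<open>1\<close> and
    \<open>0\<close> because the family is affine in \<open>t\<close>.\<close>
  define N where "N = (\<lambda>v. \<psi>' (?G 1 (\<phi> v)) - \<psi>' (?G 0 (\<phi> v)))"
  have lN: "lin N" unfolding N_def using tGt[of 1] tGt[of 0] by (intro fvv.linear_compose_sub) (auto simp: thom_def)
  have NV: "N v \<in> VS bs" if "v \<in> VS as" for v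
    unfolding N_def using tGt[of 1] tGt[of 0] that by (intro fv.subspace_diff[OF subspace_coord_space]) (auto simp: thom_def)
  define NM where "NM = mat_of as N"
  have NM: "NM \<in> Hom as bs" unfolding NM_def by (rule mat_of_Hom) (rule NV)
  let ?g = "\<lambda>t. (\<lambda>b a. g b a + t * NM b a)"
  have gH: "?g t \<in> Hom as bs" for t by (rule HomI) (simp add: HomD[OF g] HomD[OF NM])
  have mg: "mv (Bas as) (?g t) v = \<psi>' (?G t (\<phi> v))" if v: "v \<in> VS as" for t v
  proof -
    have "mv (Bas as) (?g t) v = mv (Bas as) g v + vscale t (mv (Bas as) NM v)"
      by (rule ext) (simp add: mv_def algebra_simps sum.distrib sum_distrib_left)
    also have "mv (Bas as) NM v = N v" unfolding NM_def by (rule mv_mat_of[OF lN v])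
    also have "mv (Bas as) g v = \<psi>' (?G 0 (\<phi> v))" using 1(3)[OF v] q(2)[OF mv_VS[OF g]] by metis
    also have "\<psi>' (?G 0 (\<phi> v)) + vscale t (N v) = \<psi>' (?G 0 (\<phi> v) + vscale t (?G 1 (\<phi> v) - ?G 0 (\<phi> v)))"
      unfolding N_def lin_add[OF l(2)] lin_vscale[OF l(2)] lin_diff[OF l(2)] ..
    also have "?G 0 (\<phi> v) + vscale t (?G 1 (\<phi> v) - ?G 0 (\<phi> v)) = ?G t (\<phi> v)"
      by (rule ext2) (subst (3) fam, simp)
    finally show ?thesis .
  qed
  have tg': "thom as bs (mv (Bas as) (?g t))" for t
    using tGt[of t] mg by (simp add: thom_def lin_mv)
  have Gw: "?G t w \<in> VS (ys @ yr)" if "w \<in> VS (xs @ xr)" for t w using tG[of t] that by (simp add: thom_def)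
  have eG: "eqv (as, bs, mv (Bas as) (?g t)) (fsum (xs, ys, fam t) R)" for t
    unfolding R' fsum.simps
    by (rule eqvI[OF 1(1,2)]) (use mg q(3)[OF Gw] l(3) in simp)
  have eY: "eqv (as, bs, mv (Bas as) (?g t)) (fsum Y R)" if "t \<noteq> 0" for t
    using eqv_trans[OF eG eqv_fsum[OF Y[OF that] eqv_refl h R]] .
  have "degen as bs (?g 1) g"
  proof (rule degenI[OF gH g])
    fix p assume p: "p \<in> polyfun" and z: "\<And>M. M \<in> orbit as bs (?g 1) \<Longrightarrow> p M = 0"
    show "p g = 0"
    proof (rule line_vanish[OF p])
      fix t :: 'k assume t: "t \<noteq> 0"
      have "eqv (fsum Y R) (as, bs, mv (Bas as) (?g t))" by (rule eqv_sym[OF eY[OF t]]) (simp add: tg')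
      then have "eqv (as, bs, mv (Bas as) (?g 1)) (as, bs, mv (Bas as) (?g t))"
        by (rule eqv_trans[OF eY[OF one_neq_zero]])
      then have "?g t \<in> orbit as bs (?g 1)" unfolding orbit_iff[OF gH] using gH by simp
      then show "p (?g t) = 0" by (rule z)
    qed
  qed
  then show ?thesis using gH[of 1] tg'[of 1] eY[of 1] by (intro exI[of _ "?g 1"]) simp
qed

lemma hemb_arc_emb: "1 \<le> r \<Longrightarrow> 2 \<le> m \<Longrightarrow> hemb (arc_emb m r)"
  by (simp add: arc_emb_def thom_arcF)

lemma hemb_pole_emb: "1 \<le> m \<Longrightarrow> hemb (pole_emb m)"
  by (simp add: pole_emb_def thom_pickF)

lemma Bas_22: "(i, j) \<in> Bas [2, 2] \<longleftrightarrow> (i = 0 \<or> i = 1) \<and> (j = 0 \<or> j = 1)"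
  by (auto simp: Bas_pair)

lemma Bas_21: "(i, j) \<in> Bas [2, Suc 0] \<longleftrightarrow> i = 0 \<and> (j = 0 \<or> j = 1) \<or> i = 1 \<and> j = 0"
  by (auto simp: Bas_pair)

lemma hemb_famA: "m > n \<Longrightarrow> n > r \<Longrightarrow> r > s \<Longrightarrow> 1 \<le> s \<Longrightarrow> hemb ([2, 2], [m, r, n, s], famA t m r n s)"
  unfolding hemb.simps thom_def
proof (intro conjI ballI)
  assume a: "m > n" "n > r" "r > s" "1 \<le> s"
  show "lin (famA t m r n s)" by (rule linI; rule ext2) (auto simp: famA_apply algebra_simps)
  fix v :: "idx \<Rightarrow> 'a"
  show "famA t m r n s v \<in> VS [m, r, n, s]"
    by (rule VS_I2) (use a in \<open>auto simp: famA_apply Bas_nth4\<close>)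
  show "famA t m r n s (tshift [2, 2] v) = tshift [m, r, n, s] (famA t m r n s v)"
  proof (rule ext2)
    fix i j :: nat
    consider "i = 0" | "i = 1" | "i = 2" | "i = 3" | "4 \<le> i" by linarith
    then show "famA t m r n s (tshift [2, 2] v) (i, j) = tshift [m, r, n, s] (famA t m r n s v) (i, j)"
      by cases (use a in \<open>auto simp: famA_apply tshift_apply Bas_nth4 Bas_22\<close>)
  qed
qed

lemma hemb_famC: "m > n \<Longrightarrow> n > r \<Longrightarrow> r > s \<Longrightarrow> 1 \<le> s \<Longrightarrow> hemb ([2, 2], [m, r, n, s], famC t m r n s)"
  unfolding hemb.simps thom_def
proof (intro conjI ballI)
  assume a: "m > n" "n > r" "r > s" "1 \<le> s"
  show "lin (famC t m r n s)" by (rule linI; rule ext2) (auto simp: famC_apply algebra_simps)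
  fix v :: "idx \<Rightarrow> 'a"
  show "famC t m r n s v \<in> VS [m, r, n, s]"
  proof (rule VS_I2)
    fix i j :: nat assume o: "(i, j) \<notin> Bas [m, r, n, s]"
    consider "i = 0" | "i = 1" | "i = 2" | "i = 3" | "4 \<le> i" by linarith
    then show "famC t m r n s v (i, j) = 0" by cases (use a o in \<open>simp_all add: famC_apply Bas_nth4\<close>)
  qed
  show "famC t m r n s (tshift [2, 2] v) = tshift [m, r, n, s] (famC t m r n s v)"
  proof (rule ext2)
    fix i j :: nat
    consider "i = 0" | "i = 1" | "i = 2" | "i = 3" | "4 \<le> i" by linarith
    then show "famC t m r n s (tshift [2, 2] v) (i, j) = tshift [m, r, n, s] (famC t m r n s v) (i, j)"
    proof cases
      case 2
      then show ?thesis using a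
        by (cases j) (simp_all add: famC_apply tshift_apply Bas_nth4 Bas_22)
    qed (use a in \<open>auto simp: famC_apply tshift_apply Bas_nth4 Bas_22\<close>)
  qed
qed

lemma hemb_famB: "m > r \<Longrightarrow> r > s \<Longrightarrow> 1 \<le> s \<Longrightarrow> hemb ([2, 1], [m, s, r], famB t m s r)"
  unfolding hemb.simps thom_def
proof (intro conjI ballI)
  assume a: "m > r" "r > s" "1 \<le> s"
  show "lin (famB t m s r)" by (rule linI; rule ext2) (auto simp: famB_apply algebra_simps)
  fix v :: "idx \<Rightarrow> 'a"
  show "famB t m s r v \<in> VS [m, s, r]"
    by (rule VS_I2) (use a in \<open>auto simp: famB_apply Bas_nth3\<close>)
  show "famB t m s r (tshift [2, 1] v) = tshift [m, s, r] (famB t m s r v)"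
    by (rule ext2) (use a in \<open>auto simp: famB_apply tshift_apply Bas_nth3 Bas_21\<close>)
qed

lemma hemb_famD: "m > r \<Longrightarrow> r > s \<Longrightarrow> 1 \<le> s \<Longrightarrow> hemb ([2, 1], [m, s, r], famD t m s r)"
  unfolding hemb.simps thom_def
proof (intro conjI ballI)
  assume a: "m > r" "r > s" "1 \<le> s"
  show "lin (famD t m s r)" by (rule linI; rule ext2) (auto simp: famD_apply algebra_simps)
  fix v :: "idx \<Rightarrow> 'a"
  show "famD t m s r v \<in> VS [m, s, r]"
    by (rule VS_I2) (use a in \<open>auto simp: famD_apply Bas_nth3\<close>)
  show "famD t m s r (tshift [2, 1] v) = tshift [m, s, r] (famD t m s r v)"
    by (rule ext2) (use a in \<open>auto simp: famD_apply tshift_apply Bas_nth3 Bas_21\<close>)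
qed

lemma summand_of_item:
  assumes "x \<in># diag ss" "list_all valid_summand ss"
  shows "\<exists>ts. mset ss = mset (item_summand x # ts) \<and> diag ss = add_mset x (diag ts)"
  using assms
proof (induction ss)
  case (Cons s ss)
  show ?case
  proof (cases "x \<in># diag ss")
    case True
    then obtain ts where "mset ss = mset (item_summand x # ts)" "diag ss = add_mset x (diag ts)" using Cons by auto
    then show ?thesis by (intro exI[of _ "s # ts"]) (simp add: add_mset_commute)
  next
    case False
    then have "x \<in># summand_diag s" using Cons.prems by simp
    then have "summand_diag s = {#x#} \<and> item_summand x = s" using Cons.prems(2) by (cases s) (auto split: if_splits)
    then show ?thesis by (intro exI[of _ ss]) simp
  qed
qed simp

lemma two_items:
  assumes d: "diag ss = D0 + {#x, y#}" and v: "list_all valid_summand ss"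
  shows "\<exists>ts. mset ss = mset (item_summand x # item_summand y # ts) \<and> D0 = diag ts \<and> list_all valid_summand ts \<and>
    valid_summand (item_summand x) \<and> valid_summand (item_summand y) \<and> valid_item x \<and> valid_item y"
proof -
  have "x \<in># diag ss" using d by simp
  then obtain t1 where t1: "mset ss = mset (item_summand x # t1)" "diag ss = add_mset x (diag t1)"
    using summand_of_item v by blast
  have sv: "s \<in># mset ss \<Longrightarrow> valid_summand s" for s using v by (simp add: list_all_iff)
  have v1: "list_all valid_summand t1" using sv t1(1) by (auto simp: list_all_iff)
  have "diag t1 = add_mset y D0" using t1(2) d by (simp add: add_mset_commute)
  then obtain ts where ts: "mset t1 = mset (item_summand y # ts)" "diag t1 = add_mset y (diag ts)"
    using summand_of_item[OF _ v1, of y] by auto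
  have v2: "list_all valid_summand ts" using v1 mset_eq_setD[OF ts(1)] by (simp add: list_all_iff)
  have "mset ss = mset (item_summand x # item_summand y # ts)" using t1(1) ts(1) by simp
  moreover have "D0 = diag ts" using ts(2) \<open>diag t1 = add_mset y D0\<close> by simp
  moreover have "valid_item x" "valid_item y" using valid_diag[OF v] d by simp_all
  moreover have "valid_summand (item_summand x)" "valid_summand (item_summand y)"
    using sv calculation(1) by simp_all
  ultimately show ?thesis using v2 by blast
qed

lemma fsum_list_pole: "1 \<le> r \<Longrightarrow> fsum_list [Picket 1 r] = pole_emb r"
  using fsum_list_picket[of 1 r] by (simp add: pole_emb_def)

lemma famA_affine: "famA t m r n s v = famA 0 m r n s v + vscale t (famA 1 m r n s v - famA 0 m r n s v)"
  by (rule ext2) (simp add: famA_apply)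

lemma famC_affine: "famC t m r n s v = famC 0 m r n s v + vscale t (famC 1 m r n s v - famC 0 m r n s v)"
  by (rule ext2) (simp add: famC_apply)

lemma famB_affine: "famB t m s r v = famB 0 m s r v + vscale t (famB 1 m s r v - famB 0 m s r v)"
  by (rule ext2) (simp add: famB_apply)

lemma famD_affine: "famD t m s r v = famD 0 m s r v + vscale t (famD 1 m s r v - famD 0 m s r v)"
  by (rule ext2) (simp add: famD_apply)

lemma eqv_fsum_fsum_list:
  fixes X Y :: "'k::field femb"
  assumes "eqv X (fsum_list a)" "eqv Y (fsum_list b)" "hemb X" "hemb Y" "hemb (fsum_list c :: 'k femb)"
  shows "eqv (fsum (fsum X Y) (fsum_list c)) (fsum_list (a @ b @ c))"
  unfolding fsum_list_append fsum_assoc[symmetric] by (intro eqv_fsum eqv_refl thom_fsum assms)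

text \<open>The two summands of the move are brought to the front by a permutation, the family acts
  on them, and the remaining summands are carried along unchanged.\<close>

lemma move_lift:
  fixes g :: "'k::alg_closed_field mat"
  assumes g: "g \<in> Hom as bs" "thom as bs (mv (Bas as) g)" and v: "list_all valid_summand ss"
    and e: "eqv (as, bs, mv (Bas as) g) (fsum_list ss)" and move: "arc_move (diag ss) D"
  shows "\<exists>f ts. f \<in> Hom as bs \<and> thom as bs (mv (Bas as) f) \<and> list_all valid_summand ts \<and>
    eqv (as, bs, mv (Bas as) f) (fsum_list ts) \<and> diag ts = D \<and> degen as bs f g"
proof -
  have main: ?thesis
    if blk: "mset ss = mset (s1 # s2 # rest)" "list_all valid_summand rest" "fsum_list [s1] = X1" "fsum_list [s2] = X2"
      and fam: "(xs, ys, fam 0) = fsum X1 X2" "\<And>t v. fam t v = fam 0 v + vscale t (fam 1 v - fam 0 v)"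
        "\<And>t. hemb (xs, ys, fam t)" "\<And>t. t \<noteq> 0 \<Longrightarrow> eqv (xs, ys, fam t) (fsum Y1 Y2)"
      and Y: "eqv Y1 (fsum_list a)" "eqv Y2 (fsum_list b)" "hemb Y1" "hemb Y2" "list_all valid_summand a" "list_all valid_summand b"
      and D: "diag a + diag b + diag rest = D"
    for s1 s2 rest X1 X2 xs ys a b and fam :: "'k \<Rightarrow> (idx \<Rightarrow> 'k) \<Rightarrow> idx \<Rightarrow> 'k" and Y1 Y2 :: "'k femb"
  proof -
    have hr: "hemb (fsum_list rest :: 'k femb)" by (rule hemb_fsum_list[OF blk(2)])
    have "fsum_list (s1 # s2 # rest) = fsum (fsum_list [s1]) (fsum (fsum_list [s2]) (fsum_list rest :: 'k femb))"
      using fsum_list_append[of "[s1]" "s2 # rest", where 'a = 'k] fsum_list_append[of "[s2]" rest, where 'a = 'k] by simp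
    then have "eqv (as, bs, mv (Bas as) g) (fsum (xs, ys, fam 0) (fsum_list rest))"
      using eqv_trans[OF e eqv_perm[OF blk(1) v]] unfolding blk fam(1) fsum_assoc by simp
    then obtain f where f: "f \<in> Hom as bs" "thom as bs (mv (Bas as) f)"
      "eqv (as, bs, mv (Bas as) f) (fsum (fsum Y1 Y2) (fsum_list rest))" "degen as bs f g"
      using family_degen[OF g _ hr fam(2-4)] by blast
    have "eqv (as, bs, mv (Bas as) f) (fsum_list (a @ b @ rest))"
      by (rule eqv_trans[OF f(3) eqv_fsum_fsum_list[OF Y(1-4) hr]])
    moreover have "diag (a @ b @ rest) = D" unfolding D[symmetric] by (simp add: diag_def)
    moreover have "list_all valid_summand (a @ b @ rest)" using Y blk by simp
    ultimately show ?thesis using f by blast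
  qed
  show ?thesis using move
  proof cases
    case (moveA m n r s E)
    obtain rest where r: "mset ss = mset (item_summand (Arc m r) # item_summand (Arc n s) # rest)" "E = diag rest"
      "list_all valid_summand rest" "valid_item (Arc n s)"
      using two_items[OF moveA(1) v] by blast
    have s: "1 \<le> s" using r(4) by simp
    \<comment> \<open>Both arcs of a crossing pair contain another end point strictly inside, so
      their summands are honest bipickets; only the new arcs may have length one.\<close>
    have b: "1 \<le> r" "2 \<le> m" "r + 2 \<le> m" "2 \<le> n" "s + 2 \<le> n" "s < m" "r < n" using moveA s by auto
    show ?thesis
      by (rule main[OF r(1,3) _ _ famA_0[where m = m and r = r and n = n and s = s] famA_affine[where m = m and r = r and n = n and s = s] hemb_famA[where m = m and r = r and n = n and s = s] famA_eqv[where m = m and r = r and n = n and s = s] arc_summand_eqv(1)[where m = m and r = s] arc_summand_eqv(1)[where m = n and r = r]])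
         (use moveA s b r(2) in \<open>auto simp: fsum_list_bipicket hemb_arc_emb arc_summand_eqv\<close>)
  next
    case (moveC m n r s E)
    obtain rest where r: "mset ss = mset (item_summand (Arc m r) # item_summand (Arc n s) # rest)" "E = diag rest"
      "list_all valid_summand rest" "valid_item (Arc n s)"
      using two_items[OF moveC(1) v] by blast
    have s: "1 \<le> s" using r(4) by simp
    have b: "1 \<le> r" "2 \<le> m" "r + 2 \<le> m" "2 \<le> n" "s + 2 \<le> n" "s < r" "n < m" "1 \<le> n" "2 \<le> r" using moveC s by auto
    show ?thesis
      by (rule main[OF r(1,3) _ _ famC_0[where m = m and r = r and n = n and s = s] famC_affine[where m = m and r = r and n = n and s = s] hemb_famC[where m = m and r = r and n = n and s = s] famC_eqv[where m = m and r = r and n = n and s = s] arc_summand_eqv(1)[where m = m and r = n] arc_summand_eqv(1)[where m = r and r = s]])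
         (use moveC s b r(2) in \<open>auto simp: fsum_list_bipicket hemb_arc_emb arc_summand_eqv\<close>)
  next
    case (moveB m r s E)
    obtain rest where r: "mset ss = mset (item_summand (Arc m s) # item_summand (Pole r) # rest)" "E = diag rest"
      "list_all valid_summand rest" "valid_item (Arc m s)"
      using two_items[OF moveB(1) v] by blast
    have s: "1 \<le> s" using r(4) by simp
    have b: "1 \<le> r" "2 \<le> m" "s + 2 \<le> m" "r < m" using moveB s by auto
    have p: "eqv (pole_emb s :: 'k femb) (fsum_list [Picket 1 s])" using fsum_list_pole[OF s, where 'a = 'k] eqv_refl by metis
    show ?thesis
      by (rule main[OF r(1,3) _ _ famB_0[where m = m and r = r and s = s] famB_affine[where m = m and r = r and s = s] hemb_famB[where m = m and r = r and s = s] famB_eqv[where m = m and r = r and s = s] arc_summand_eqv(1)[where m = m and r = r] p])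
         (use moveB s b r(2) in \<open>auto simp: fsum_list_bipicket fsum_list_pole[simplified] hemb_arc_emb hemb_pole_emb arc_summand_eqv\<close>)
  next
    case (moveD m r s E)
    obtain rest where r: "mset ss = mset (item_summand (Arc m s) # item_summand (Pole r) # rest)" "E = diag rest"
      "list_all valid_summand rest" "valid_item (Arc m s)"
      using two_items[OF moveD(1) v] by blast
    have s: "1 \<le> s" using r(4) by simp
    have b: "1 \<le> r" "2 \<le> m" "s + 2 \<le> m" "r < m" "1 \<le> m" "2 \<le> r" using moveD s by auto
    have p: "eqv (pole_emb m :: 'k femb) (fsum_list [Picket 1 m])" using fsum_list_pole[OF b(5), where 'a = 'k] eqv_refl by metis
    show ?thesis
      by (rule main[OF r(1,3) _ _ famD_0[where m = m and r = r and s = s] famD_affine[where m = m and r = r and s = s] hemb_famD[where m = m and r = r and s = s] famD_eqv[where m = m and r = r and s = s] arc_summand_eqv(1)[where m = r and r = s] p])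
         (use moveD s b r(2) in \<open>auto simp: fsum_list_bipicket fsum_list_pole[simplified] hemb_arc_emb hemb_pole_emb arc_summand_eqv\<close>)
  qed
qed

subsection \<open>Orbits and the Zariski topology\<close>

text \<open>On the diagonal the socle part is absorbed, which leaves the image of
  \<open>T^q\<close>.\<close>

lemma Wsub_image: "Wsub q q ys = (tshift ys ^^ q) ` VS ys"
proof (intro equalityI subsetI)
  fix w :: "idx \<Rightarrow> 'a" assume "w \<in> Wsub q q ys"
  then obtain u z where uz: "u \<in> VS ys" "z \<in> VS ys" "w = (tshift ys ^^ q) u + (tshift ys ^^ q) z"
    unfolding Wsub_iff by blast
  have "w = (tshift ys ^^ q) (u + z)" unfolding uz(3) by (rule lin_add[OF lin_pow[OF lin_tshift], symmetric])
  then show "w \<in> (tshift ys ^^ q) ` VS ys" using fv.subspace_add[OF subspace_coord_space uz(1,2)] by blast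
next
  fix w :: "idx \<Rightarrow> 'a" assume "w \<in> (tshift ys ^^ q) ` VS ys"
  then obtain u where u: "u \<in> VS ys" "w = (tshift ys ^^ q) u" by blast
  have z: "(0 :: idx \<Rightarrow> 'a) \<in> VS ys" by (rule fv.subspace_0[OF subspace_coord_space])
  have "w = (tshift ys ^^ q) u + (tshift ys ^^ q) 0" using u(2) lin_0[OF lin_pow[OF lin_tshift[of ys]], of q] by simp
  moreover have "(tshift ys ^^ Suc q) (0 :: idx \<Rightarrow> 'a) = 0" by (rule lin_0[OF lin_pow[OF lin_tshift]])
  ultimately show "w \<in> Wsub q q ys" unfolding Wsub_iff using u(1) z by blast
qed

section \<open>Cokernels and the invariants fixed by them\<close>

definition coker_fun :: "nat list \<Rightarrow> nat list \<Rightarrow> nat list \<Rightarrow> ((idx \<Rightarrow> 'k::field) \<Rightarrow> idx \<Rightarrow> 'k) \<Rightarrow> bool" where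
  "coker_fun as bs gs F \<longleftrightarrow> (\<exists>P. thom bs gs P \<and> P ` VS bs = VS gs \<and> (\<forall>w\<in>VS bs. P w = 0 \<longleftrightarrow> w \<in> F ` VS as))"

lemma VS_eq_iff: "u \<in> VS xs \<Longrightarrow> w \<in> VS xs \<Longrightarrow> u = w \<longleftrightarrow> (\<forall>a\<in>Bas xs. u a = w a)"
proof (intro iffI ext)
  fix a assume "u \<in> VS xs" "w \<in> VS xs" "\<forall>a\<in>Bas xs. u a = w a"
  then show "u a = w a" using VS_D[of u xs a] VS_D[of w xs a] by (cases "a \<in> Bas xs") simp_all
qed simp

lemma coker_iso_iff:
  assumes M: "M \<in> Hom as bs"
  shows "coker_iso as bs gs M \<longleftrightarrow> coker_fun as bs gs (mv (Bas as) (M :: 'k::field mat))"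
proof -
  have z: "(0 :: idx \<Rightarrow> 'k) \<in> VS xs" for xs by (rule fv.subspace_0[OF subspace_coord_space])
  have body: "((\<forall>u. vec_on (Bas gs) u \<longrightarrow> (\<exists>w. vec_on (Bas bs) w \<and> (\<forall>c\<in>Bas gs. mv (Bas bs) P w c = u c))) \<and>
        (\<forall>w. vec_on (Bas bs) w \<longrightarrow> ((\<forall>c\<in>Bas gs. mv (Bas bs) P w c = 0) \<longleftrightarrow>
              (\<exists>v. vec_on (Bas as) v \<and> (\<forall>b\<in>Bas bs. w b = mv (Bas as) M v b))))) \<longleftrightarrow>
     mv (Bas bs) P ` VS bs = VS gs \<and> (\<forall>w\<in>VS bs. mv (Bas bs) P w = 0 \<longleftrightarrow> w \<in> mv (Bas as) M ` VS as)"
    if P: "P \<in> Hom bs gs" for P :: "'k mat"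
  proof -
    have sub: "mv (Bas bs) P ` VS bs \<subseteq> VS gs" using mv_VS[OF P] by blast
    have 1: "(\<exists>w. vec_on (Bas bs) w \<and> (\<forall>c\<in>Bas gs. mv (Bas bs) P w c = u c)) \<longleftrightarrow> u \<in> mv (Bas bs) P ` VS bs"
      if "u \<in> VS gs" for u
      unfolding vec_on_VS image_iff Bex_def using VS_eq_iff[OF that mv_VS[OF P]] by (metis (no_types))
    have "(\<forall>u. vec_on (Bas gs) u \<longrightarrow> (\<exists>w. vec_on (Bas bs) w \<and> (\<forall>c\<in>Bas gs. mv (Bas bs) P w c = u c))) \<longleftrightarrow>
      (\<forall>u\<in>VS gs. u \<in> mv (Bas bs) P ` VS bs)"
      unfolding vec_on_VS[of gs] Ball_def[of "VS gs"] by (intro all_cong1 imp_cong refl 1)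
    also have "\<dots> \<longleftrightarrow> mv (Bas bs) P ` VS bs = VS gs" using sub by (simp only: subset_iff[symmetric] Ball_def set_eq_subset) simp
    finally have A: "(\<forall>u. vec_on (Bas gs) u \<longrightarrow> (\<exists>w. vec_on (Bas bs) w \<and> (\<forall>c\<in>Bas gs. mv (Bas bs) P w c = u c))) \<longleftrightarrow>
      mv (Bas bs) P ` VS bs = VS gs" .
    have 2: "(\<forall>c\<in>Bas gs. mv (Bas bs) P w c = 0) \<longleftrightarrow> mv (Bas bs) P w = 0" for w
      using VS_eq_iff[OF mv_VS[OF P, of w] z] by simp
    have 3: "(\<exists>v. vec_on (Bas as) v \<and> (\<forall>b\<in>Bas bs. w b = mv (Bas as) M v b)) \<longleftrightarrow> w \<in> mv (Bas as) M ` VS as"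
      if "w \<in> VS bs" for w
      unfolding vec_on_VS image_iff Bex_def using VS_eq_iff[OF that mv_VS[OF M]] by (metis (no_types))
    have "(\<forall>w. vec_on (Bas bs) w \<longrightarrow> ((\<forall>c\<in>Bas gs. mv (Bas bs) P w c = 0) \<longleftrightarrow>
              (\<exists>v. vec_on (Bas as) v \<and> (\<forall>b\<in>Bas bs. w b = mv (Bas as) M v b)))) \<longleftrightarrow>
      (\<forall>w\<in>VS bs. mv (Bas bs) P w = 0 \<longleftrightarrow> w \<in> mv (Bas as) M ` VS as)"
      unfolding vec_on_VS[of bs] Ball_def[of "VS bs"] 2 by (intro all_cong1 imp_cong refl arg_cong2[where f = "(=)"] 3)
    then show ?thesis unfolding A by (rule arg_cong)
  qed
  show ?thesis
  proof
    assume "coker_iso as bs gs M"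
    then obtain P where P: "is_hom bs gs P" and b: "mv (Bas bs) P ` VS bs = VS gs"
      "\<forall>w\<in>VS bs. mv (Bas bs) P w = 0 \<longleftrightarrow> w \<in> mv (Bas as) M ` VS as"
    proof -
      obtain P where P: "is_hom bs gs P" "((\<forall>u. vec_on (Bas gs) u \<longrightarrow> (\<exists>w. vec_on (Bas bs) w \<and> (\<forall>c\<in>Bas gs. mv (Bas bs) P w c = u c))) \<and>
        (\<forall>w. vec_on (Bas bs) w \<longrightarrow> ((\<forall>c\<in>Bas gs. mv (Bas bs) P w c = 0) \<longleftrightarrow>
              (\<exists>v. vec_on (Bas as) v \<and> (\<forall>b\<in>Bas bs. w b = mv (Bas as) M v b)))))"
        using \<open>coker_iso as bs gs M\<close> unfolding coker_iso_def by (elim exE conjE) (rule that, assumption, intro conjI)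
      moreover have "P \<in> Hom bs gs" using P(1) is_hom_iff by blast
      ultimately show ?thesis using that body by blast
    qed
    then show "coker_fun as bs gs (mv (Bas as) M)" unfolding coker_fun_def using P is_hom_iff by blast
  next
    assume "coker_fun as bs gs (mv (Bas as) M)"
    then obtain F where F: "thom bs gs F" "F ` VS bs = VS gs" "\<forall>w\<in>VS bs. F w = 0 \<longleftrightarrow> w \<in> mv (Bas as) M ` VS as"
      unfolding coker_fun_def by blast
    have lF: "lin F" "\<And>v. v \<in> VS bs \<Longrightarrow> F v \<in> VS gs" using F(1) by (auto simp: thom_def)
    define P where "P = mat_of bs F"
    have PH: "P \<in> Hom bs gs" unfolding P_def by (rule mat_of_Hom) (rule lF)
    have Pv: "mv (Bas bs) P v = F v" if "v \<in> VS bs" for v unfolding P_def by (rule mv_mat_of[OF lF(1) that])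
    have "is_hom bs gs P" unfolding is_hom_iff using PH F(1) Pv by (simp add: thom_def lin_mv)
    moreover have "mv (Bas bs) P ` VS bs = VS gs" using F(2) Pv by (simp cong: image_cong)
    moreover have "\<forall>w\<in>VS bs. mv (Bas bs) P w = 0 \<longleftrightarrow> w \<in> mv (Bas as) M ` VS as" using F(3) Pv by simp
    ultimately show "coker_iso as bs gs M" unfolding coker_iso_def
      by (intro exI[of _ P] conjI[OF _ iffD2[OF body[OF PH]]] conjI)
  qed
qed

lemma Vset_iff: "M \<in> Vset as bs gs \<longleftrightarrow> M \<in> Hom as bs \<and> thom as bs (mv (Bas as) M) \<and>
    inj_on (mv (Bas as) M) (VS as) \<and> coker_fun as bs gs (mv (Bas as) (M :: 'k::field mat))"
  unfolding Vset_def mem_Collect_eq is_hom_iff by (auto simp: inj_mat_iff coker_iso_iff)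

text \<open>The cokernel map restricts to a surjection from \<open>T^q N_bs\<close> onto
  \<open>T^q N_gs\<close>, whose kernel is the image of the subspace measured by
  \<open>kdim q q\<close>. Hence this invariant takes the same value on all of
  \<open>Vset\<close>.\<close>

lemma kdim_coker:
  assumes "M \<in> Vset as bs gs"
  shows "kdim q q (as, bs, mv (Bas as) (M :: 'k::field mat)) + fv.dim (Wsub q q gs :: (idx \<Rightarrow> 'k) set)
    = fv.dim (Wsub q q bs :: (idx \<Rightarrow> 'k) set)"
proof -
  let ?F = "mv (Bas as) M"
  have M: "M \<in> Hom as bs" "inj_on ?F (VS as)" "coker_fun as bs gs ?F" using assms by (auto simp: Vset_iff)
  obtain P where P: "thom bs gs P" "P ` VS bs = VS gs" "\<forall>w\<in>VS bs. P w = 0 \<longleftrightarrow> w \<in> ?F ` VS as"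
    using M(3) unfolding coker_fun_def by blast
  have lP: "lin P" using P(1) by (simp add: thom_def)
  let ?S = "Wsub q q bs :: (idx \<Rightarrow> 'k) set"
  have SV: "?S \<subseteq> VS bs" by (auto simp: Wsub_def)
  have "P ` ?S = Wsub q q gs"
  proof -
    have "P ` ?S = (\<lambda>v. P ((tshift bs ^^ q) v)) ` VS bs" unfolding Wsub_image by (simp add: image_image)
    also have "\<dots> = (\<lambda>v. (tshift gs ^^ q) (P v)) ` VS bs" by (rule image_cong[OF refl]) (rule thom_pow[OF P(1)])
    also have "\<dots> = (tshift gs ^^ q) ` P ` VS bs" by (simp add: image_image)
    finally show ?thesis unfolding P(2) Wsub_image .
  qed
  moreover have "{w \<in> ?S. P w = 0} = ?F ` Ksub q q (as, bs, ?F)"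
  proof (intro equalityI subsetI)
    fix w assume w: "w \<in> {w \<in> ?S. P w = 0}"
    then have "w \<in> ?F ` VS as" using P(3) SV by blast
    then show "w \<in> ?F ` Ksub q q (as, bs, ?F)" using w by auto
  next
    fix w assume "w \<in> ?F ` Ksub q q (as, bs, ?F)"
    then obtain v where "v \<in> VS as" "w = ?F v" "w \<in> ?S" by auto
    then show "w \<in> {w \<in> ?S. P w = 0}" using P(3) SV by blast
  qed
  moreover have "fv.dim (?F ` Ksub q q (as, bs, ?F)) = kdim q q (as, bs, ?F)"
    unfolding kdim_def by (rule dim_inj_image[OF lin_mv subspace_Ksub[OF lin_mv]]) (use M(2) in \<open>auto intro: inj_on_subset\<close>)
  moreover have "fv.dim (P ` ?S) + fv.dim {w \<in> ?S. P w = 0} = fv.dim ?S"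
    by (rule rank_nullity[OF lP subspace_Wsub SV finite_Bas])
  ultimately show ?thesis by (metis add.commute)
qed

lemma tiso_VS: "tiso xs ys F \<Longrightarrow> v \<in> VS xs \<Longrightarrow> F v \<in> VS ys"
  by (simp add: tiso_def thom_def)

lemma orbit_Vset:
  assumes "f \<in> Vset as bs gs" "M \<in> orbit as bs (f :: 'k::field mat)"
  shows "M \<in> Vset as bs gs"
proof -
  let ?f = "mv (Bas as) f" and ?M = "mv (Bas as) M"
  have f: "f \<in> Hom as bs" "thom as bs ?f" "inj_on ?f (VS as)" "coker_fun as bs gs ?f" using assms(1) by (auto simp: Vset_iff)
  have M: "M \<in> Hom as bs" "emb_iso_fun as bs ?f as bs ?M" using assms(2) unfolding orbit_iff[OF f(1)] by auto
  obtain \<phi> \<psi> where 1: "tiso as as \<phi>" "tiso bs bs \<psi>" "\<forall>v\<in>VS as. \<psi> (?f v) = ?M (\<phi> v)"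
    using M(2) unfolding emb_iso_fun_def by blast
  obtain \<phi>' where p: "tiso as as \<phi>'" "\<And>v. v \<in> VS as \<Longrightarrow> \<phi>' (\<phi> v) = v" "\<And>w. w \<in> VS as \<Longrightarrow> \<phi> (\<phi>' w) = w"
    using tiso_inverse[OF 1(1)] by blast
  obtain \<psi>' where q: "tiso bs bs \<psi>'" "\<And>v. v \<in> VS bs \<Longrightarrow> \<psi>' (\<psi> v) = v" "\<And>w. w \<in> VS bs \<Longrightarrow> \<psi> (\<psi>' w) = w"
    using tiso_inverse[OF 1(2)] by blast
  note m = tiso_VS[OF p(1)] tiso_VS[OF 1(1)] tiso_VS[OF q(1)] tiso_VS[OF 1(2)]
  have Meq: "?M w = \<psi> (?f (\<phi>' w))" if "w \<in> VS as" for w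
  proof -
    have "\<psi> (?f (\<phi>' w)) = ?M (\<phi> (\<phi>' w))" using 1(3) m(1)[OF that] by blast
    then show ?thesis unfolding p(3)[OF that] by (rule sym)
  qed
  have t: "thom as as \<phi>'" "thom bs bs \<psi>" "thom bs bs \<psi>'" using p(1) 1(2) q(1) by (simp_all add: tiso_def)
  have "thom as bs (\<lambda>w. \<psi> (?f (\<phi>' w)))" by (rule thom_comp[OF thom_comp[OF t(1) f(2)] t(2)])
  then have tM: "thom as bs ?M" using Meq by (simp add: thom_def lin_mv)
  have "inj_on (\<lambda>w. \<psi> (?f (\<phi>' w))) (VS as)"
  proof (rule inj_onI)
    fix u v assume uv: "u \<in> VS as" "v \<in> VS as" "\<psi> (?f (\<phi>' u)) = \<psi> (?f (\<phi>' v))"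
    have "?f (\<phi>' u) = ?f (\<phi>' v)"
      using arg_cong[OF uv(3), of \<psi>'] unfolding q(2)[OF mv_VS[OF f(1)]] .
    then have "\<phi>' u = \<phi>' v" using inj_onD[OF f(3)] m(1)[OF uv(1)] m(1)[OF uv(2)] by blast
    then show "u = v" using arg_cong[of "\<phi>' u" "\<phi>' v" \<phi>] unfolding p(3)[OF uv(1)] p(3)[OF uv(2)] by blast
  qed
  then have iM: "inj_on ?M (VS as)" using Meq by (simp cong: inj_on_cong)
  obtain P where P: "thom bs gs P" "P ` VS bs = VS gs" "\<forall>w\<in>VS bs. P w = 0 \<longleftrightarrow> w \<in> ?f ` VS as"
    using f(4) unfolding coker_fun_def by blast
  have "coker_fun as bs gs ?M" unfolding coker_fun_def
  proof (intro exI conjI ballI)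
    show "thom bs gs (\<lambda>w. P (\<psi>' w))" by (rule thom_comp[OF t(3) P(1)])
    have "\<psi>' ` VS bs = VS bs" using q(1) by (simp add: tiso_def bij_betw_def)
    then show "(\<lambda>w. P (\<psi>' w)) ` VS bs = VS gs" unfolding P(2)[symmetric] by (metis image_image)
    fix w :: "idx \<Rightarrow> 'k" assume w: "w \<in> VS bs"
    have "P (\<psi>' w) = 0 \<longleftrightarrow> \<psi>' w \<in> ?f ` VS as" using P(3) m(3)[OF w] by blast
    also have "\<dots> \<longleftrightarrow> w \<in> ?M ` VS as"
    proof
      assume "\<psi>' w \<in> ?f ` VS as"
      then obtain v where v: "v \<in> VS as" "\<psi>' w = ?f v" by blast
      have "w = ?M (\<phi> v)" using q(3)[OF w] v 1(3) by simp
      then show "w \<in> ?M ` VS as" using m(2)[OF v(1)] by blast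
    next
      assume "w \<in> ?M ` VS as"
      then obtain v where v: "v \<in> VS as" "w = ?M v" by blast
      have "\<psi>' w = ?f (\<phi>' v)" unfolding v(2) Meq[OF v(1)] by (rule q(2)[OF mv_VS[OF f(1)]])
      then show "\<psi>' w \<in> ?f ` VS as" using m(1)[OF v(1)] by blast
    qed
    finally show "P (\<psi>' w) = 0 \<longleftrightarrow> w \<in> ?M ` VS as" .
  qed
  then show ?thesis using M(1) tM iM by (simp add: Vset_iff)
qed

text \<open>\<open>topology\<close> returns the intended open sets only after the axioms are
  verified: intersections use pairwise products, with no zero divisors in a field, and unions use
  the union of the defining families.\<close>

lemma openin_zariski: "openin (zariski X) U \<longleftrightarrow> (\<exists>F \<subseteq> polyfun. U = X - {M \<in> X. \<forall>p\<in>F. p M = (0 :: 'k::field)})"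
proof -
  let ?L = "\<lambda>U. \<exists>F \<subseteq> polyfun. U = X - {M \<in> X. \<forall>p\<in>F. p M = (0 :: 'k)}"
  have "istopology ?L" unfolding istopology_def
  proof (intro conjI allI impI)
    fix S T assume "?L S" "?L T"
    then obtain F G where F: "F \<subseteq> polyfun" "S = X - {M \<in> X. \<forall>p\<in>F. p M = 0}"
      and G: "G \<subseteq> polyfun" "T = X - {M \<in> X. \<forall>p\<in>G. p M = 0}" by blast
    let ?H = "{\<lambda>M. p M * q M |p q. p \<in> F \<and> q \<in> G}"
    have "?H \<subseteq> polyfun" using F(1) G(1) by (auto intro: pf_mult)
    moreover have "S \<inter> T = X - {M \<in> X. \<forall>p\<in>?H. p M = 0}"
    proof (intro equalityI subsetI)
      fix M assume "M \<in> S \<inter> T"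
      then obtain p q where "M \<in> X" "p \<in> F" "p M \<noteq> 0" "q \<in> G" "q M \<noteq> 0" using F(2) G(2) by blast
      moreover have "(\<lambda>M. p M * q M) \<in> ?H" using calculation by blast
      moreover have "p M * q M \<noteq> 0" using calculation by simp
      ultimately show "M \<in> X - {M \<in> X. \<forall>p\<in>?H. p M = 0}" by fast
    next
      fix M assume "M \<in> X - {M \<in> X. \<forall>p\<in>?H. p M = 0}"
      then obtain p q where "M \<in> X" "p \<in> F" "q \<in> G" "p M * q M \<noteq> 0" by auto
      then show "M \<in> S \<inter> T" using F(2) G(2) by auto
    qed
    ultimately show "?L (S \<inter> T)" by blast
  next
    fix K assume K: "\<forall>U\<in>K. ?L U"
    define F where "F U = (SOME F. F \<subseteq> polyfun \<and> U = X - {M \<in> X. \<forall>p\<in>F. p M = 0})" for U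
    have F: "F U \<subseteq> polyfun" "U = X - {M \<in> X. \<forall>p\<in>F U. p M = 0}" if "U \<in> K" for U
      using someI_ex[OF bspec[OF K that]] unfolding F_def by (rule conjunct1, rule conjunct2)
    have "(\<Union>U\<in>K. F U) \<subseteq> polyfun" using F(1) by (rule UN_least)
    moreover have "\<Union> K = X - {M \<in> X. \<forall>p\<in>(\<Union>U\<in>K. F U). p M = 0}"
    proof (intro equalityI subsetI)
      fix M assume "M \<in> \<Union> K"
      then obtain U where U: "U \<in> K" "M \<in> U" by blast
      have "M \<in> X \<and> \<not> (\<forall>p\<in>F U. p M = 0)" using U(2) by (subst (asm) F(2)[OF U(1)]) simp
      then show "M \<in> X - {M \<in> X. \<forall>p\<in>(\<Union>U\<in>K. F U). p M = 0}" using U(1) by auto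
    next
      fix M assume "M \<in> X - {M \<in> X. \<forall>p\<in>(\<Union>U\<in>K. F U). p M = 0}"
      then obtain U where U: "U \<in> K" "M \<in> X \<and> \<not> (\<forall>p\<in>F U. p M = 0)" by auto
      have "M \<in> U" using U(2) by (subst F(2)[OF U(1)]) simp
      then show "M \<in> \<Union> K" using U(1) by (rule UnionI[rotated])
    qed
    ultimately show "?L (\<Union> K)" by blast
  qed
  then show ?thesis unfolding zariski_def by (simp only: topology_inverse')
qed

lemma topspace_zariski: "topspace (zariski X) = (X :: 'k::field mat set)"
proof
  show "topspace (zariski X) \<subseteq> X"
    using openin_topspace[of "zariski X"] unfolding openin_zariski by blast
  have "X = X - {M \<in> X. \<forall>p\<in>{\<lambda>M. 1}. p M = (0 :: 'k)}" by auto
  then have "openin (zariski X) X" unfolding openin_zariski by (intro exI[of _ "{\<lambda>M. 1}"]) (auto intro: pf_const)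
  then show "X \<subseteq> topspace (zariski X)" by (rule openin_subset)
qed

text \<open>One polynomial already gives an open neighbourhood, and every neighbourhood of
  \<open>g\<close> contains one defined by a single polynomial that is nonzero at
  \<open>g\<close>.\<close>

lemma in_closure_zariski:
  assumes "S \<subseteq> V" "V \<subseteq> X"
  shows "g \<in> subtopology (zariski X) V closure_of S \<longleftrightarrow>
    g \<in> V \<and> (\<forall>p\<in>polyfun. (\<forall>M\<in>S. p M = 0) \<longrightarrow> p g = (0 :: 'k::field))"
proof -
  have "g \<in> subtopology (zariski X) V closure_of S \<longleftrightarrow> g \<in> V \<and> (\<forall>U. openin (zariski X) U \<and> g \<in> U \<longrightarrow> (\<exists>M\<in>S. M \<in> U))"
  proof
    assume "g \<in> subtopology (zariski X) V closure_of S"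
    then have g: "g \<in> V" and c: "\<And>T. openin (subtopology (zariski X) V) T \<Longrightarrow> g \<in> T \<Longrightarrow> \<exists>y. y \<in> S \<and> y \<in> T"
      by (simp_all add: in_closure_of topspace_subtopology)
    have "\<exists>M\<in>S. M \<in> U" if U: "openin (zariski X) U" "g \<in> U" for U
    proof -
      have "g \<in> U \<inter> V" using g U(2) by (rule IntI[rotated])
      from c[OF openin_subtopology_Int[OF U(1)] this] obtain y where "y \<in> S" "y \<in> U \<inter> V" by (elim exE conjE)
      then show ?thesis by (elim IntE) (rule bexI)
    qed
    then show "g \<in> V \<and> (\<forall>U. openin (zariski X) U \<and> g \<in> U \<longrightarrow> (\<exists>M\<in>S. M \<in> U))" using g by blast
  next
    assume h: "g \<in> V \<and> (\<forall>U. openin (zariski X) U \<and> g \<in> U \<longrightarrow> (\<exists>M\<in>S. M \<in> U))"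
    have "\<exists>y. y \<in> S \<and> y \<in> T" if T: "openin (subtopology (zariski X) V) T" "g \<in> T" for T
    proof -
      obtain U where U: "openin (zariski X) U" "T = U \<inter> V" using T(1) unfolding openin_subtopology by blast
      have "g \<in> U" using T(2) U(2) by blast
      then obtain M where "M \<in> S" "M \<in> U" using h U(1) by blast
      then show ?thesis using U(2) assms(1) by blast
    qed
    moreover have "g \<in> topspace (subtopology (zariski X) V)"
      using h assms(2) by (auto simp: topspace_subtopology topspace_zariski)
    ultimately show "g \<in> subtopology (zariski X) V closure_of S" by (simp add: in_closure_of)
  qed
  also have "\<dots> \<longleftrightarrow> g \<in> V \<and> (\<forall>p\<in>polyfun. (\<forall>M\<in>S. p M = 0) \<longrightarrow> p g = 0)"
  proof (intro conj_cong refl iffI ballI impI allI)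
    fix p assume gV: "g \<in> V" and c: "\<forall>U. openin (zariski X) U \<and> g \<in> U \<longrightarrow> (\<exists>M\<in>S. M \<in> U)"
      and p: "p \<in> polyfun" and z: "\<forall>M\<in>S. p M = 0"
    show "p g = 0"
    proof (rule ccontr)
      assume nz: "p g \<noteq> 0"
      let ?U = "X - {M \<in> X. \<forall>p\<in>{p}. p M = 0}"
      have "openin (zariski X) ?U" unfolding openin_zariski using p by (intro exI[of _ "{p}"]) simp
      moreover have "g \<in> ?U" using gV assms(2) nz by auto
      ultimately have "\<exists>M\<in>S. M \<in> ?U" by (intro c[rule_format] conjI)
      then obtain M where M: "M \<in> S" "M \<in> ?U" by (elim bexE)
      have "p M = 0" using z M(1) by (rule bspec)
      then show False using M(2) by simp
    qed
  next
    fix U assume gV: "g \<in> V" and c: "\<forall>p\<in>polyfun. (\<forall>M\<in>S. p M = 0) \<longrightarrow> p g = 0"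
      and U: "openin (zariski X) U \<and> g \<in> U"
    obtain F where F: "F \<subseteq> polyfun" "U = X - {M \<in> X. \<forall>p\<in>F. p M = 0}" using U unfolding openin_zariski by blast
    have "\<not> (\<forall>p\<in>F. p g = 0)" using U unfolding F(2) by auto
    then obtain p where p: "p \<in> F" "p g \<noteq> 0" by auto
    have "\<not> (\<forall>M\<in>S. p M = 0)" using c[rule_format, of p] subsetD[OF F(1) p(1)] p(2) by auto
    then obtain M where M: "M \<in> S" "p M \<noteq> 0" by auto
    have "M \<in> X" using M(1) assms by (meson subsetD)
    then have "M \<in> U" unfolding F(2) using p(1) M(2) by auto
    then show "\<exists>M\<in>S. M \<in> U" using M(1) by (rule bexI)
  qed
  finally show ?thesis .
qed

text \<open>Both orbits lie in \<open>Vset\<close>, so taking the closure in the subspace or testing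
  polynomials on the whole affine space amounts to the same.\<close>

lemma deg_le_iff_degen:
  assumes f: "f \<in> Vset as bs gs" and g: "g \<in> Vset as bs (gs :: nat list)"
  shows "deg_le as bs gs f g \<longleftrightarrow> degen as bs f (g :: 'k::field mat)"
proof -
  have V: "orbit as bs f \<subseteq> Vset as bs gs" "orbit as bs g \<subseteq> Vset as bs gs" using orbit_Vset f g by blast+
  have "Vset as bs gs \<subseteq> (Hom as bs :: 'k mat set)" by (rule subsetI) (simp add: Vset_iff)
  note c = in_closure_zariski[OF V(1) this]
  show ?thesis unfolding deg_le_def degen_def subset_iff c using V(2) by blast
qed

section \<open>Matching the matrix definitions of sums and diagrams\<close>

lemma dsum_Hom:
  assumes "M \<in> Hom xs ys" "M' \<in> Hom xs' ys'"
  shows "snd (snd (dsum (xs, ys, M) (xs', ys', M'))) \<in> Hom (xs @ xs') (ys @ ys')"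
proof (rule HomI)
  fix b a assume o: "b \<notin> Bas (ys @ ys') \<or> a \<notin> Bas (xs @ xs')"
  obtain i j i' j' where ab: "b = (i, j)" "a = (i', j')" by (metis prod.exhaust)
  show "snd (snd (dsum (xs, ys, M) (xs', ys', M'))) b a = 0"
    using o HomD[OF assms(1), of b a] HomD[OF assms(2), of "(i - length ys, j)" "(i' - length xs, j')"]
    unfolding ab mem_Bas_append by auto
qed

lemma summand_Hom:
  assumes "valid_summand s"
  shows "snd (snd (summand_emb s)) \<in> Hom (sub_shape s) (amb_shape s)"
proof (cases s)
  case (Picket l m)
  then show ?thesis using assms by (intro HomI) (auto simp: Bas_single)
next
  case (Bipicket m r)
  then show ?thesis using assms by (intro HomI) (auto simp: Bas_pair Bas_2)
qed

lemma dsum_list_Hom: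
  "list_all valid_summand ss \<Longrightarrow> snd (snd (dsum_list ss :: 'k::comm_semiring_1 emb)) \<in> Hom (concat (map sub_shape ss)) (concat (map amb_shape ss))"
proof (induction ss)
  case Nil
  show ?case by (auto simp: Hom_def)
next
  case (Cons s ss)
  obtain M where M: "dsum_list ss = (concat (map sub_shape ss), concat (map amb_shape ss), M :: 'k mat)"
    using dsum_list_shape[of ss, where 'k = 'k] by (metis prod.collapse)
  obtain N where N: "summand_emb s = (sub_shape s, amb_shape s, N :: 'k mat)" by (cases s) auto
  have "M \<in> Hom (concat (map sub_shape ss)) (concat (map amb_shape ss))" using Cons M by simp
  moreover have "N \<in> Hom (sub_shape s) (amb_shape s)" using summand_Hom[of s, where 'a = 'k] Cons.prems N by simp
  ultimately show ?case using dsum_Hom[of N "sub_shape s" "amb_shape s" M] by (simp add: M N)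
qed

lemma emb_iso_eqv:
  assumes "M \<in> Hom as bs" "list_all valid_summand ss"
  shows "emb_iso (as, bs, M) (dsum_list ss) \<longleftrightarrow> eqv (as, bs, mv (Bas as) M) (fsum_list ss :: 'k::field femb)"
proof -
  obtain N where N: "dsum_list ss = (concat (map sub_shape ss), concat (map amb_shape ss), N :: 'k mat)"
    using dsum_list_shape[of ss, where 'k = 'k] by (metis prod.collapse)
  have "N \<in> Hom (concat (map sub_shape ss)) (concat (map amb_shape ss))" using dsum_list_Hom[OF assms(2), where 'k = 'k] N by simp
  then show ?thesis using emb_iso_iff[OF assms(1)] by (simp add: N fsum_list_def)
qed

text \<open>Any decomposition may be used to evaluate the definite description, since
  \<open>diag_unique\<close> makes all of them agree.\<close>

lemma arc_diag_eq:
  assumes M: "M \<in> Hom as bs" "thom as bs (mv (Bas as) M)" and ss: "list_all valid_summand ss"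
    and e: "eqv (as, bs, mv (Bas as) M) (fsum_list ss :: 'k::field femb)"
  shows "arc_diag (as, bs, M) = diag ss"
  unfolding arc_diag_def
proof (rule the_equality)
  show "\<exists>ss'. list_all valid_summand ss' \<and> emb_iso (as, bs, M) (dsum_list ss') \<and> diag ss = sum_list (map summand_diag ss')"
    using ss e emb_iso_eqv[OF M(1) ss] by (auto simp: diag_def)
  fix D assume "\<exists>ss'. list_all valid_summand ss' \<and> emb_iso (as, bs, M) (dsum_list ss') \<and> D = sum_list (map summand_diag ss')"
  then obtain ss' where ss': "list_all valid_summand ss'" "eqv (as, bs, mv (Bas as) M) (fsum_list ss')" "D = diag ss'"
    using emb_iso_eqv[OF M(1)] by (auto simp: diag_def)
  have "hemb (as, bs, mv (Bas as) M)" using M(2) by simp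
  then show "D = diag ss" using diag_unique[OF _ ss'(2) e ss'(1) ss] ss'(3) by simp
qed

lemma moves_lift:
  fixes g :: "'k::alg_closed_field mat"
  assumes g: "g \<in> Hom as bs" "thom as bs (mv (Bas as) g)" and v: "list_all valid_summand ss"
    and e: "eqv (as, bs, mv (Bas as) g) (fsum_list ss)" and moves: "arc_move\<^sup>*\<^sup>* (diag ss) D"
  shows "\<exists>f ts. f \<in> Hom as bs \<and> thom as bs (mv (Bas as) f) \<and> list_all valid_summand ts \<and>
    eqv (as, bs, mv (Bas as) f) (fsum_list ts) \<and> diag ts = D \<and> degen as bs f g"
  using moves
proof (induction rule: rtranclp_induct)
  case base
  then show ?case using g v e degen_refl by blast
next
  case (step D D')
  then obtain f ts where f: "f \<in> Hom as bs" "thom as bs (mv (Bas as) f)" "list_all valid_summand ts"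
    "eqv (as, bs, mv (Bas as) f) (fsum_list ts)" "diag ts = D" "degen as bs f g" by blast
  then show ?case using move_lift[OF f(1-4), of D'] step.hyps(2) degen_trans by blast
qed

theorem theorem1p2:
  fixes as bs gs :: "nat list" and f g :: "('k::alg_closed_field) mat"
  assumes "is_partition as" and "is_partition bs" and "is_partition gs"
    and "\<forall>x\<in>set as. x \<le> 2"
    and "f \<in> Vset as bs gs" and "g \<in> Vset as bs gs"
  shows "deg_le as bs gs f g \<longleftrightarrow> arc_le (arc_diag (as, bs, f)) (arc_diag (as, bs, g))"
proof -
  let ?f = "mv (Bas as) f" and ?g = "mv (Bas as) g"
  have f: "f \<in> Hom as bs" "thom as bs ?f" "inj_on ?f (VS as)" using assms(5) by (auto simp: Vset_iff)
  have g: "g \<in> Hom as bs" "thom as bs ?g" "inj_on ?g (VS as)" using assms(6) by (auto simp: Vset_iff)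
  obtain ss where ss: "list_all valid_summand ss" "eqv (as, bs, ?f) (fsum_list ss)"
    using decomposition_exists[OF f(2,3) assms(4)] by blast
  obtain ts where ts: "list_all valid_summand ts" "eqv (as, bs, ?g) (fsum_list ts)"
    using decomposition_exists[OF g(2,3) assms(4)] by blast
  have hf: "hemb (as, bs, ?f)" and hg: "hemb (as, bs, ?g)" using f(2) g(2) by simp_all
  have kf: "kdim p q (as, bs, ?f) = hom_count p q (diag ss)" if "q \<le> p" for p q
    using kdim_eqv[OF ss(2) hf] kdim_fsum_list[OF ss(1) that, where 'k = 'k] by simp
  have kg: "kdim p q (as, bs, ?g) = hom_count p q (diag ts)" if "q \<le> p" for p q
    using kdim_eqv[OF ts(2) hg] kdim_fsum_list[OF ts(1) that, where 'k = 'k] by simp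
  have "degen as bs f g \<longleftrightarrow> arc_move\<^sup>*\<^sup>* (diag ts) (diag ss)"
  proof
    assume d: "degen as bs f g"
    \<comment> \<open>Otherwise some polynomial would vanish on the orbit of \<open>f\<close>, where
      the invariant has a constant larger value, but not at \<open>g\<close>.\<close>
    have le: "hom_count p q (diag ss) \<le> hom_count p q (diag ts)" if pq: "q \<le> p" for p q
    proof (rule ccontr)
      assume "\<not> ?thesis"
      then have "kdim p q (as, bs, ?g) < kdim p q (as, bs, ?f)" using kf[OF pq] kg[OF pq] by simp
      then obtain P where P: "P \<in> polyfun" "P g \<noteq> 0"
        "\<forall>M\<in>Hom as bs. kdim p q (as, bs, ?f) \<le> fv.dim {v \<in> VS as. mv (Bas as) M v \<in> Wsub p q bs} \<longrightarrow> P M = 0"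
        using semicontinuity[OF g(1) subspace_Wsub[of p q bs], of "kdim p q (as, bs, ?f)"]
        unfolding kdim_def Ksub.simps by blast
      have "P M = 0" if M: "M \<in> orbit as bs f" for M
      proof -
        have MH: "M \<in> Hom as bs" and "eqv (as, bs, ?f) (as, bs, mv (Bas as) M)"
          using M unfolding orbit_iff[OF f(1)] by simp_all
        then have "kdim p q (as, bs, ?f) = kdim p q (as, bs, mv (Bas as) M)" using kdim_eqv hf by blast
        then show ?thesis using P(3) MH unfolding kdim_def Ksub.simps by simp
      qed
      moreover have "g \<in> orbit as bs g" unfolding orbit_iff[OF g(1)] using g(1) emb_iso_fun_refl by blast
      ultimately have "P g = 0" using d P(1) unfolding degen_def by blast
      then show False using P(2) by blast
    qed
    \<comment> \<open>Both maps have the same ambient module and cokernel.\<close>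
    have eq: "hom_count q q (diag ss) = hom_count q q (diag ts)" for q
      using kdim_coker[OF assms(5), of q] kdim_coker[OF assms(6), of q] kf[of q q] kg[of q q] by simp
    obtain F1 where F1: "fsum_list ss = (concat (map sub_shape ss), concat (map amb_shape ss), F1 :: (idx \<Rightarrow> 'k) \<Rightarrow> _)" using fsum_list_shape by blast
    obtain F2 where F2: "fsum_list ts = (concat (map sub_shape ts), concat (map amb_shape ts), F2 :: (idx \<Rightarrow> 'k) \<Rightarrow> _)" using fsum_list_shape by blast
    obtain \<phi> where 1: "tiso as (concat (map sub_shape ss)) (\<phi> :: (idx \<Rightarrow> 'k) \<Rightarrow> _)"
      using ss(2) unfolding F1 eqv.simps emb_iso_fun_def by blast
    obtain \<phi>' where 2: "tiso as (concat (map sub_shape ts)) (\<phi>' :: (idx \<Rightarrow> 'k) \<Rightarrow> _)"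
      using ts(2) unfolding F2 eqv.simps emb_iso_fun_def by blast
    have "num_arcs (diag ss) = num_arcs (diag ts)"
      using tiso_sizes[OF 1, of 1] tiso_sizes[OF 2, of 1] num_arcs_diag ss(1) ts(1) by metis
    then show "arc_move\<^sup>*\<^sup>* (diag ts) (diag ss)"
      using arc_moves_reachable(1)[OF _ _ le eq] valid_diag ss(1) ts(1) by blast
  next
    assume "arc_move\<^sup>*\<^sup>* (diag ts) (diag ss)"
    then obtain h us where h: "h \<in> Hom as bs" "thom as bs (mv (Bas as) h)" "list_all valid_summand us"
      "eqv (as, bs, mv (Bas as) h) (fsum_list us)" "diag us = diag ss" "degen as bs h g"
      using moves_lift[OF g(1,2) ts] by blast
    have hh: "hemb (as, bs, mv (Bas as) h)" using h(2) by simp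
    \<comment> \<open>The moves produce a map \<open>h\<close> with the diagram of \<open>f\<close>
      but no control over the map itself; equality of diagrams over the same ambient module puts it
      into the orbit of \<open>f\<close>.\<close>
    have "eqv (as, bs, ?f) (as, bs, mv (Bas as) h)"
      by (rule eqv_of_diag_eq[OF ss(1) h(3) h(5)[symmetric] hf hh ss(2) h(4)]) simp
    then have ho: "h \<in> orbit as bs f" unfolding orbit_iff[OF f(1)] using h(1) by simp
    have "degen as bs f h"
      by (rule degenI[OF f(1) h(1)]) (use ho in blast)
    then show "degen as bs f g" using h(6) by (rule degen_trans)
  qed
  then show ?thesis
    unfolding deg_le_iff_degen[OF assms(5,6)] arc_le_def arc_diag_eq[OF f(1,2) ss] arc_diag_eq[OF g(1,2) ts] .
qed

end
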